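(* Let $n\ge1$, and let $G=\mathrm{F}^\times\times\mathrm{GL}_n(\mathrm{F})\times\mathrm{F}^\times$ act on $V=\mathrm{F}^n\times\mathrm{F}^n$ by $(a,g,b)\cdot(x,y)=(axg^{-1},\,b^{-1}yg^t)$, where $x,y\in\mathrm{F}^n$ are row vectors, $a,b\in\mathrm{F}^\times$, $g\in\mathrm{GL}_n(\mathrm{F})$ and $g^t$ is the transpose of $g$. Then for any character $\underline{\chi}$ of $G$, $$\dim D(V)^{\underline{\chi}}\le 1.$$
   Context: $\mathrm{F}$ is a non-archimedean local field of characteristic zero. A character of $G$ is a homomorphism $G\to\mathbb{C}^\times$ continuous for the discrete topology on $\mathbb{C}^\times$. $\mathcal{S}(V)$ is the space of locally constant compactly supported functions $V\to\mathbb{C}$, with $(g\cdot\phi)(v)=\phi(g^{-1}\cdot v)$ for $g\in G$. $D(V)^{\underline{\chi}}$ is the space of linear functionals $\xi:\mathcal{S}(V)\to\mathbb{C}$ with $\xi(g\cdot\phi)=\underline{\chi}(g)\xi(\phi)$ for all $g\in G$, $\phi\in\mathcal{S}(V)$. *)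

theory Defs
  imports "HOL-Analysis.Analysis" "HOL-Algebra.Group" "HOL-Library.Function_Algebras"
begin

text \<open>
  A non-archimedean local field of characteristic zero is a field of characteristic zero with a
  locally compact topology that is induced by a nontrivial non-archimedean absolute value. The
  absolute value itself is not part of the structure.
\<close>

class nonarch_local_field = field_char_0 + topological_space +
  assumes nonarch_abs_topology:
    "\<exists>v :: 'a \<Rightarrow> real.
       (\<forall>x. 0 \<le> v x) \<and> (\<forall>x. v x = 0 \<longleftrightarrow> x = 0) \<and>
       (\<forall>x y. v (x * y) = v x * v y) \<and>
       (\<forall>x y. v (x + y) \<le> max (v x) (v y)) \<and>
       (\<exists>x. x \<noteq> 0 \<and> v x \<noteq> 1) \<and>
       (\<forall>U. open U \<longleftrightarrow> (\<forall>x\<in>U. \<exists>e>0. \<forall>y. v (y - x) < e \<longrightarrow> y \<in> U))"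
    and locally_compact: "\<exists>U K. open U \<and> x \<in> U \<and> U \<subseteq> K \<and> compact K"

definition units_group :: "'a::field monoid" where
  "units_group = \<lparr>carrier = {a. a \<noteq> 0}, mult = (*), one = 1\<rparr>"

definition GL :: "('a::field ^ 'n ^ 'n) monoid" where
  "GL = \<lparr>carrier = {g. invertible g}, mult = (**), one = mat 1\<rparr>"

abbreviation act_group :: "('f::field \<times> ('f ^ 'n ^ 'n) \<times> 'f) monoid" where
  "act_group \<equiv> units_group \<times>\<times> GL \<times>\<times> units_group"

lemma group_units_group: "group (units_group :: 'a::field monoid)"
proof (rule groupI)
  fix x :: 'a assume "x \<in> carrier units_group"
  then show "\<exists>y\<in>carrier units_group. y \<otimes>\<^bsub>units_group\<^esub> x = \<one>\<^bsub>units_group\<^esub>"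
    by (intro bexI[of _ "inverse x"]) (auto simp: units_group_def)
qed (auto simp: units_group_def)

lemma group_GL: "group (GL :: ('a::field ^ 'n ^ 'n) monoid)"
proof (rule groupI)
  fix x :: "'a ^ 'n ^ 'n" assume "x \<in> carrier GL"
  then obtain y where "x ** y = mat 1" "y ** x = mat 1"
    by (auto simp: GL_def invertible_def)
  then show "\<exists>y\<in>carrier GL. y \<otimes>\<^bsub>GL\<^esub> x = \<one>\<^bsub>GL\<^esub>"
    by (intro bexI[of _ y]) (auto simp: GL_def invertible_def)
qed (auto simp: GL_def matrix_mul_assoc invertible_mult intro: invertible_def[THEN iffD2])

lemma group_act_group: "group (act_group :: ('f::field \<times> ('f ^ 'n ^ 'n) \<times> 'f) monoid)"
  by (intro DirProd_group group_units_group group_GL)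

fun act :: "'f::field \<times> ('f ^ 'n ^ 'n) \<times> 'f \<Rightarrow> ('f ^ 'n) \<times> ('f ^ 'n) \<Rightarrow> ('f ^ 'n) \<times> ('f ^ 'n)" where
  "act (a, g, b) (x, y) = (a *s (x v* matrix_inv g), inverse b *s (y v* transpose g))"

lemma matrix_inv_right_left:
  fixes m :: "'a::field ^ 'n ^ 'n"
  assumes "invertible m"
  shows "m ** matrix_inv m = mat 1" "matrix_inv m ** m = mat 1"
  using someI_ex[OF assms[unfolded invertible_def]] by (simp_all add: matrix_inv_def)

lemma matrix_inv_eqI:
  fixes m :: "'a::field ^ 'n ^ 'n"
  assumes "m ** k = mat 1" "k ** m = mat 1"
  shows "matrix_inv m = k"
proof -
  have "invertible m"
    using assms by (auto simp: invertible_def)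
  then show ?thesis
    using assms(1) by (metis matrix_inv_right_left(2) matrix_mul_assoc matrix_mul_lid matrix_mul_rid)
qed

lemma act_one: "act \<one>\<^bsub>act_group\<^esub> p = p"
proof -
  have "matrix_inv (mat 1 :: 'a ^ 'b ^ 'b) = mat 1"
    by (simp add: matrix_inv_eqI)
  then show ?thesis
    by (cases p) (simp add: units_group_def GL_def transpose_mat)
qed

lemma act_mult:
  assumes "g \<in> carrier act_group" "h \<in> carrier act_group"
  shows "act (g \<otimes>\<^bsub>act_group\<^esub> h) p = act g (act h p)"
proof -
  obtain a m b a' m' b' x y where e: "g = (a, m, b)" "h = (a', m', b')" "p = (x, y)"
    by (metis prod_cases3 surj_pair)
  have m: "invertible m" "invertible m'"
    using assms by (auto simp: e GL_def)
  have i: "matrix_inv m ** m = mat 1" "m ** matrix_inv m = mat 1"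
    "matrix_inv m' ** m' = mat 1" "m' ** matrix_inv m' = mat 1"
    using m by (auto simp: matrix_inv_right_left)
  have "(m ** m') ** (matrix_inv m' ** matrix_inv m) = mat 1"
    "(matrix_inv m' ** matrix_inv m) ** (m ** m') = mat 1"
    using i by (metis matrix_mul_assoc matrix_mul_lid)+
  then have inv: "matrix_inv (m ** m') = matrix_inv m' ** matrix_inv m"
    by (rule matrix_inv_eqI)
  have "(a * a') *s (x v* matrix_inv (m ** m')) =
      a *s ((a' *s (x v* matrix_inv m')) v* matrix_inv m)"
    by (simp add: inv scalar_vector_matrix_assoc vector_smult_assoc vector_matrix_mul_assoc)
  moreover have "inverse (b * b') *s ((m ** m') *v y) =
      inverse b *s (m *v (inverse b' *s (m' *v y)))"
    by (simp add: vector_scalar_commute vector_smult_assoc matrix_vector_mul_assoc mult.commute)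
  ultimately show ?thesis
    by (simp add: e units_group_def GL_def)
qed

text \<open>
  The group carries the subspace topology from \<open>F \<times> M\<^sub>n(F) \<times> F\<close>; inversion is
  continuous on the units of a topological field, so this is the usual group topology.
\<close>

definition is_character :: "('f::nonarch_local_field \<times> ('f ^ 'n ^ 'n) \<times> 'f \<Rightarrow> complex) \<Rightarrow> bool" where
  "is_character chi \<longleftrightarrow> chi \<in> hom act_group units_group \<and>
     continuous_map (top_of_set (carrier act_group)) (discrete_topology (carrier units_group)) chi"

definition schwartz :: "('v::topological_space \<Rightarrow> complex) set" where
  "schwartz = {\<phi>. locally (\<lambda>U. \<phi> constant_on U) UNIV \<and> compact (closure {v. \<phi> v \<noteq> 0})}"

definition translate ::
  "'f::field \<times> ('f ^ 'n ^ 'n) \<times> 'f \<Rightarrow> (('f ^ 'n) \<times> ('f ^ 'n) \<Rightarrow> complex) \<Rightarrow> ('f ^ 'n) \<times> ('f ^ 'n) \<Rightarrow> complex" where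
  "translate g \<phi> = (\<lambda>v. \<phi> (act (inv\<^bsub>act_group\<^esub> g) v))"

definition cscale :: "complex \<Rightarrow> ('a \<Rightarrow> complex) \<Rightarrow> 'a \<Rightarrow> complex" where
  "cscale c f = (\<lambda>x. c * f x)"

global_interpretation cfun: vector_space cscale
  by unfold_locales (auto simp: cscale_def fun_eq_iff algebra_simps)

text \<open>
  A functional on \<open>schwartz\<close> is represented by its extension by \<open>0\<close> to all functions, so that
  equality of functionals on \<open>schwartz\<close> is equality of the representatives.
\<close>

definition functionals :: "(('v::topological_space \<Rightarrow> complex) \<Rightarrow> complex) set" where
  "functionals = {\<xi>.
     (\<forall>\<phi>\<in>schwartz. \<forall>\<psi>\<in>schwartz. \<xi> (\<phi> + \<psi>) = \<xi> \<phi> + \<xi> \<psi>) \<and>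
     (\<forall>c. \<forall>\<phi>\<in>schwartz. \<xi> (cscale c \<phi>) = c * \<xi> \<phi>) \<and>
     (\<forall>\<phi>. \<phi> \<notin> schwartz \<longrightarrow> \<xi> \<phi> = 0)}"

definition equivariant_functionals ::
  "('f::nonarch_local_field \<times> ('f ^ 'n ^ 'n) \<times> 'f \<Rightarrow> complex) \<Rightarrow>
     ((('f ^ 'n) \<times> ('f ^ 'n) \<Rightarrow> complex) \<Rightarrow> complex) set" where
  "equivariant_functionals chi = {\<xi> \<in> functionals.
     \<forall>g\<in>carrier act_group. \<forall>\<phi>\<in>schwartz. \<xi> (translate g \<phi>) = chi g * \<xi> \<phi>}"

lemma subspace_equivariant_functionals: "cfun.subspace (equivariant_functionals chi)"
  by (auto simp: cfun.subspace_def equivariant_functionals_def functionals_def cscale_def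
      algebra_simps)

text \<open>
  The library's \<open>dim\<close> is a natural number; finite-dimensionality is required separately, because
  the cardinality of an infinite basis is \<open>0\<close>.
\<close>

definition dim_at_most :: "(('a \<Rightarrow> complex) set) \<Rightarrow> nat \<Rightarrow> bool" where
  "dim_at_most S d \<longleftrightarrow> (\<exists>B. finite B \<and> B \<subseteq> S \<and> S \<subseteq> cfun.span B) \<and> cfun.dim S \<le> d"

end

theory Submission
  imports Defs
begin

text \<open>
  Write \<open>m A = \<xi> (1\<^sub>A)\<close> for compact open \<open>A\<close>; this finitely additive set function determines \<open>\<xi>\<close>, and
  transvections act trivially on it. The claim is that a single set \<open>A\<^sub>0\<close>, depending only on the
  character, has the property that \<open>m A\<^sub>0 = 0\<close> forces \<open>m = 0\<close>.

  Over \<open>x \<noteq> 0\<close> the group is transitive on the first component, so there \<open>m\<close> is the same as a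
  set function \<open>\<eta>\<close> on the fibre \<open>F\<^sup>n\<close> over \<open>x = e\<close>, equivariant under a triangular group with torus
  characters \<open>\<alpha>\<^sub>i\<close>. Such an \<open>\<eta>\<close> is handled coordinate by coordinate: if \<open>\<alpha>\<^sub>i = 1\<close>, then comparing
  the unit ball with its image under scaling coordinate \<open>i\<close> by a uniformizer shows that \<open>\<eta>\<close> lives
  on \<open>y\<^sub>i = 0\<close>; if \<open>\<alpha>\<^sub>i \<noteq> 1\<close>, then \<open>\<eta>\<close> is determined off \<open>y\<^sub>i = 0\<close>, where it is proportional to
  one known set function.

  Let \<open>\<chi>\<^sub>1\<close> be the character of scaling \<open>x\<close>. If \<open>\<chi>\<^sub>1 \<noteq> 1\<close>, then \<open>m\<close> is determined over \<open>x \<noteq> 0\<close>, hence by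
  \<open>\<eta>\<close>. If \<open>\<chi>\<^sub>1 = 1\<close>, then the primitive vectors times any fixed set have measure zero, which forces
  \<open>\<eta> = 0\<close>; so \<open>m\<close> lives on \<open>x = 0\<close>, and the coordinatewise argument applies to \<open>F\<^sup>n\<close> once more.
\<close>

section \<open>The valuation\<close>

text \<open>The set \<open>A0\<close> turns the bound into injectivity: \<xi> \<mapsto>
  \<open>\<xi> (indic A0)\<close> is one linear form on the whole space, and an injective linear
  form leaves dimension at most 1. Hence \<open>A0\<close> has to be fixed before \<open>m\<close>.

  No Haar measure enters. The fibre function is a density: the measure of a small box around
  \<open>e0\<close> times \<open>B\<close>, multiplied by q to the sum of the exponents of the box,
  q the residue cardinality. It becomes stationary because small shears stabilise a compact open
  \<open>B\<close>. Group elements that fix \<open>e0\<close> but distort the boxes contribute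
  powers of q to the torus characters of the density.

  For \<chi>1 = 1 the obstacle is to compare cells around different primitive vectors, since shears
  also move the second component. With O^n as second factor nothing moves, which gives only
  \<open>eta (icube 0) = 0\<close>. If \<chi>2 is trivial on units, this single value kills
  \<open>eta\<close>; if not, unit dilations of a coordinate other than \<open>i0\<close> do. In
  dimension 1 there is no such coordinate, but there scalars, which fix the second component,
  already permute the primitive cells.\<close>

definition is_abs :: "('f::nonarch_local_field \<Rightarrow> real) \<Rightarrow> bool" where
  "is_abs v \<longleftrightarrow> (\<forall>x. 0 \<le> v x) \<and> (\<forall>x. v x = 0 \<longleftrightarrow> x = 0) \<and>
     (\<forall>x y. v (x * y) = v x * v y) \<and>
     (\<forall>x y. v (x + y) \<le> max (v x) (v y)) \<and>
     (\<exists>x. x \<noteq> 0 \<and> v x \<noteq> 1) \<and>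
     (\<forall>U. open U \<longleftrightarrow> (\<forall>x\<in>U. \<exists>e>0. \<forall>y. v (y - x) < e \<longrightarrow> y \<in> U))"

definition av :: "'f::nonarch_local_field \<Rightarrow> real" where
  "av = (SOME v. is_abs v)"

lemma is_abs_av: "is_abs (av :: 'f::nonarch_local_field \<Rightarrow> real)"
  unfolding av_def by (rule someI_ex[of is_abs], unfold is_abs_def, rule nonarch_abs_topology)

lemmas av_spec = is_abs_av[unfolded is_abs_def]

lemma av_nonneg [simp]: "0 \<le> av (x::'f::nonarch_local_field)"
  and av_eq_0 [simp]: "av x = 0 \<longleftrightarrow> x = 0"
  and av_mult: "av (x * y) = av x * av y"
  and av_add: "av (x + y) \<le> max (av x) (av y)"
  and av_nontrivial: "\<exists>x::'f. x \<noteq> 0 \<and> av x \<noteq> 1"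
  using av_spec[where 'f='f] by simp_all

lemma av_0 [simp]: "av (0::'f::nonarch_local_field) = 0"
  by simp

lemma open_av_iff:
  "open U \<longleftrightarrow> (\<forall>x\<in>U. \<exists>e>0. \<forall>y. av (y - x) < e \<longrightarrow> y \<in> U)" for U :: "'f::nonarch_local_field set"
  using av_spec[where 'f='f] by (elim conjE) (rule spec)

lemma av_pos [simp]: "0 < av x \<longleftrightarrow> x \<noteq> 0" for x :: "'f::nonarch_local_field"
  using av_nonneg[of x] av_eq_0[of x] by linarith

lemma av_1 [simp]: "av (1::'f::nonarch_local_field) = 1"
  using av_mult[of "1::'f" 1] by simp

lemma av_minus [simp]: "av (- x) = av x" for x :: "'f::nonarch_local_field"
proof -
  have "av (-1::'f) * av (-1::'f) = 1"
    using av_mult[of "-1::'f" "-1"] by simp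
  then have "av (-1::'f) = 1"
    using av_nonneg[of "-1::'f"] by (metis abs_of_nonneg real_sqrt_abs2 real_sqrt_one)
  then show ?thesis
    using av_mult[of "-1" x] by simp
qed

lemma av_diff: "av (x - y) \<le> max (av x) (av y)" for x :: "'f::nonarch_local_field"
  using av_add[of x "-y"] by simp

lemma av_inverse: "av (inverse x) = inverse (av x)" for x :: "'f::nonarch_local_field"
proof (cases "x = 0")
  case False
  then show ?thesis
    using av_mult[of x "inverse x"] by (simp add: field_simps)
qed simp

lemma av_divide: "av (x / y) = av x / av y" for x :: "'f::nonarch_local_field"
  by (simp add: divide_inverse av_mult av_inverse)

lemma av_power: "av (x ^ n) = av x ^ n" for x :: "'f::nonarch_local_field"
  by (induction n) (simp_all add: av_mult)

lemma av_power_int: "av (x powi n) = av x powi n" for x :: "'f::nonarch_local_field"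
  by (simp add: power_int_def av_power av_inverse)

lemma open_av_less: "open {y::'f::nonarch_local_field. av y < r}"
  unfolding open_av_iff
proof safe
  fix x :: 'f assume x: "av x < r"
  then have "r > 0"
    using av_nonneg[of x] by linarith
  moreover have "av y < r" if "av (y - x) < r" for y
    using av_add[of "y - x" x] that x by auto
  ultimately show "\<exists>e>0. \<forall>y. av (y - x) < e \<longrightarrow> y \<in> {y. av y < r}"
    by auto
qed

lemma av_near: "x \<noteq> 0 \<Longrightarrow> av (y - x) < av x \<Longrightarrow> av y = av x" for x :: "'f::nonarch_local_field"
  using av_diff[of y "y - x"] av_add[of "y - x" x] by auto

text \<open>Away from 0 the absolute value is locally constant, so the complement is open; 0 itself
  lies in the complement only if \<open>r \<le> 0\<close>, when the set is empty.\<close>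

lemma closed_av_less: "closed {y::'f::nonarch_local_field. av y < r}"
  unfolding closed_def open_av_iff
proof (intro ballI)
  fix x :: 'f assume "x \<in> - {y. av y < r}"
  then have x: "r \<le> av x"
    by simp
  show "\<exists>e>0. \<forall>y. av (y - x) < e \<longrightarrow> y \<in> - {y. av y < r}"
  proof (cases "x = 0")
    case True
    then have "r \<le> av y" for y :: 'f
      using x order.trans[OF _ av_nonneg] by simp
    then show ?thesis
      by (intro exI[of _ 1]) (simp add: not_less)
  next
    case False
    then have "r \<le> av y" if "av (y - x) < av x" for y
      using x av_near[OF _ that] by simp
    then show ?thesis
      using False by (intro exI[of _ "av x"]) (simp add: not_less)
  qed
qed

lemma closed_av_le: "closed {y::'f::nonarch_local_field. av y \<le> r}"
proof -
  have "{y::'f. av y \<le> r} = (\<Inter>s\<in>{r<..}. {y. av y < s})"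
  proof (intro equalityI subsetI)
    fix y assume y: "y \<in> (\<Inter>s\<in>{r<..}. {y::'f. av y < s})"
    have "av y \<le> s" if "r < s" for s
      using y that by fastforce
    then show "y \<in> {y. av y \<le> r}"
      by (simp add: dense_ge)
  qed auto
  then show ?thesis
    by (simp add: closed_INT closed_av_less)
qed

lemma exists_small: "e > 0 \<Longrightarrow> \<exists>a::'f::nonarch_local_field. a \<noteq> 0 \<and> av a < e"
proof -
  assume e: "e > 0"
  obtain x :: 'f where x: "x \<noteq> 0" "av x \<noteq> 1"
    using av_nontrivial by blast
  define z where "z = (if av x < 1 then x else inverse x)"
  have z: "z \<noteq> 0" "av z < 1"
    using x by (auto simp: z_def av_inverse inverse_less_1_iff)
  then obtain n where "av z ^ n < e"
    using real_arch_pow_inv[OF e] by blast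
  then show ?thesis
    using z by (intro exI[of _ "z ^ n"]) (simp add: av_power)
qed

lemma continuous_mult_left: "continuous_on S (\<lambda>x. a * x :: 'f::nonarch_local_field)"
proof (cases "a = 0")
  case False
  have "open ((\<lambda>x. a * x) -` U)" if "open U" for U
    unfolding open_av_iff
  proof
    fix x assume "x \<in> (\<lambda>x. a * x) -` U"
    then obtain e where e: "e > 0" "\<And>y. av (y - a * x) < e \<Longrightarrow> y \<in> U"
      using \<open>open U\<close> unfolding open_av_iff by blast
    have "a * y \<in> U" if "av (y - x) < e / av a" for y
    proof (rule e)
      have "a * y - a * x = a * (y - x)"
        by (simp add: algebra_simps)
      then show "av (a * y - a * x) < e"
        using that False by (simp only: av_mult) (simp add: field_simps)
    qed
    then show "\<exists>e>0. \<forall>y. av (y - x) < e \<longrightarrow> y \<in> (\<lambda>x. a * x) -` U"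
      using e(1) False by (intro exI[of _ "e / av a"]) auto
  qed
  then have "continuous_on UNIV (\<lambda>x. a * x)"
    by (simp add: continuous_on_open_vimage)
  then show ?thesis
    using continuous_on_subset subset_UNIV by blast
qed simp

text \<open>Local compactness provides some small compact ball around 0, and multiplication by
  \<open>inverse a\<close> carries it onto the unit ball.\<close>

lemma compact_av_le_1: "compact {y::'f::nonarch_local_field. av y \<le> 1}"
proof -
  obtain U K where UK: "open U" "(0::'f) \<in> U" "U \<subseteq> K" "compact K"
    using locally_compact[of "0::'f"] by (elim exE conjE)
  then obtain e where e: "e > 0" "\<And>y::'f. av y < e \<Longrightarrow> y \<in> U"
    unfolding open_av_iff by (metis diff_zero)
  obtain a :: 'f where a: "a \<noteq> 0" "av a < e"
    using exists_small e(1) by blast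
  have "compact (K \<inter> {y. av y \<le> av a})"
    by (rule compact_Int_closed[OF UK(4) closed_av_le])
  moreover have "K \<inter> {y. av y \<le> av a} = {y. av y \<le> av a}"
    using e(2) order.strict_trans1[OF _ a(2)] UK(3) by auto
  ultimately have "compact ((\<lambda>x. inverse a * x) ` {y. av y \<le> av a})"
    by (metis compact_continuous_image continuous_mult_left)
  also have "(\<lambda>x. inverse a * x) ` {y. av y \<le> av a} = {y. av y \<le> 1}"
  proof safe
    fix x :: 'f assume "av x \<le> av a"
    then show "av (inverse a * x) \<le> 1"
      using a by (simp add: av_mult av_inverse) (simp add: inverse_eq_divide divide_le_eq)
  next
    fix x :: 'f assume "av x \<le> 1"
    then show "x \<in> (\<lambda>x. inverse a * x) ` {y. av y \<le> av a}"
      using a by (intro image_eqI[of _ _ "a * x"]) (auto simp: av_mult intro: mult_left_le)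
  qed
  finally show ?thesis .
qed

text \<open>Compactness makes the valuation discrete: if the absolute values below 1 had no maximum,
  the balls \<open>av y < av x\<close> would cover the compact maximal ideal, and the largest ball
  of a finite subcover would miss its own \<open>x\<close>.\<close>

lemma exists_uniformizer:
  "\<exists>p::'f::nonarch_local_field. p \<noteq> 0 \<and> av p < 1 \<and> (\<forall>x::'f. av x < 1 \<longrightarrow> av x \<le> av p)"
proof (rule ccontr)
  assume contr: "\<not> ?thesis"
  let ?M = "{y::'f. av y < 1}"
  obtain a :: 'f where a: "a \<noteq> 0" "av a < 1"
    using exists_small[of 1] by auto
  have "compact ({y::'f. av y \<le> 1} \<inter> ?M)"
    by (rule compact_Int_closed[OF compact_av_le_1 closed_av_less])
  moreover have "{y::'f. av y \<le> 1} \<inter> ?M = ?M"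
    by auto
  ultimately have comp: "compact ?M"
    by simp
  have larger: "\<exists>x\<in>?M. av y < av x" if "y \<in> ?M" for y
  proof (cases "y = 0")
    case False
    have "\<not> (\<forall>x::'f. av x < 1 \<longrightarrow> av x \<le> av y)"
      using contr False that by auto
    then show ?thesis
      by (auto simp: not_le)
  qed (use a in auto)
  then have "?M \<subseteq> (\<Union>x\<in>?M. {y. av y < av x})"
    by blast
  then obtain D where D: "D \<subseteq> ?M" "finite D" "?M \<subseteq> (\<Union>x\<in>D. {y. av y < av x})"
    using compactE_image[OF comp, of ?M "\<lambda>x. {y. av y < av x}"] open_av_less by metis
  have "D \<noteq> {}"
    using D(3) a by auto
  then obtain x where "x \<in> D" "\<And>y. y \<in> D \<Longrightarrow> av y \<le> av x"
    using obtains_MAX[of D av] D(2) Max_ge[of "av ` D"] by (metis finite_imageI imageI)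
  moreover obtain z where "z \<in> D" "av x < av z"
    using D(1,3) \<open>x \<in> D\<close> by blast
  ultimately show False
    by fastforce
qed

definition unif :: "'f::nonarch_local_field" where
  "unif = (SOME p. p \<noteq> 0 \<and> av p < 1 \<and> (\<forall>x::'f. av x < 1 \<longrightarrow> av x \<le> av p))"

lemma unif_spec:
  "(unif::'f::nonarch_local_field) \<noteq> 0 \<and> av (unif::'f) < 1 \<and>
    (\<forall>x::'f. av x < 1 \<longrightarrow> av x \<le> av (unif::'f))"
  unfolding unif_def by (rule someI_ex[OF exists_uniformizer])

lemma unif_nz [simp]: "(unif::'f::nonarch_local_field) \<noteq> 0"
  and av_unif_less: "av (unif::'f) < 1"
  and av_le_unif: "av (x::'f) < 1 \<Longrightarrow> av x \<le> av (unif::'f)"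
  using unif_spec by blast+

lemma exists_val: "t \<noteq> 0 \<Longrightarrow> \<exists>k. av t = av (unif::'f) powi k" for t :: "'f::nonarch_local_field"
proof -
  assume t: "t \<noteq> 0"
  define r where "r = av (unif::'f)"
  have r: "0 < r" "r < 1"
    by (auto simp: r_def av_unif_less)
  \<comment> \<open>Rounding down leaves a quotient \<open>s\<close> with
    \<open>r < av s \<le> 1\<close>; no absolute value lies strictly between \<open>r\<close> and 1,
    so \<open>av s = 1\<close>.\<close>
  define k where "k = \<lfloor>log r (av t)\<rfloor>"
  have "av t = r powr (log r (av t))"
    using t r by simp
  moreover have "r powr (log r (av t)) \<le> r powr (of_int k)"
    using r by (intro powr_mono') (auto simp: k_def)
  moreover have "r powr (of_int k + 1) < r powr (log r (av t))"
    using r by (intro powr_less_mono') (auto simp: k_def)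
  ultimately have k: "av t \<le> r powi k" "r powi k * r < av t"
    using r by (auto simp: powr_real_of_int' powr_add)
  define s where "s = t / unif powi k"
  have s: "av s = av t / r powi k"
    by (simp add: s_def av_divide av_power_int r_def)
  have "av s \<le> 1" "r < av s"
    using k r by (auto simp: s field_simps)
  then have "av s = 1"
    using av_le_unif[of s] by (force simp: r_def)
  then have "av t = r powi k"
    using r by (simp add: s field_simps)
  then show ?thesis
    unfolding r_def ..
qed

text \<open>The value of \<open>val 0\<close> is arbitrary.\<close>

definition val :: "'f::nonarch_local_field \<Rightarrow> int" where
  "val t = (SOME k. av t = av (unif::'f) powi k)"

lemma av_val: "t \<noteq> 0 \<Longrightarrow> av t = av (unif::'f) powi val t" for t :: "'f::nonarch_local_field"
  unfolding val_def by (rule someI_ex, rule exists_val)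

lemma unif_powi_le_iff [simp]:
  "av (unif::'f::nonarch_local_field) powi k \<le> av (unif::'f) powi l \<longleftrightarrow> l \<le> k"
proof -
  have r: "0 < av (unif::'f)" "av (unif::'f) < 1"
    by (auto simp: av_unif_less)
  show ?thesis
    using power_int_strict_decreasing[of k l "av (unif::'f)"] power_int_decreasing[of l k "av (unif::'f)"] r
    by (cases "l \<le> k") auto
qed

lemma unif_powi_eq_iff [simp]:
  "av (unif::'f::nonarch_local_field) powi k = av (unif::'f) powi l \<longleftrightarrow> l = k"
  by (metis unif_powi_le_iff order_antisym order_refl)

lemma val_eqI: "t \<noteq> 0 \<Longrightarrow> av t = av (unif::'f) powi k \<Longrightarrow> val t = k" for t :: "'f::nonarch_local_field"
  using av_val[of t] by simp

lemma val_mult: "s \<noteq> 0 \<Longrightarrow> t \<noteq> 0 \<Longrightarrow> val (s * t) = val s + val t" for t :: "'f::nonarch_local_field"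
  by (rule val_eqI) (auto simp: av_mult av_val[of s] av_val[of t] power_int_add)

lemma val_1 [simp]: "val (1::'f::nonarch_local_field) = 0"
  by (rule val_eqI) auto

lemma val_unif [simp]: "val (unif::'f::nonarch_local_field) = 1"
  by (rule val_eqI) auto

lemma val_inverse: "t \<noteq> 0 \<Longrightarrow> val (inverse t) = - val t" for t :: "'f::nonarch_local_field"
  using val_mult[of t "inverse t"] by simp

lemma val_powi [simp]: "val (unif powi k :: 'f::nonarch_local_field) = k"
  by (rule val_eqI) (auto simp: av_power_int)

section \<open>Fractional ideals as a neighbourhood basis of zero\<close>

definition ideal_pow :: "int \<Rightarrow> 'f::nonarch_local_field set" where
  "ideal_pow k = {x. av x \<le> av (unif::'f) powi k}"

lemma ideal_pow_iff: "x \<in> ideal_pow k \<longleftrightarrow> x = 0 \<or> k \<le> val x"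
  using av_val[of x] by (cases "x = 0") (auto simp: ideal_pow_def)

lemma ideal_pow_0 [simp]: "0 \<in> ideal_pow k"
  by (simp add: ideal_pow_iff)

lemma ideal_pow_1 [simp]: "1 \<in> ideal_pow k \<longleftrightarrow> k \<le> 0"
  by (simp add: ideal_pow_iff)

lemma ideal_pow_add: "x \<in> ideal_pow k \<Longrightarrow> y \<in> ideal_pow k \<Longrightarrow> x + y \<in> ideal_pow k"
  using av_add[of x y] by (auto simp: ideal_pow_def)

lemma ideal_pow_minus [simp]: "- x \<in> ideal_pow k \<longleftrightarrow> x \<in> ideal_pow k"
  by (auto simp: ideal_pow_def)

lemma ideal_pow_diff: "x \<in> ideal_pow k \<Longrightarrow> y \<in> ideal_pow k \<Longrightarrow> x - y \<in> ideal_pow k"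
  using ideal_pow_add[of x k "- y"] by simp

lemma ideal_pow_commute: "x - y \<in> ideal_pow k \<longleftrightarrow> y - x \<in> ideal_pow k"
  using ideal_pow_minus[of "x - y" k] by simp

lemma ideal_pow_mono: "l \<le> k \<Longrightarrow> x \<in> ideal_pow k \<Longrightarrow> x \<in> ideal_pow l"
  by (auto simp: ideal_pow_iff)

lemma ideal_pow_mult: "x \<in> ideal_pow k \<Longrightarrow> y \<in> ideal_pow l \<Longrightarrow> x * y \<in> ideal_pow (k + l)"
  by (cases "x = 0 \<or> y = 0") (auto simp: ideal_pow_iff val_mult)

lemma ideal_pow_scale: "t \<noteq> 0 \<Longrightarrow> t * x \<in> ideal_pow k \<longleftrightarrow> x \<in> ideal_pow (k - val t)"
  by (cases "x = 0") (auto simp: ideal_pow_iff val_mult)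

lemma ex_ideal_pow: "\<exists>k. x \<in> ideal_pow k"
  by (auto simp: ideal_pow_iff)

lemma val_one_plus: "x \<in> ideal_pow 1 \<Longrightarrow> 1 + x \<noteq> 0 \<and> val (1 + x) = 0" for x :: "'f::nonarch_local_field"
proof -
  assume x: "x \<in> ideal_pow 1"
  have "1 + x \<in> ideal_pow 0"
    by (rule ideal_pow_add[OF _ ideal_pow_mono[OF _ x]]) auto
  moreover have "1 + x \<notin> ideal_pow 1"
    using ideal_pow_diff[of "1 + x" 1 x] x by auto
  ultimately show ?thesis
    by (auto simp: ideal_pow_iff)
qed

lemma compact_ideal_pow: "compact (ideal_pow k :: 'f::nonarch_local_field set)"
proof -
  have "ideal_pow k = (\<lambda>x::'f. unif powi k * x) ` {y. av y \<le> 1}"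
  proof safe
    fix x :: 'f assume "x \<in> ideal_pow k"
    then show "x \<in> (\<lambda>x::'f. unif powi k * x) ` {y. av y \<le> 1}"
      by (intro image_eqI[of _ _ "x / unif powi k"])
        (auto simp: ideal_pow_def av_divide av_power_int divide_le_eq zero_less_power_int)
  qed (auto simp: ideal_pow_def av_mult av_power_int mult_le_cancel_left1)
  then show ?thesis
    by (metis compact_continuous_image continuous_mult_left compact_av_le_1)
qed

lemma open_ideal_pow_iff:
  "open U \<longleftrightarrow> (\<forall>x\<in>U. \<exists>k. \<forall>y. y - x \<in> ideal_pow k \<longrightarrow> y \<in> U)" for U :: "'f::nonarch_local_field set"
proof -
  have r: "0 < av (unif::'f)" "av (unif::'f) < 1"
    by (auto simp: av_unif_less)
  have "(\<exists>e>0. \<forall>y. av (y - x) < e \<longrightarrow> y \<in> U) \<longleftrightarrow> (\<exists>k. \<forall>y. y - x \<in> ideal_pow k \<longrightarrow> y \<in> U)" for x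
  proof
    assume "\<exists>e>0. \<forall>y. av (y - x) < e \<longrightarrow> y \<in> U"
    then obtain e where e: "e > 0" "\<forall>y. av (y - x) < e \<longrightarrow> y \<in> U"
      by blast
    obtain n where "av (unif::'f) ^ n < e"
      using real_arch_pow_inv[OF e(1) r(2)] by blast
    then have "\<forall>y. y - x \<in> ideal_pow (int n) \<longrightarrow> y \<in> U"
      using e(2) by (auto simp: ideal_pow_def)
    then show "\<exists>k. \<forall>y. y - x \<in> ideal_pow k \<longrightarrow> y \<in> U" ..
  next
    assume "\<exists>k. \<forall>y. y - x \<in> ideal_pow k \<longrightarrow> y \<in> U"
    then obtain k where "\<forall>y. y - x \<in> ideal_pow k \<longrightarrow> y \<in> U" ..
    then show "\<exists>e>0. \<forall>y. av (y - x) < e \<longrightarrow> y \<in> U"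
      using r by (intro exI[of _ "av (unif::'f) powi k"]) (auto simp: ideal_pow_def zero_less_power_int)
  qed
  then show ?thesis
    unfolding open_av_iff by simp
qed

section \<open>Finitely additive functions on compact open sets\<close>

definition compact_open :: "'v::topological_space set \<Rightarrow> bool" where
  "compact_open A \<longleftrightarrow> compact A \<and> open A"

definition cell :: "'v::ab_group_add \<Rightarrow> 'v set \<Rightarrow> 'v set" where
  "cell p M = {z. z - p \<in> M}"

definition is_subgroup :: "'v::ab_group_add set \<Rightarrow> bool" where
  "is_subgroup M \<longleftrightarrow> 0 \<in> M \<and> (\<forall>x\<in>M. \<forall>y\<in>M. x - y \<in> M)"

definition fin_additive :: "('v::topological_space set \<Rightarrow> complex) \<Rightarrow> bool" where
  "fin_additive m \<longleftrightarrow> (\<forall>A B. compact_open A \<longrightarrow> compact_open B \<longrightarrow> A \<inter> B = {} \<longrightarrow> m (A \<union> B) = m A + m B)"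

text \<open>The complement of the support of \<open>m\<close>.\<close>

definition null_at :: "('v::topological_space set \<Rightarrow> complex) \<Rightarrow> 'v \<Rightarrow> bool" where
  "null_at m p \<longleftrightarrow> (\<exists>U. compact_open U \<and> p \<in> U \<and> (\<forall>A. compact_open A \<longrightarrow> A \<subseteq> U \<longrightarrow> m A = 0))"

lemma is_subgroup_minus: "is_subgroup M \<Longrightarrow> x \<in> M \<Longrightarrow> - x \<in> M"
  unfolding is_subgroup_def by (metis diff_0)

lemma is_subgroup_add: "is_subgroup M \<Longrightarrow> x \<in> M \<Longrightarrow> y \<in> M \<Longrightarrow> x + y \<in> M"
  using is_subgroup_minus[of M y] unfolding is_subgroup_def by (metis diff_minus_eq_add)

lemma cell_self: "is_subgroup M \<Longrightarrow> p \<in> cell p M"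
  by (simp add: cell_def is_subgroup_def)

lemma cell_sym: "is_subgroup M \<Longrightarrow> z \<in> cell p M \<Longrightarrow> p \<in> cell z M"
  using is_subgroup_minus[of M "z - p"] by (simp add: cell_def)

lemma cell_eq: "is_subgroup M \<Longrightarrow> z \<in> cell p M \<Longrightarrow> cell z M = cell p M"
proof -
  assume M: "is_subgroup M" and z: "z \<in> cell p M"
  have sub: "cell a M \<subseteq> cell b M" if "a \<in> cell b M" for a b
  proof
    fix x assume "x \<in> cell a M"
    then have "(x - a) + (a - b) \<in> M"
      using that M by (intro is_subgroup_add) (auto simp: cell_def)
    then show "x \<in> cell b M"
      by (simp add: cell_def)
  qed
  show ?thesis
    using sub[OF z] sub[OF cell_sym[OF M z]] by blast
qed

lemma co_empty [simp]: "compact_open {}"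
  by (simp add: compact_open_def)

lemma co_Un: "compact_open A \<Longrightarrow> compact_open B \<Longrightarrow> compact_open (A \<union> B)"
  by (auto simp: compact_open_def compact_Un)

lemma co_Union: "finite F \<Longrightarrow> (\<And>X. X \<in> F \<Longrightarrow> compact_open X) \<Longrightarrow> compact_open (\<Union>F)"
  by (induction rule: finite_induct) (auto intro: co_Un)

lemma co_Times: "compact_open A \<Longrightarrow> compact_open B \<Longrightarrow> compact_open (A \<times> B)"
  by (simp add: compact_open_def compact_Times open_Times)

lemma fin_additive_empty: "fin_additive m \<Longrightarrow> m {} = 0"
  unfolding fin_additive_def by (metis Un_empty co_empty inf_bot_right add_cancel_right_right)

lemma fin_additive_Union:
  assumes m: "fin_additive m" and "finite F" and "\<And>X. X \<in> F \<Longrightarrow> compact_open X"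
    and "\<And>X Y. X \<in> F \<Longrightarrow> Y \<in> F \<Longrightarrow> X \<noteq> Y \<Longrightarrow> X \<inter> Y = {}"
  shows "m (\<Union>F) = (\<Sum>X\<in>F. m X)"
  using assms(2-)
proof (induction rule: finite_induct)
  case empty
  then show ?case
    by (simp add: fin_additive_empty[OF m])
next
  case (insert X F)
  have "X \<inter> \<Union>F = {}"
    using insert.prems(2)[of X] insert.hyps(2) by blast
  moreover have "compact_open X" "compact_open (\<Union>F)"
    using insert.prems(1) insert.hyps(1) by (auto intro: co_Union)
  ultimately have "m (X \<union> \<Union>F) = m X + m (\<Union>F)"
    using m unfolding fin_additive_def by blast
  moreover have "m (\<Union>F) = (\<Sum>X\<in>F. m X)"
    using insert.prems by (intro insert.IH) auto
  ultimately show ?case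
    using insert.hyps by simp
qed

text \<open>The sum runs over indices rather than over sets, as required for translates indexed by a
  transversal.\<close>

lemma fin_additive_UN:
  assumes m: "fin_additive m" and "finite R" and "\<And>r. r \<in> R \<Longrightarrow> compact_open (X r)"
    and "\<And>r s. r \<in> R \<Longrightarrow> s \<in> R \<Longrightarrow> r \<noteq> s \<Longrightarrow> X r \<inter> X s = {}"
  shows "m (\<Union>r\<in>R. X r) = (\<Sum>r\<in>R. m (X r))"
  using assms(2-)
proof (induction rule: finite_induct)
  case empty
  then show ?case
    by (simp add: fin_additive_empty[OF m])
next
  case (insert r R)
  have "X r \<inter> (\<Union>r\<in>R. X r) = {}"
    using insert.prems(2)[of r] insert.hyps(2) by blast
  moreover have "compact_open (X r)" "compact_open (\<Union>r\<in>R. X r)"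
    using insert.prems(1) insert.hyps(1) by (auto intro: co_Union)
  ultimately have "m (X r \<union> (\<Union>r\<in>R. X r)) = m (X r) + m (\<Union>r\<in>R. X r)"
    using m unfolding fin_additive_def by blast
  moreover have "m (\<Union>r\<in>R. X r) = (\<Sum>r\<in>R. m (X r))"
    using insert.prems by (intro insert.IH) auto
  ultimately show ?case
    using insert.hyps by simp
qed

text \<open>A homeomorphism that multiplies \<open>m\<close> by a constant carries the complement of
  the support into itself. All movements of points along group orbits below go through this.\<close>

lemma null_at_map:
  assumes "null_at m p" and "\<And>A. compact_open A \<Longrightarrow> compact_open (f ` A)" "\<And>A. compact_open A \<Longrightarrow> compact_open (g ` A)"
    and fg: "\<And>x. f (g x) = x" "\<And>x. g (f x) = x"
    and m: "\<And>A. compact_open A \<Longrightarrow> m (f ` A) = c * m A"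
  shows "null_at m (f p)"
proof -
  obtain U where U: "compact_open U" "p \<in> U" "\<And>A. compact_open A \<Longrightarrow> A \<subseteq> U \<Longrightarrow> m A = 0"
    using assms(1) unfolding null_at_def by blast
  have "m A = 0" if A: "compact_open A" "A \<subseteq> f ` U" for A
  proof -
    have "g ` A \<subseteq> U"
      using A(2) fg(2) by auto
    then have "m (g ` A) = 0"
      using U(3) assms(3) A(1) by blast
    moreover have "A = f ` g ` A"
      by (simp add: image_image fg(1))
    ultimately show ?thesis
      using m[of "g ` A"] assms(3)[OF A(1)] by simp
  qed
  then show ?thesis
    unfolding null_at_def using U(1,2) assms(2) by blast
qed

section \<open>Abelian groups filtered by compact open subgroups\<close>

locale ultra_group =
  fixes L :: "int \<Rightarrow> 'v::{ab_group_add, topological_space} set"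
  assumes subgroup_L: "is_subgroup (L k)"
    and mono_L: "k \<le> l \<Longrightarrow> L l \<subseteq> L k"
    and exhaust_L: "\<exists>k. x \<in> L k"
    and compact_L: "compact (L k)"
    and open_iff: "open U \<longleftrightarrow> (\<forall>p\<in>U. \<exists>k. cell p (L k) \<subseteq> U)"
begin

text \<open>For a homomorphism, continuity at 0 is continuity everywhere, so only the filtration has
  to be checked.\<close>

definition cts_hom :: "('v \<Rightarrow> 'v) \<Rightarrow> bool" where
  "cts_hom f \<longleftrightarrow> (\<forall>x y. f (x - y) = f x - f y) \<and> (\<forall>k. \<exists>l. f ` L l \<subseteq> L k)"

lemma continuous_cts_hom: "cts_hom f \<Longrightarrow> continuous_on UNIV f"
proof -
  assume f: "cts_hom f"
  have "open (f -` U)" if "open U" for U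
    unfolding open_iff
  proof
    fix p assume "p \<in> f -` U"
    then obtain k where k: "cell (f p) (L k) \<subseteq> U"
      using \<open>open U\<close> unfolding open_iff by auto
    obtain l where "f ` L l \<subseteq> L k"
      using f unfolding cts_hom_def by blast
    then have "f z \<in> cell (f p) (L k)" if "z \<in> cell p (L l)" for z
      using f that unfolding cts_hom_def cell_def by (metis image_subset_iff mem_Collect_eq)
    then show "\<exists>l. cell p (L l) \<subseteq> f -` U"
      using k by blast
  qed
  then show ?thesis
    by (simp add: continuous_on_open_vimage)
qed

lemma co_image:
  assumes "cts_hom f" "cts_hom g" "\<And>x. f (g x) = x" "\<And>x. g (f x) = x" "compact_open A"
  shows "compact_open (f ` A)"
proof -
  have "f ` A = g -` A"
  proof (intro equalityI subsetI)
    fix x assume "x \<in> g -` A"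
    then have "f (g x) \<in> f ` A"
      by simp
    then show "x \<in> f ` A"
      by (simp add: assms(3))
  qed (auto simp: assms(4))
  moreover have "open (g -` A)"
    using continuous_cts_hom[OF assms(2)] assms(5) by (simp add: continuous_on_open_vimage compact_open_def)
  moreover have "compact (f ` A)"
    using compact_continuous_image[of A f] continuous_on_subset[OF continuous_cts_hom[OF assms(1)], of A] assms(5)
    by (simp add: compact_open_def)
  ultimately show ?thesis
    by (simp add: compact_open_def)
qed

lemma compact_cell: "compact M \<Longrightarrow> compact (cell p M)" for M :: "'v set"
proof -
  assume M: "compact M"
  have "open ((\<lambda>x. p + x) -` U)" if "open U" for U
    unfolding open_iff
  proof
    fix x assume "x \<in> (\<lambda>x. p + x) -` U"
    then obtain k where k: "cell (p + x) (L k) \<subseteq> U"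
      using \<open>open U\<close> unfolding open_iff by auto
    have "cell x (L k) \<subseteq> (\<lambda>x. p + x) -` U"
    proof
      fix z assume "z \<in> cell x (L k)"
      then have "p + z \<in> cell (p + x) (L k)"
        by (simp add: cell_def)
      then show "z \<in> (\<lambda>x. p + x) -` U"
        using k by auto
    qed
    then show "\<exists>k. cell x (L k) \<subseteq> (\<lambda>x. p + x) -` U" ..
  qed
  then have "continuous_on UNIV (\<lambda>x. p + x)"
    by (simp add: continuous_on_open_vimage)
  then have "compact ((\<lambda>x. p + x) ` M)"
    using compact_continuous_image continuous_on_subset M subset_UNIV by blast
  moreover have "(\<lambda>x. p + x) ` M = cell p M"
    by (force simp: cell_def intro: image_eqI[of _ _ "_ - p"])
  ultimately show ?thesis
    by simp
qed

lemma co_cell: "is_subgroup M \<Longrightarrow> compact M \<Longrightarrow> L k \<subseteq> M \<Longrightarrow> compact_open (cell p M)" for M :: "'v set"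
proof -
  assume M: "is_subgroup M" "compact M" "L k \<subseteq> M"
  have "cell z (L k) \<subseteq> cell p M" if "z \<in> cell p M" for z
    using cell_eq[OF M(1) that] M(3) by (auto simp: cell_def)
  then show ?thesis
    using compact_cell[OF M(2)] by (auto simp: compact_open_def open_iff)
qed

lemma co_cell_L: "compact_open (cell p (L k))"
  by (rule co_cell[OF subgroup_L compact_L order_refl])

lemma co_L: "compact_open (L k)"
  using co_cell_L[of 0 k] by (simp add: cell_def)

text \<open>A Lebesgue number: cells are cosets, so a smaller cell meeting a larger one lies inside
  it, and the smallest cell of a finite subcover gives a radius valid at every point.\<close>

lemma co_uniform:
  fixes A :: "'v set"
  assumes "compact_open A"
  shows "\<exists>K. \<forall>k\<ge>K. \<forall>p\<in>A. cell p (L k) \<subseteq> A"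
proof -
  obtain h where h: "cell p (L (h p)) \<subseteq> A" if "p \<in> A" for p
    using assms unfolding compact_open_def open_iff by metis
  have "A \<subseteq> (\<Union>p\<in>A. cell p (L (h p)))"
    using cell_self[OF subgroup_L] by blast
  then obtain D where D: "D \<subseteq> A" "finite D" "A \<subseteq> (\<Union>p\<in>D. cell p (L (h p)))"
    using compactE_image[of A A "\<lambda>p. cell p (L (h p))"] assms co_cell_L unfolding compact_open_def by metis
  \<comment> \<open>The extra 0 keeps the maximum defined when \<open>D\<close> is empty; any value
    is then admissible.\<close>
  have "cell z (L k) \<subseteq> A" if k: "k \<ge> Max (insert 0 (h ` D))" and z: "z \<in> A" for k z
  proof -
    obtain p where p: "p \<in> D" "z \<in> cell p (L (h p))"
      using D(3) z by blast
    have "h p \<le> Max (insert 0 (h ` D))"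
      using D(2) p(1) by (intro Max_ge) auto
    then have "L k \<subseteq> L (h p)"
      using k by (intro mono_L) simp
    then have "cell z (L k) \<subseteq> cell z (L (h p))"
      by (auto simp: cell_def)
    also have "\<dots> = cell p (L (h p))"
      by (rule cell_eq[OF subgroup_L p(2)])
    also have "\<dots> \<subseteq> A"
      using h D(1) p(1) by blast
    finally show ?thesis .
  qed
  then show ?thesis
    by blast
qed

lemma co_bounded:
  fixes A :: "'v set"
  assumes "compact_open A"
  shows "\<exists>k. A \<subseteq> L k"
proof -
  have "A \<subseteq> (\<Union>k\<in>UNIV. L k)"
    using exhaust_L by blast
  then obtain D where D: "finite D" "A \<subseteq> (\<Union>k\<in>D. L k)"
    using compactE_image[of A UNIV L] assms co_L unfolding compact_open_def by metis
  have "L k \<subseteq> L (Min (insert 0 D))" if "k \<in> D" for k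
    using D(1) that by (intro mono_L Min_le) auto
  then show ?thesis
    using D(2) by blast
qed

lemma co_closed: "compact_open A \<Longrightarrow> closed A" for A :: "'v set"
proof -
  assume A: "compact_open A"
  then obtain K where K: "cell p (L K) \<subseteq> A" if "p \<in> A" for p
    using co_uniform by blast
  have "cell p (L K) \<subseteq> - A" if "p \<notin> A" for p
    using K cell_sym[OF subgroup_L] that by blast
  then show ?thesis
    unfolding closed_def open_iff by blast
qed

lemma co_Int: "compact_open A \<Longrightarrow> compact_open B \<Longrightarrow> compact_open (A \<inter> B)" for A B :: "'v set"
  using compact_Int_closed[of A B] co_closed[of B] by (auto simp: compact_open_def)

lemma co_Diff: "compact_open A \<Longrightarrow> compact_open B \<Longrightarrow> compact_open (A - B)" for A B :: "'v set"
  using compact_diff[of A B] co_closed[of B] by (auto simp: compact_open_def)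

lemma fin_additive_split:
  "fin_additive m \<Longrightarrow> compact_open A \<Longrightarrow> compact_open B \<Longrightarrow> m A = m (A \<inter> B) + m (A - B)" for A B :: "'v set"
proof -
  assume m: "fin_additive m" and A: "compact_open A" and B: "compact_open B"
  have "m ((A \<inter> B) \<union> (A - B)) = m (A \<inter> B) + m (A - B)"
    using m co_Int[OF A B] co_Diff[OF A B] unfolding fin_additive_def by blast
  then show ?thesis
    by (simp add: Int_Diff_Un)
qed

text \<open>Finitely many null neighbourhoods cover \<open>A\<close>; they are cut off one at a time
  by additivity.\<close>

lemma null_at_imp_zero:
  fixes A :: "'v set"
  assumes m: "fin_additive m" and A: "compact_open A" and null: "\<And>p. p \<in> A \<Longrightarrow> null_at m p"
  shows "m A = 0"
proof -
  have "\<forall>p\<in>A. \<exists>U. compact_open U \<and> p \<in> U \<and> (\<forall>B. compact_open B \<longrightarrow> B \<subseteq> U \<longrightarrow> m B = 0)"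
    using null unfolding null_at_def by blast
  from bchoice[OF this] obtain U where
    U0: "\<forall>p\<in>A. compact_open (U p) \<and> p \<in> U p \<and> (\<forall>B. compact_open B \<longrightarrow> B \<subseteq> U p \<longrightarrow> m B = 0)" ..
  then have U: "compact_open (U p)" "p \<in> U p" "compact_open B \<Longrightarrow> B \<subseteq> U p \<Longrightarrow> m B = 0" if "p \<in> A" for p B
    using that by auto
  obtain D where D: "D \<subseteq> A" "finite D" "A \<subseteq> (\<Union>p\<in>D. U p)"
  proof (rule compactE_image[of A A U])
    show "compact A" "\<And>p. p \<in> A \<Longrightarrow> open (U p)"
      using A U(1) by (auto simp: compact_open_def)
    show "A \<subseteq> (\<Union>p\<in>A. U p)"
      using U(2) by blast
  qed blast
  have "compact_open B \<Longrightarrow> B \<subseteq> (\<Union>p\<in>D. U p) \<Longrightarrow> m B = 0" for B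
    using D(2,1)
  proof (induction arbitrary: B rule: finite_induct)
    case empty
    then show ?case
      using fin_additive_empty[OF m] by simp
  next
    case (insert p D)
    have "p \<in> A"
      using insert.prems by simp
    have "m (B \<inter> U p) = 0"
      using U(1,3)[OF \<open>p \<in> A\<close>] insert.prems(1) co_Int by blast
    moreover have "m (B - U p) = 0"
      using insert.prems U(1)[OF \<open>p \<in> A\<close>] by (intro insert.IH co_Diff) auto
    ultimately show ?case
      using fin_additive_split[OF m insert.prems(1) U(1)[OF \<open>p \<in> A\<close>]] by simp
  qed
  then show ?thesis
    using A D(3) by blast
qed

text \<open>\<open>A\<close> and \<open>B\<close> differ only off \<open>Z\<close>. So
  \<open>m\<close>, being supported on \<open>Z\<close>, depends only on the trace of a set on
  \<open>Z\<close>; this replaces restricting distributions to closed subsets.\<close>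

lemma eq_if_null_off:
  fixes A B Z :: "'v set"
  assumes m: "fin_additive m" and null: "\<And>A. compact_open A \<Longrightarrow> A \<inter> Z = {} \<Longrightarrow> m A = 0"
    and A: "compact_open A" and B: "compact_open B" and eq: "A \<inter> Z = B \<inter> Z"
  shows "m A = m B"
proof -
  have "m (A - B) = 0" "m (B - A) = 0"
    using eq by (auto intro!: null co_Diff A B)
  then show ?thesis
    using fin_additive_split[OF m A B] fin_additive_split[OF m B A] by (simp add: Int_commute)
qed

text \<open>The cosets of \<open>M\<close> in \<open>W\<close> are disjoint and open, so compactness
  of \<open>W\<close> leaves only finitely many.\<close>

lemma coset_sum:
  fixes W M :: "'v set"
  assumes m: "fin_additive m" and W: "compact_open W" and M: "is_subgroup M"
    and coM: "\<And>p. compact_open (cell p M)" and stable: "\<And>p. p \<in> W \<Longrightarrow> cell p M \<subseteq> W"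
  shows "finite ((\<lambda>p. cell p M) ` W)" "m W = (\<Sum>C\<in>(\<lambda>p. cell p M) ` W. m C)"
proof -
  let ?P = "(\<lambda>p. cell p M) ` W"
  have un: "\<Union>?P = W"
    using stable cell_self[OF M] by blast
  have disj: "X \<inter> Y = {}" if "X \<in> ?P" "Y \<in> ?P" "X \<noteq> Y" for X Y
    using that cell_eq[OF M] by blast
  obtain D where D: "D \<subseteq> W" "finite D" "W \<subseteq> (\<Union>p\<in>D. cell p M)"
    using compactE_image[of W W "\<lambda>p. cell p M"] W coM un unfolding compact_open_def by (metis order_refl)
  have "?P \<subseteq> (\<lambda>p. cell p M) ` D"
  proof
    fix X assume "X \<in> ?P"
    then obtain z where z: "z \<in> W" "X = cell z M"
      by blast
    then obtain p where "p \<in> D" "z \<in> cell p M"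
      using D(3) by blast
    then show "X \<in> (\<lambda>p. cell p M) ` D"
      using z cell_eq[OF M] by blast
  qed
  then show fin: "finite ?P"
    using D(2) finite_surj by blast
  show "m W = (\<Sum>C\<in>?P. m C)"
    using fin_additive_Union[OF m fin] coM disj un by auto
qed

lemma zero_if_cosets_zero:
  fixes W M :: "'v set"
  assumes "fin_additive m" "compact_open W" "is_subgroup M" "\<And>p. compact_open (cell p M)" "\<And>p. p \<in> W \<Longrightarrow> cell p M \<subseteq> W"
    and "\<And>p. p \<in> W \<Longrightarrow> m (cell p M) = 0"
  shows "m W = 0"
proof -
  have "m W = (\<Sum>C\<in>(\<lambda>p. cell p M) ` W. m C)"
    by (rule coset_sum(2)[OF assms(1-5)])
  also have "\<dots> = 0"
    by (rule sum.neutral) (use assms(6) in auto)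
  finally show ?thesis .
qed

text \<open>The averaging argument: \<open>m W\<close> is the value at \<open>p0\<close> times the
  number of cosets with nonzero value. If that value were nonzero, the number would be at least 1,
  and a positive integer is nonzero in the complex numbers.\<close>

lemma coset_zero:
  fixes W M :: "'v set"
  assumes "fin_additive m" "compact_open W" "is_subgroup M" "\<And>p. compact_open (cell p M)" "\<And>p. p \<in> W \<Longrightarrow> cell p M \<subseteq> W"
    and zero: "m W = 0" and p0: "p0 \<in> W"
    and vals: "\<And>p. p \<in> W \<Longrightarrow> m (cell p M) = 0 \<or> m (cell p M) = m (cell p0 M)"
  shows "m (cell p0 M) = 0"
proof (rule ccontr)
  let ?P = "(\<lambda>p. cell p M) ` W" and ?z = "m (cell p0 M)"
  assume nz: "?z \<noteq> 0"
  have fin: "finite ?P"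
    by (rule coset_sum(1)[OF assms(1-5)])
  have "m W = (\<Sum>C\<in>?P. m C)"
    by (rule coset_sum(2)[OF assms(1-5)])
  also have "\<dots> = (\<Sum>C\<in>{C \<in> ?P. m C \<noteq> 0}. m C)"
    by (rule sum.mono_neutral_right) (use fin in auto)
  also have "\<dots> = (\<Sum>C\<in>{C \<in> ?P. m C \<noteq> 0}. ?z)"
    by (rule sum.cong) (use vals in auto)
  also have "\<dots> = of_nat (card {C \<in> ?P. m C \<noteq> 0}) * ?z"
    by simp
  finally have "card {C \<in> ?P. m C \<noteq> 0} = 0"
    using zero nz by simp
  moreover have "cell p0 M \<in> {C \<in> ?P. m C \<noteq> 0}"
    using p0 nz by auto
  moreover have "finite {C \<in> ?P. m C \<noteq> 0}"
    using fin by simp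
  ultimately show False
    by (metis (no_types) card_0_eq empty_iff)
qed

end

section \<open>Boxes in the coordinate space and its square\<close>

definition ibox :: "('n \<Rightarrow> int) \<Rightarrow> ('f::nonarch_local_field ^ 'n) set" where
  "ibox k = {x. \<forall>i. x $ i \<in> ideal_pow (k i)}"

abbreviation icube :: "int \<Rightarrow> ('f::nonarch_local_field ^ 'n) set" where
  "icube k \<equiv> ibox (\<lambda>_. k)"

lemma subgroup_box: "is_subgroup (ibox k)"
  by (auto simp: is_subgroup_def ibox_def intro: ideal_pow_diff)

lemma box_mono: "(\<And>i. k i \<le> l i) \<Longrightarrow> ibox l \<subseteq> ibox k"
  by (auto simp: ibox_def intro: ideal_pow_mono)

text \<open>Tychonoff for the product of the ideals, transported to the vector type.\<close>

lemma compact_box: "compact (ibox k :: ('f::nonarch_local_field ^ 'n) set)"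
proof -
  have "compactin (product_topology (\<lambda>i. euclidean) UNIV) (PiE UNIV (\<lambda>i. ideal_pow (k i) :: 'f set))"
    by (simp add: compactin_PiE compact_ideal_pow)
  then have "compact (PiE UNIV (\<lambda>i. ideal_pow (k i) :: 'f set))"
    by (simp add: euclidean_product_topology)
  moreover have "continuous_on (PiE UNIV (\<lambda>i. ideal_pow (k i) :: 'f set)) (\<lambda>f. \<chi> i. f i)"
    by (intro continuous_on_vec_lambda continuous_on_subset[OF continuous_on_product_coordinates]) auto
  ultimately have "compact ((\<lambda>f. \<chi> i. f i) ` PiE UNIV (\<lambda>i. ideal_pow (k i) :: 'f set))"
    by (metis compact_continuous_image)
  moreover have "(\<lambda>f. \<chi> i. f i) ` PiE UNIV (\<lambda>i. ideal_pow (k i) :: 'f set) = ibox k"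
    by (force simp: ibox_def intro: image_eqI[of _ _ "\<lambda>i. _ $ i"])
  ultimately show ?thesis
    by simp
qed

lemma ex_cube: "\<exists>k. (x :: 'f::nonarch_local_field ^ 'n) \<in> icube k"
proof -
  obtain k where k: "\<forall>i. x $ i \<in> ideal_pow (k i)"
    using choice[of "\<lambda>i k. x $ i \<in> ideal_pow k"] ex_ideal_pow by blast
  have "x $ i \<in> ideal_pow (Min (range k))" for i
    by (rule ideal_pow_mono[OF _ spec[OF k]]) simp
  then show ?thesis
    by (auto simp: ibox_def)
qed

lemma open_vec_iff:
  "open U \<longleftrightarrow> (\<forall>p\<in>U. \<exists>k. cell p (icube k) \<subseteq> U)" for U :: "('f::nonarch_local_field ^ 'n) set"
proof
  assume U: "open U"
  show "\<forall>p\<in>U. \<exists>k. cell p (icube k) \<subseteq> U"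
  proof
    fix p assume "p \<in> U"
    then obtain A where A: "\<And>i. open (A i)" "\<And>i. p $ i \<in> A i" "\<And>y. (\<And>i. y $ i \<in> A i) \<Longrightarrow> y \<in> U"
      using U unfolding open_vec_def by meson
    have "\<forall>i. \<exists>k. \<forall>z. z - p $ i \<in> ideal_pow k \<longrightarrow> z \<in> A i"
      using A(1,2) unfolding open_ideal_pow_iff by blast
    then obtain k where k: "\<And>i z. z - p $ i \<in> ideal_pow (k i) \<Longrightarrow> z \<in> A i"
      by (auto dest!: choice)
    have "z \<in> U" if z: "z \<in> cell p (icube (Max (range k)))" for z
    proof (rule A(3), rule k)
      fix i
      show "z $ i - p $ i \<in> ideal_pow (k i)"
        using z by (intro ideal_pow_mono[of "k i" "Max (range k)"]) (auto simp: cell_def ibox_def)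
    qed
    then show "\<exists>k. cell p (icube k) \<subseteq> U"
      by blast
  qed
next
  assume U: "\<forall>p\<in>U. \<exists>k. cell p (icube k) \<subseteq> U"
  show "open U"
    unfolding open_vec_def
  proof
    fix p assume "p \<in> U"
    then obtain k where k: "cell p (icube k) \<subseteq> U"
      using U by blast
    have "open {z. z - p $ i \<in> ideal_pow k}" for i
      unfolding open_ideal_pow_iff
    proof (intro ballI exI[of _ k] allI impI)
      fix x y assume "x \<in> {z. z - p $ i \<in> ideal_pow k}" "y - x \<in> ideal_pow k"
      then show "y \<in> {z. z - p $ i \<in> ideal_pow k}"
        using ideal_pow_add[of "y - x" k "x - p $ i"] by simp
    qed
    then show "\<exists>A. (\<forall>i. open (A i) \<and> p $ i \<in> A i) \<and> (\<forall>y. (\<forall>i. y $ i \<in> A i) \<longrightarrow> y \<in> U)"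
      using k by (intro exI[of _ "\<lambda>i. {z. z - p $ i \<in> ideal_pow k}"]) (auto simp: cell_def ibox_def)
  qed
qed

interpretation vec_ultra: ultra_group "icube :: int \<Rightarrow> ('f::nonarch_local_field ^ 'n) set"
  by unfold_locales
    (auto simp: subgroup_box compact_box ex_cube open_vec_iff intro: subsetD[OF box_mono])

lemma co_cell_box: "compact_open (cell p (ibox k :: ('f::nonarch_local_field ^ 'n) set))"
  by (rule vec_ultra.co_cell[OF subgroup_box compact_box box_mono, of k "Max (range k)"]) simp

lemma subgroup_Times: "is_subgroup A \<Longrightarrow> is_subgroup B \<Longrightarrow> is_subgroup (A \<times> B)"
  by (auto simp: is_subgroup_def zero_prod_def)

lemma cell_Times: "cell (x, y) (A \<times> B) = cell x A \<times> cell y B"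
  by (auto simp: cell_def)

interpretation pair_ultra: ultra_group "\<lambda>k. icube k \<times> icube k :: (('f::nonarch_local_field ^ 'n) \<times> ('f ^ 'n)) set"
proof
  fix k l :: int and U :: "(('f ^ 'n) \<times> ('f ^ 'n)) set" and x :: "('f ^ 'n) \<times> ('f ^ 'n)"
  show "is_subgroup (icube k \<times> icube k :: (('f ^ 'n) \<times> ('f ^ 'n)) set)"
    by (intro subgroup_Times subgroup_box)
  show "compact (icube k \<times> icube k :: (('f ^ 'n) \<times> ('f ^ 'n)) set)"
    by (intro compact_Times compact_box)
  have mono: "icube b \<times> icube b \<subseteq> (icube a \<times> icube a :: (('f ^ 'n) \<times> ('f ^ 'n)) set)" if "a \<le> b" for a b
    using that by (intro Sigma_mono box_mono)
  then show "k \<le> l \<Longrightarrow> icube l \<times> icube l \<subseteq> (icube k \<times> icube k :: (('f ^ 'n) \<times> ('f ^ 'n)) set)" .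
  obtain a b where "fst x \<in> icube a" "snd x \<in> icube b"
    using ex_cube by blast
  then have "x \<in> icube (min a b) \<times> icube (min a b)"
    using box_mono[of "\<lambda>_. min a b" "\<lambda>_. a"] box_mono[of "\<lambda>_. min a b" "\<lambda>_. b"] by (auto simp: mem_Times_iff)
  then show "\<exists>k. x \<in> icube k \<times> icube k" ..
  show "open U \<longleftrightarrow> (\<forall>p\<in>U. \<exists>k. cell p (icube k \<times> icube k) \<subseteq> U)"
  proof
    assume U: "open U"
    show "\<forall>p\<in>U. \<exists>k. cell p (icube k \<times> icube k) \<subseteq> U"
    proof
      fix p assume "p \<in> U"
      then obtain A B where AB: "open A" "open B" "p \<in> A \<times> B" "A \<times> B \<subseteq> U"
        by (rule open_prod_elim[OF U])
      obtain a b where ab: "cell (fst p) (icube a) \<subseteq> A" "cell (snd p) (icube b) \<subseteq> B"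
        using AB unfolding open_vec_iff by (metis mem_Times_iff)
      have "cell p (icube (max a b) \<times> icube (max a b)) \<subseteq> cell p (icube a \<times> icube b)"
        using box_mono[of "\<lambda>_. a" "\<lambda>_. max a b"] box_mono[of "\<lambda>_. b" "\<lambda>_. max a b"]
        by (auto simp: cell_def mem_Times_iff)
      also have "\<dots> = cell (fst p) (icube a) \<times> cell (snd p) (icube b)"
        by (metis cell_Times prod.collapse)
      also have "\<dots> \<subseteq> U"
        using ab AB(4) by blast
      finally show "\<exists>k. cell p (icube k \<times> icube k) \<subseteq> U" ..
    qed
  next
    assume U: "\<forall>p\<in>U. \<exists>k. cell p (icube k \<times> icube k) \<subseteq> U"
    show "open U"
    proof (rule open_prod_intro)
      fix p assume "p \<in> U"
      then obtain k where k: "cell p (icube k \<times> icube k) \<subseteq> U"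
        using U by blast
      then have "cell (fst p) (icube k) \<times> cell (snd p) (icube k) \<subseteq> U"
        by (metis cell_Times prod.collapse)
      then show "\<exists>A B. open A \<and> open B \<and> p \<in> A \<times> B \<and> A \<times> B \<subseteq> U"
        using vec_ultra.co_cell_L cell_self[OF subgroup_box] unfolding compact_open_def
        by (metis mem_Times_iff)
    qed
  qed
qed

section \<open>Triangular equivariance on a coordinate space\<close>

definition dilate :: "'n \<Rightarrow> 'f::field \<Rightarrow> 'f ^ 'n \<Rightarrow> 'f ^ 'n" where
  "dilate i t y = (\<chi> k. if k = i then t * y $ k else y $ k)"

definition shear :: "'n \<Rightarrow> 'n \<Rightarrow> 'f::field \<Rightarrow> 'f ^ 'n \<Rightarrow> 'f ^ 'n" where
  "shear i j w y = (\<chi> k. if k = j then y $ k + w * y $ i else y $ k)"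

lemma dilate_nth [simp]: "dilate i t y $ k = (if k = i then t * y $ k else y $ k)"
  by (simp add: dilate_def)

lemma shear_nth [simp]: "shear i j w y $ k = (if k = j then y $ k + w * y $ i else y $ k)"
  by (simp add: shear_def)

lemma dilate_inverse [simp]:
  "t \<noteq> 0 \<Longrightarrow> dilate i t (dilate i (inverse t) y) = y" "t \<noteq> 0 \<Longrightarrow> dilate i (inverse t) (dilate i t y) = y"
  by (simp_all add: vec_eq_iff)

lemma shear_inverse [simp]:
  "i \<noteq> j \<Longrightarrow> shear i j w (shear i j (- w) y) = y" "i \<noteq> j \<Longrightarrow> shear i j (- w) (shear i j w y) = y"
  by (simp_all add: vec_eq_iff)

lemma dilate_diff: "dilate i t (x - y) = dilate i t x - dilate i t y"
  by (simp add: vec_eq_iff algebra_simps)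

lemma shear_diff: "shear i j w (x - y) = shear i j w x - shear i j w y"
  by (simp add: vec_eq_iff algebra_simps)

lemma smult_diff: "t *s (x - y) = t *s x - t *s (y :: 'f::field ^ 'n)"
  by (simp add: vec_eq_iff algebra_simps)

lemma smult_inverse [simp]:
  "t \<noteq> 0 \<Longrightarrow> t *s (inverse t *s y) = (y :: 'f::field ^ 'n)" "t \<noteq> 0 \<Longrightarrow> inverse t *s (t *s y) = y"
  by (simp_all add: vec_eq_iff)

lemma image_cell:
  assumes "\<And>x y. f (x - y) = f x - f y" "\<And>x. f (g x) = x" "\<And>x. g (f x) = x"
  shows "f ` cell p M = cell (f p) (f ` M)"
proof (intro equalityI subsetI)
  fix z assume "z \<in> cell (f p) (f ` M)"
  then obtain a where a: "a \<in> M" "z - f p = f a"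
    by (auto simp: cell_def)
  have "f (g z - p) = f a"
    using a(2) by (simp add: assms)
  then have "g z - p = a"
    by (metis assms(3))
  then have "g z \<in> cell p M"
    using a(1) by (simp add: cell_def)
  then have "f (g z) \<in> f ` cell p M"
    by (rule imageI)
  then show "z \<in> f ` cell p M"
    by (simp add: assms(2))
qed (auto simp: cell_def assms(1)[symmetric])

lemma const_fun_upd [simp]: "(\<lambda>_. k)(i := k) = (\<lambda>_. k)"
  by auto

lemma dilate_box:
  fixes t :: "'f::nonarch_local_field" and i :: "'n::finite"
  shows "t \<noteq> 0 \<Longrightarrow> dilate i t ` ibox k = ibox (k(i := k i + val t))"
proof (intro equalityI subsetI)
  fix y :: "'f ^ 'n"
  assume t: "t \<noteq> 0" and y: "y \<in> ibox (k(i := k i + val t))"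
  have ya: "y $ a \<in> ideal_pow (if a = i then k i + val t else k a)" for a
    using y by (auto simp: ibox_def fun_upd_def)
  have "dilate i (inverse t) y $ a \<in> ideal_pow (k a)" for a
    using ya[of a] t by (cases "a = i") (simp_all add: ideal_pow_scale val_inverse)
  then have "dilate i (inverse t) y \<in> ibox k"
    by (simp add: ibox_def)
  then have "dilate i t (dilate i (inverse t) y) \<in> dilate i t ` ibox k"
    by (rule imageI)
  then show "y \<in> dilate i t ` ibox k"
    using t by simp
qed (auto simp: ibox_def ideal_pow_scale)

text \<open>The exponents add up: \<open>w * y $ i\<close> lies in the ideal of exponent
  \<open>(k j - k i) + k i = k j\<close>.\<close>

lemma shear_box:
  fixes w :: "'f::nonarch_local_field" and i :: "'n::finite"
  shows "i \<noteq> j \<Longrightarrow> w \<in> ideal_pow (k j - k i) \<Longrightarrow> shear i j w ` ibox k = ibox k"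
proof -
  assume ij: "i \<noteq> j" and w: "w \<in> ideal_pow (k j - k i)"
  have sub: "shear i j v y \<in> ibox k" if "v \<in> ideal_pow (k j - k i)" "y \<in> ibox k" for v and y :: "'f ^ 'n"
    using ideal_pow_mult[OF that(1), of "y $ i" "k i"] that(2)
    by (auto simp: ibox_def intro: ideal_pow_add)
  show ?thesis
  proof (intro equalityI subsetI)
    fix y :: "'f ^ 'n"
    assume "y \<in> ibox k"
    then have "shear i j w (shear i j (- w) y) \<in> shear i j w ` ibox k"
      using sub[of "- w" y] w by (intro imageI) simp
    then show "y \<in> shear i j w ` ibox k"
      using ij by simp
  qed (use sub w in auto)
qed

lemma smult_box:
  fixes t :: "'f::nonarch_local_field"
  shows "t \<noteq> 0 \<Longrightarrow> (*s) t ` ibox k = (ibox (\<lambda>i. k i + val t) :: ('f ^ 'n) set)"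
proof (intro equalityI subsetI)
  fix y :: "'f ^ 'n"
  assume t: "t \<noteq> 0" and y: "y \<in> ibox (\<lambda>i. k i + val t)"
  have "inverse t *s y \<in> ibox k"
    using y t by (auto simp: ibox_def ideal_pow_scale val_inverse)
  then have "t *s (inverse t *s y) \<in> (*s) t ` ibox k"
    by (rule imageI)
  then show "y \<in> (*s) t ` ibox k"
    using t by simp
qed (auto simp: ibox_def ideal_pow_scale)

lemma dilate_cell: "t \<noteq> 0 \<Longrightarrow> dilate i t ` cell p M = cell (dilate i t p) (dilate i t ` M)"
  by (rule image_cell[of _ "dilate i (inverse t)"]) (simp_all add: dilate_diff)

lemma shear_cell: "i \<noteq> j \<Longrightarrow> shear i j w ` cell p M = cell (shear i j w p) (shear i j w ` M)"
  by (rule image_cell[of _ "shear i j (- w)"]) (simp_all add: shear_diff)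

lemma smult_cell: "t \<noteq> 0 \<Longrightarrow> (*s) t ` cell p M = cell (t *s p) ((*s) t ` M)" for p :: "'f::field ^ 'n"
  by (rule image_cell[of _ "(*s) (inverse t)"]) (simp_all add: smult_diff)

lemma cts_dilate: "t \<noteq> 0 \<Longrightarrow> vec_ultra.cts_hom (dilate i t)" for t :: "'f::nonarch_local_field"
proof -
  assume t: "t \<noteq> 0"
  have "dilate i t ` icube (max k (k - val t)) \<subseteq> icube k" for k
    unfolding dilate_box[OF t] by (rule box_mono) auto
  then show ?thesis
    unfolding vec_ultra.cts_hom_def by (auto simp: dilate_diff)
qed

lemma cts_smult: "t \<noteq> 0 \<Longrightarrow> vec_ultra.cts_hom ((*s) t :: 'f ^ 'n \<Rightarrow> 'f ^ 'n)" for t :: "'f::nonarch_local_field"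
proof -
  assume t: "t \<noteq> 0"
  have "(*s) t ` icube (k - val t) \<subseteq> (icube k :: ('f ^ 'n) set)" for k
    unfolding smult_box[OF t] by simp
  then show ?thesis
    unfolding vec_ultra.cts_hom_def by (auto simp: smult_diff)
qed

lemma cts_shear: "i \<noteq> j \<Longrightarrow> vec_ultra.cts_hom (shear i j w)" for w :: "'f::nonarch_local_field"
proof -
  assume ij: "i \<noteq> j"
  obtain l where l: "w \<in> ideal_pow l"
    using ex_ideal_pow by blast
  have "shear i j w ` icube (max k (k - l)) \<subseteq> icube k" for k
  proof -
    have "shear i j w y \<in> icube k" if "y \<in> icube (max k (k - l))" for y
    proof -
      have "w * y $ i \<in> ideal_pow (l + max k (k - l))"
        using that by (intro ideal_pow_mult[OF l]) (simp add: ibox_def)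
      then have "w * y $ i \<in> ideal_pow k"
        by (rule ideal_pow_mono[rotated]) simp
      moreover have "y $ a \<in> ideal_pow k" for a
        using that by (intro ideal_pow_mono[of k "max k (k - l)"]) (auto simp: ibox_def)
      ultimately show ?thesis
        by (auto simp: ibox_def intro: ideal_pow_add)
    qed
    then show ?thesis
      by blast
  qed
  then show ?thesis
    unfolding vec_ultra.cts_hom_def by (auto simp: shear_diff)
qed

lemma co_dilate: "t \<noteq> 0 \<Longrightarrow> compact_open A \<Longrightarrow> compact_open (dilate i t ` A)" for A :: "('f::nonarch_local_field ^ 'n) set"
  by (rule vec_ultra.co_image[of _ "dilate i (inverse t)"]) (simp_all add: cts_dilate)

lemma co_shear: "i \<noteq> j \<Longrightarrow> compact_open A \<Longrightarrow> compact_open (shear i j w ` A)" for A :: "('f::nonarch_local_field ^ 'n) set"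
  by (rule vec_ultra.co_image[of _ "shear i j (- w)"]) (simp_all add: cts_shear)

lemma co_box: "compact_open (ibox k :: ('f::nonarch_local_field ^ 'n) set)"
  using co_cell_box[of 0 k] by (simp add: cell_def)

lemma val_unit: "t - 1 \<in> ideal_pow 1 \<Longrightarrow> t \<noteq> 0 \<and> val t = 0" for t :: "'f::nonarch_local_field"
  using val_one_plus[of "t - 1"] by simp

text \<open>
  Shears into coordinate \<open>i0\<close> are excluded: in the application they do not fix the base point of
  the fibre.
\<close>

locale borel_dist =
  fixes \<mu> :: "('f::nonarch_local_field ^ 'n) set \<Rightarrow> complex"
    and \<alpha> :: "'n \<Rightarrow> 'f \<Rightarrow> complex" and i0 :: 'n and k0 :: int
  assumes additive: "fin_additive \<mu>"
    and mu_dilate: "t \<noteq> 0 \<Longrightarrow> compact_open A \<Longrightarrow> \<mu> (dilate i t ` A) = \<alpha> i t * \<mu> A"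
    and mu_shear: "i \<noteq> j \<Longrightarrow> j \<noteq> i0 \<Longrightarrow> compact_open A \<Longrightarrow> \<mu> (shear i j w ` A) = \<mu> A"
    and smooth: "t - 1 \<in> ideal_pow k0 \<Longrightarrow> \<alpha> i t = 1"
    and k0: "1 \<le> k0"
begin

definition zeros :: "'n set \<Rightarrow> ('f ^ 'n) set" where
  "zeros J = {y. \<forall>j\<in>J. y $ j = 0}"

text \<open>The support of \<open>\<mu>\<close> is contained in the coordinate subspace
  \<open>zeros J\<close>.\<close>

definition null_off :: "'n set \<Rightarrow> bool" where
  "null_off J \<longleftrightarrow> (\<forall>p. p \<notin> zeros J \<longrightarrow> null_at \<mu> p)"

lemma null_offD: "null_off J \<Longrightarrow> compact_open A \<Longrightarrow> A \<inter> zeros J = {} \<Longrightarrow> \<mu> A = 0"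
  using vec_ultra.null_at_imp_zero[OF additive, of A] unfolding null_off_def by blast

lemma eq_on_zeros:
  assumes J: "null_off J" and AB: "compact_open A" "compact_open B" "A \<inter> zeros J = B \<inter> zeros J"
  shows "\<mu> A = \<mu> B"
  by (rule vec_ultra.eq_if_null_off[OF additive _ AB]) (rule null_offD[OF J])

text \<open>Gaussian elimination with pivot \<open>c $ i = 1\<close>. The multipliers
  \<open>- c $ j\<close> are integral, so every cube is preserved and only the centre of the cell
  changes. Coordinate \<open>i0\<close> cannot be a target.\<close>

lemma clear_coords:
  assumes "finite S" "i \<notin> S" "i0 \<notin> S" "c $ i = 1" "c \<in> icube 0"
  shows "\<mu> (cell c (icube k)) = \<mu> (cell (\<chi> j. if j \<in> S then 0 else c $ j) (icube k))"
  using assms(1-3)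
proof (induction rule: finite_induct)
  case (insert j S)
  let ?c = "\<chi> j. if j \<in> S then 0 else c $ j"
  have ij: "i \<noteq> j" "j \<noteq> i0"
    using insert.prems by auto
  have "- c $ j \<in> ideal_pow (k - k)"
    using assms(5) by (simp add: ibox_def)
  then have "shear i j (- c $ j) ` cell ?c (icube k) = cell (shear i j (- c $ j) ?c) (icube k)"
    by (subst shear_cell[OF ij(1)], subst shear_box[OF ij(1)]) simp_all
  also have "shear i j (- c $ j) ?c = (\<chi> l. if l \<in> insert j S then 0 else c $ l)"
    using insert.prems insert.hyps assms(4) by (auto simp: vec_eq_iff)
  finally show ?case
    using mu_shear[OF ij vec_ultra.co_cell_L, of "- c $ j" ?c k] insert.IH insert.prems by simp
qed simp

text \<open>Either the cell misses \<open>zeros J\<close>, where \<open>\<mu>\<close> lives, or its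
  centre can be normalised to the axis vector: a unit dilation makes coordinate \<open>i\<close>
  equal to 1, shears clear the others. Thus up to the factor \<open>\<alpha> i (c $ i)\<close> all
  cells of one depth have only two possible values.\<close>

lemma mu_cell:
  assumes J: "null_off J" "i \<notin> J" "i = i0 \<or> i0 \<in> J"
    and c: "c \<in> icube 0" "c $ i \<noteq> 0" "val (c $ i) = 0"
  shows "\<mu> (cell c (icube k)) =
    (if \<forall>j\<in>J. c $ j \<in> ideal_pow k then \<alpha> i (c $ i) * \<mu> (cell (axis i 1) (icube k)) else 0)"
proof (cases "\<forall>j\<in>J. c $ j \<in> ideal_pow k")
  case False
  then obtain j where j: "j \<in> J" "c $ j \<notin> ideal_pow k"
    by blast
  have "cell c (icube k) \<inter> zeros J = {}"
  proof -
    have "y $ j \<noteq> 0" if "y \<in> cell c (icube k)" for y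
    proof
      assume "y $ j = 0"
      then have "- c $ j \<in> ideal_pow k"
        using that by (auto simp: cell_def ibox_def dest!: spec[of _ j])
      then show False
        using j(2) by simp
    qed
    then show ?thesis
      using j(1) by (auto simp: zeros_def)
  qed
  then have "\<mu> (cell c (icube k)) = 0"
    by (rule null_offD[OF J(1) vec_ultra.co_cell_L])
  then show ?thesis
    by (simp only: False if_False)
next
  case True
  let ?c1 = "dilate i (inverse (c $ i)) c"
  let ?S = "{j. j \<noteq> i \<and> j \<noteq> i0}"
  let ?c2 = "\<chi> j. if j \<in> ?S then 0 else ?c1 $ j"
  have "dilate i (c $ i) ` cell ?c1 (icube k) = cell c (icube k)"
    using c(2,3) by (simp add: dilate_cell dilate_box)
  then have 1: "\<mu> (cell c (icube k)) = \<alpha> i (c $ i) * \<mu> (cell ?c1 (icube k))"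
    using mu_dilate[OF c(2) vec_ultra.co_cell_L, of i ?c1 k] by simp
  have c1: "?c1 $ i = 1" "?c1 \<in> icube 0"
    using c by (auto simp: ibox_def)
  have 2: "\<mu> (cell ?c1 (icube k)) = \<mu> (cell ?c2 (icube k))"
    by (rule clear_coords[OF _ _ _ c1]) auto
  \<comment> \<open>Coordinate \<open>i0\<close> is not cleared. For \<open>i \<noteq> i0\<close> it
    belongs to \<open>J\<close>, so it lies in \<open>ideal_pow k\<close> and is absorbed by the
    cell.\<close>
  have "?c2 $ l - axis i 1 $ l \<in> ideal_pow k" for l
    using True J(3) c1(1) c(2) by (auto simp: axis_def)
  then have "?c2 \<in> cell (axis i 1) (icube k)"
    by (simp add: cell_def ibox_def)
  then have "cell ?c2 (icube k) = cell (axis i 1) (icube k)"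
    by (rule cell_eq[OF subgroup_box])
  then show ?thesis
    using 1 2 True by simp
qed

lemma near_axis:
  assumes "p \<in> cell (axis i 1) (icube k0)"
  shows "p \<in> icube 0" "p $ i - 1 \<in> ideal_pow k0" "p $ i \<noteq> 0" "val (p $ i) = 0" "\<alpha> i (p $ i) = 1"
proof -
  have p: "p $ l - axis i 1 $ l \<in> ideal_pow k0" for l
    using assms by (simp add: cell_def ibox_def)
  show pi: "p $ i - 1 \<in> ideal_pow k0"
    using p[of i] by (simp add: axis_def)
  then have "p $ i - 1 \<in> ideal_pow 1"
    using k0 by (rule ideal_pow_mono[rotated])
  then show "p $ i \<noteq> 0" "val (p $ i) = 0"
    using val_unit by auto
  show "\<alpha> i (p $ i) = 1"
    by (rule smooth[OF pi])
  have "p $ l \<in> ideal_pow 0" for l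
  proof -
    have "p $ l - axis i 1 $ l \<in> ideal_pow 0"
      using k0 by (intro ideal_pow_mono[OF _ p]) simp
    moreover have "axis i 1 $ l \<in> (ideal_pow 0 :: 'f set)"
      by (simp add: axis_def)
    ultimately show ?thesis
      using ideal_pow_add[of "p $ l - axis i 1 $ l" 0 "axis i 1 $ l"] by simp
  qed
  then show "p \<in> icube 0"
    by (simp add: ibox_def)
qed

text \<open>On \<open>W\<close> the factor \<open>\<alpha> i (p $ i)\<close> is 1, so every cell in
  \<open>W\<close> has either the value of the axis cell or 0, and averaging over
  \<open>\<mu> W = 0\<close> kills the axis cell. The same \<open>W\<close> serves at every depth
  \<open>K \<ge> k0\<close>, hence all small cells near the axis vector vanish, not just
  one.\<close>

lemma null_at_axis:
  assumes J: "null_off J" "i \<notin> J" "i = i0 \<or> i0 \<in> J"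
    and W: "compact_open W" "axis i 1 \<in> W" "\<And>p. p \<in> W \<Longrightarrow> cell p (icube k0) \<subseteq> W" "\<mu> W = 0"
    and unit: "\<And>p. p \<in> W \<Longrightarrow> p \<in> icube 0 \<and> p $ i \<noteq> 0 \<and> val (p $ i) = 0 \<and> \<alpha> i (p $ i) = 1"
  shows "null_at \<mu> (axis i 1)"
proof -
  have z: "\<mu> (cell (axis i 1) (icube K)) = 0" if "k0 \<le> K" for K
  proof (rule vec_ultra.coset_zero[OF additive W(1) subgroup_box vec_ultra.co_cell_L _ W(4,2)])
    show "cell p (icube K) \<subseteq> W" if "p \<in> W" for p
      using W(3)[OF that] vec_ultra.mono_L[OF \<open>k0 \<le> K\<close>] unfolding cell_def by blast
    show "\<mu> (cell p (icube K)) = 0 \<or> \<mu> (cell p (icube K)) = \<mu> (cell (axis i 1) (icube K))" if "p \<in> W" for p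
      using mu_cell[OF J, of p K] unit[OF that] by auto
  qed
  have "\<mu> A = 0" if A: "compact_open A" "A \<subseteq> cell (axis i 1) (icube k0)" for A
  proof -
    obtain K0 where K0: "\<And>K p. K0 \<le> K \<Longrightarrow> p \<in> A \<Longrightarrow> cell p (icube K) \<subseteq> A"
      using vec_ultra.co_uniform[OF A(1)] by blast
    show ?thesis
    proof (rule vec_ultra.zero_if_cosets_zero[OF additive A(1) subgroup_box vec_ultra.co_cell_L])
      fix p assume p: "p \<in> A"
      show "cell p (icube (max k0 K0)) \<subseteq> A"
        using K0 p by simp
      show "\<mu> (cell p (icube (max k0 K0))) = 0"
        using near_axis[of p i] p A(2) z[of "max k0 K0"] by (subst mu_cell[OF J]) auto
    qed
  qed
  then show ?thesis
    unfolding null_at_def using vec_ultra.co_cell_L cell_self[OF subgroup_box] by blast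
qed

lemma null_at_dilate: "null_at \<mu> p \<Longrightarrow> t \<noteq> 0 \<Longrightarrow> null_at \<mu> (dilate i t p)"
  by (rule null_at_map[of _ _ _ "dilate i (inverse t)" "\<alpha> i t"]) (simp_all add: co_dilate mu_dilate)

lemma null_at_shear: "null_at \<mu> p \<Longrightarrow> i \<noteq> j \<Longrightarrow> j \<noteq> i0 \<Longrightarrow> null_at \<mu> (shear i j w p)"
  by (rule null_at_map[of _ _ _ "shear i j (- w)" 1]) (simp_all add: co_shear mu_shear)

text \<open>The elimination of \<open>clear_coords\<close> run backwards. Nullity at a point is
  local and survives any shear, so the pivot may be any nonzero number and \<open>c\<close> need not
  be integral.\<close>

lemma null_at_uncleared:
  assumes "finite S" "i \<notin> S" "i0 \<notin> S" "c $ i \<noteq> 0" "null_at \<mu> (\<chi> j. if j \<in> S then 0 else c $ j)"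
  shows "null_at \<mu> c"
  using assms(1-3,5)
proof (induction rule: finite_induct)
  case (insert j S)
  have ij: "i \<noteq> j" "j \<noteq> i0"
    using insert.prems by auto
  have "shear i j (c $ j / c $ i) (\<chi> l. if l \<in> insert j S then 0 else c $ l) = (\<chi> l. if l \<in> S then 0 else c $ l)"
    using insert.prems insert.hyps assms(4) by (auto simp: vec_eq_iff)
  then show ?case
    using null_at_shear[OF insert.prems(3) ij, of "c $ j / c $ i"] insert.IH insert.prems by simp
qed (simp add: vec_lambda_eta)

text \<open>A point of \<open>zeros J\<close> with nonzero coordinate \<open>i\<close> is the image
  of the axis vector under a dilation followed by shears. The entry at \<open>i0\<close>, which
  shears cannot fill, is already 0 when \<open>i \<noteq> i0\<close>, because then
  \<open>i0 \<in> J\<close>.\<close>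

lemma null_off_insert:
  assumes J: "null_off J" "i \<notin> J" "i = i0 \<or> i0 \<in> J" and i: "null_at \<mu> (axis i 1)"
  shows "null_off (insert i J)"
  unfolding null_off_def
proof (intro allI impI)
  fix p assume p: "p \<notin> zeros (insert i J)"
  show "null_at \<mu> p"
  proof (cases "p \<in> zeros J")
    case True
    then have pJ: "p $ j = 0" if "j \<in> J" for j
      using that by (auto simp: zeros_def)
    have pi: "p $ i \<noteq> 0"
      using p True by (auto simp: zeros_def)
    let ?S = "{j. j \<noteq> i \<and> j \<noteq> i0}"
    have "dilate i (p $ i) (axis i 1) = (\<chi> j. if j \<in> ?S then 0 else p $ j)"
      using pJ J(3) by (auto simp: vec_eq_iff axis_def)
    then have "null_at \<mu> (\<chi> j. if j \<in> ?S then 0 else p $ j)"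
      using null_at_dilate[OF i pi, of i] by simp
    then show ?thesis
      by (rule null_at_uncleared[rotated -1]) (use pi in auto)
  qed (use J(1) in \<open>auto simp: null_off_def\<close>)
qed

text \<open>On the support, where \<open>y $ i = 0\<close>, the dilation \<open>dilate i t\<close>
  is the identity; so \<open>\<mu> A = \<alpha> i t * \<mu> A\<close>.\<close>

lemma zero_if_nontrivial:
  assumes "null_off (insert i J)" "t \<noteq> 0" "\<alpha> i t \<noteq> 1" "compact_open A"
  shows "\<mu> A = 0"
proof -
  have fix_zeros: "dilate i t y = y" if "y $ i = 0" for y :: "'f ^ 'n"
    using that by (simp add: vec_eq_iff)
  have "A \<inter> zeros (insert i J) = dilate i t ` A \<inter> zeros (insert i J)"
  proof (intro equalityI subsetI)
    fix y assume y: "y \<in> A \<inter> zeros (insert i J)"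
    then have "dilate i t y = y"
      by (intro fix_zeros) (simp add: zeros_def)
    then show "y \<in> dilate i t ` A \<inter> zeros (insert i J)"
      using y by (metis IntE IntI imageI)
  next
    fix y assume y: "y \<in> dilate i t ` A \<inter> zeros (insert i J)"
    then obtain x where x: "x \<in> A" "y = dilate i t x"
      by blast
    have "y $ i = 0"
      using y by (simp add: zeros_def)
    then have "x $ i = 0"
      using x(2) assms(2) by simp
    then show "y \<in> A \<inter> zeros (insert i J)"
      using x y fix_zeros[of x] by simp
  qed
  then have "\<mu> A = \<mu> (dilate i t ` A)"
    by (rule eq_on_zeros[OF assms(1,4) co_dilate[OF assms(2,4)]])
  then have "\<mu> A * (1 - \<alpha> i t) = 0"
    using mu_dilate[OF assms(2,4), of i] by (simp add: algebra_simps)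
  then show ?thesis
    using assms(3) by simp
qed

section \<open>Vanishing criteria by the type of the torus characters\<close>

definition unit_cube :: "'n \<Rightarrow> ('f ^ 'n) set" where
  "unit_cube i = icube 0 - ibox ((\<lambda>_. 0)(i := 1))"

lemma unit_cube_iff: "p \<in> unit_cube i \<longleftrightarrow> p \<in> icube 0 \<and> p $ i \<noteq> 0 \<and> val (p $ i) = 0"
  by (auto simp: unit_cube_def ibox_def ideal_pow_iff split: if_splits)

text \<open>The unit cube is O^n minus its image under dilating coordinate \<open>i\<close> by the
  uniformizer.\<close>

lemma mu_unit_cube: "\<mu> (unit_cube i) = (1 - \<alpha> i unif) * \<mu> (icube 0)"
proof -
  have "ibox ((\<lambda>_. 0)(i := 1)) \<subseteq> (icube 0 :: ('f ^ 'n) set)"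
    by (rule box_mono) auto
  then have "\<mu> (icube 0) = \<mu> (ibox ((\<lambda>_. 0)(i := 1))) + \<mu> (unit_cube i)"
    using vec_ultra.fin_additive_split[OF additive co_box co_box, of "\<lambda>_. 0" "(\<lambda>_. 0)(i := 1)"]
    by (simp add: unit_cube_def Int_absorb1)
  moreover have "\<mu> (ibox ((\<lambda>_. 0)(i := 1))) = \<alpha> i unif * \<mu> (icube 0)"
    using mu_dilate[OF unif_nz co_box, of i "\<lambda>_. 0"] by (simp add: dilate_box)
  ultimately show ?thesis
    by (simp add: algebra_simps)
qed

text \<open>The unit cube is the set \<open>W\<close> of \<open>null_at_axis\<close>: being
  unramified makes \<open>\<alpha> i (p $ i) = 1\<close> on all of it, and either alternative of
  \<open>zero\<close> makes its measure vanish.\<close>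

lemma null_at_axis_unramified:
  assumes J: "null_off J" "i \<notin> J" "i = i0 \<or> i0 \<in> J"
    and unr: "\<And>u. u \<noteq> 0 \<Longrightarrow> val u = 0 \<Longrightarrow> \<alpha> i u = 1"
    and zero: "\<alpha> i unif = 1 \<or> \<mu> (icube 0) = 0"
  shows "null_at \<mu> (axis i 1)"
proof (rule null_at_axis[OF J, of "unit_cube i"])
  show "compact_open (unit_cube i)"
    unfolding unit_cube_def by (intro vec_ultra.co_Diff co_box)
  show "axis i 1 \<in> unit_cube i"
    by (auto simp: unit_cube_iff ibox_def axis_def)
  show "\<mu> (unit_cube i) = 0"
    using zero by (auto simp: mu_unit_cube)
  show "cell p (icube k0) \<subseteq> unit_cube i" if p: "p \<in> unit_cube i" for p
  proof
    fix y assume "y \<in> cell p (icube k0)"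
    then have y: "y $ l - p $ l \<in> ideal_pow 1" for l
      using ideal_pow_mono[OF k0, of "y $ l - p $ l"] by (auto simp: cell_def ibox_def)
    have "y $ l \<in> ideal_pow 0" for l
      using ideal_pow_add[of "y $ l - p $ l" 0 "p $ l"] ideal_pow_mono[OF _ y, of 0 l] p
      by (auto simp: unit_cube_def ibox_def)
    moreover have "y $ i \<notin> ideal_pow 1"
    proof
      assume "y $ i \<in> ideal_pow 1"
      then have "p $ i \<in> ideal_pow 1"
        using ideal_pow_diff[OF _ y, of "y $ i" i] by simp
      then show False
        using p by (auto simp: unit_cube_iff ideal_pow_iff)
    qed
    ultimately show "y \<in> unit_cube i"
      by (auto simp: unit_cube_def ibox_def dest: spec[of _ i])
  qed
  show "p \<in> icube 0 \<and> p $ i \<noteq> 0 \<and> val (p $ i) = 0 \<and> \<alpha> i (p $ i) = 1" if "p \<in> unit_cube i" for p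
    using that unr by (auto simp: unit_cube_iff)
qed

lemma null_off_empty: "null_off {}"
  by (simp add: null_off_def zeros_def)

text \<open>\<open>i0\<close> has to come first: any other coordinate can be treated only once
  \<open>i0\<close> is in \<open>J\<close>, since shears cannot clear \<open>i0\<close>.\<close>

lemma null_off_trivial:
  assumes "finite S" "i0 \<notin> S" "\<And>j t. j \<in> insert i0 S \<Longrightarrow> t \<noteq> 0 \<Longrightarrow> \<alpha> j t = 1"
  shows "null_off (insert i0 S)"
  using assms
proof (induction rule: finite_induct)
  case empty
  then show ?case
    by (intro null_off_insert null_off_empty null_at_axis_unramified[of "{}"]) auto
next
  case (insert j S)
  have S: "null_off (insert i0 S)"
    using insert.prems by (intro insert.IH) auto
  have j: "j \<notin> insert i0 S" "j = i0 \<or> i0 \<in> insert i0 S"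
    using insert.prems insert.hyps by auto
  have "null_at \<mu> (axis j 1)"
    by (rule null_at_axis_unramified[OF S j]) (use insert.prems in auto)
  then have "null_off (insert j (insert i0 S))"
    by (rule null_off_insert[OF S j])
  then show ?case
    by (simp add: insert_commute)
qed

lemma null_off_trivial_set:
  assumes "\<And>t. t \<noteq> 0 \<Longrightarrow> \<alpha> i0 t = 1"
  shows "null_off {j. \<forall>t. t \<noteq> 0 \<longrightarrow> \<alpha> j t = 1}"
proof -
  have "null_off (insert i0 ({j. \<forall>t. t \<noteq> 0 \<longrightarrow> \<alpha> j t = 1} - {i0}))"
    using assms by (intro null_off_trivial) auto
  moreover have "insert i0 ({j. \<forall>t. t \<noteq> 0 \<longrightarrow> \<alpha> j t = 1} - {i0}) = {j. \<forall>t. t \<noteq> 0 \<longrightarrow> \<alpha> j t = 1}"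
    using assms by auto
  ultimately show ?thesis
    by simp
qed

text \<open>The support shrinks to the origin, so \<open>\<mu>\<close> is a multiple of the Dirac
  functional, and O^n detects the multiple.\<close>

lemma zero_if_all_trivial:
  assumes "\<And>j t. t \<noteq> 0 \<Longrightarrow> \<alpha> j t = 1" "\<mu> (icube 0) = 0" "compact_open A"
  shows "\<mu> A = 0"
proof -
  have "null_off {j. \<forall>t. t \<noteq> 0 \<longrightarrow> \<alpha> j t = 1}"
    using assms(1) by (rule null_off_trivial_set)
  then have null: "null_off UNIV"
    using assms(1) by simp
  have z: "zeros UNIV = {0}"
    by (auto simp: zeros_def vec_eq_iff)
  show ?thesis
  proof (cases "0 \<in> A")
    case True
    then have "A \<inter> zeros UNIV = icube 0 \<inter> zeros UNIV"
      by (auto simp: z ibox_def)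
    then show ?thesis
      using eq_on_zeros[OF null assms(3) co_box] assms(2) by simp
  next
    case False
    then show ?thesis
      using null_offD[OF null assms(3)] by (simp add: z)
  qed
qed

text \<open>Common end of all cases with a nontrivial character: nullity at one axis vector puts the
  support into \<open>y $ i = 0\<close>, where the nontrivial \<open>\<alpha> i\<close> leaves
  nothing.\<close>

lemma zero_if_null_at_axis:
  assumes i: "i = i0 \<or> (\<forall>t. t \<noteq> 0 \<longrightarrow> \<alpha> i0 t = 1)" and t: "t \<noteq> 0" "\<alpha> i t \<noteq> 1"
    and W: "\<And>J. null_off J \<Longrightarrow> i \<notin> J \<Longrightarrow> i = i0 \<or> i0 \<in> J \<Longrightarrow> null_at \<mu> (axis i 1)" and A: "compact_open A"
  shows "\<mu> A = 0"
proof -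
  \<comment> \<open>For \<open>i \<noteq> i0\<close> the character at \<open>i0\<close> is trivial,
    so this \<open>J\<close> contains \<open>i0\<close>; it omits \<open>i\<close> because
    \<open>\<alpha> i t \<noteq> 1\<close>.\<close>
  define J where "J = (if i = i0 then {} else {j. \<forall>t. t \<noteq> 0 \<longrightarrow> \<alpha> j t = 1})"
  have J: "null_off J" "i \<notin> J" "i = i0 \<or> i0 \<in> J"
    using i t null_off_empty null_off_trivial_set by (auto simp: J_def)
  show ?thesis
    by (rule zero_if_nontrivial[OF null_off_insert[OF J W[OF J]] t A])
qed

text \<open>O^n detects both kinds of solutions: the Dirac functional at the origin, and, through
  \<open>mu_unit_cube\<close>, anything living off \<open>y $ i = 0\<close>.\<close>

lemma zero_if_unramified:
  assumes unr: "\<And>j u. u \<noteq> 0 \<Longrightarrow> val u = 0 \<Longrightarrow> \<alpha> j u = 1" and "\<mu> (icube 0) = 0" and A: "compact_open A"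
  shows "\<mu> A = 0"
proof (cases "\<forall>j t. t \<noteq> 0 \<longrightarrow> \<alpha> j t = 1")
  case True
  then show ?thesis
    using zero_if_all_trivial assms(2,3) by blast
next
  case False
  then obtain i t where "i = i0 \<or> (\<forall>t. t \<noteq> 0 \<longrightarrow> \<alpha> i0 t = 1)" "t \<noteq> 0" "\<alpha> i t \<noteq> 1"
    by metis
  then show ?thesis
    using null_at_axis_unramified[OF _ _ _ unr] assms(2) by (intro zero_if_null_at_axis[OF _ _ _ _ A]) auto
qed

text \<open>The set \<open>?W\<close> of integral vectors whose coordinate \<open>i0\<close> is 1
  modulo \<open>ideal_pow k0\<close> is preserved by dilating the other coordinate \<open>j\<close>
  by the unit \<open>u\<close>. Since \<open>\<alpha> j u \<noteq> 1\<close>, its measure is 0, and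
  it can serve as the \<open>W\<close> of \<open>null_at_axis\<close> at \<open>i0\<close>.\<close>

lemma zero_if_ramified:
  assumes j: "j \<noteq> i0" "u \<noteq> 0" "val u = 0" "\<alpha> j u \<noteq> 1" and t: "t \<noteq> 0" "\<alpha> i0 t \<noteq> 1" and A: "compact_open A"
  shows "\<mu> A = 0"
proof (rule zero_if_null_at_axis[OF _ t _ A])
  let ?k = "(\<lambda>_. 0)(i0 := k0)"
  let ?W = "cell (axis i0 1) (ibox ?k)"
  have p_iff: "p \<in> ?W \<longleftrightarrow> p \<in> icube 0 \<and> p $ i0 - 1 \<in> ideal_pow k0" for p
  proof -
    have "p $ i0 - 1 \<in> ideal_pow k0 \<Longrightarrow> p $ i0 \<in> ideal_pow 0"
      using ideal_pow_add[of "p $ i0 - 1" 0 1] ideal_pow_mono[of 0 k0 "p $ i0 - 1"] k0 by simp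
    then show ?thesis
      by (auto simp: cell_def ibox_def axis_def split: if_splits)
  qed
  have "dilate j u ` ?W = ?W"
  proof -
    have "dilate j u (axis i0 1) = axis i0 1"
      using j(1) by (simp add: vec_eq_iff axis_def)
    moreover have "dilate j u ` ibox ?k = ibox ?k"
      using j(1-3) by (simp add: dilate_box fun_upd_idem)
    ultimately show ?thesis
      by (simp add: dilate_cell[OF j(2)])
  qed
  then have "\<mu> ?W * (1 - \<alpha> j u) = 0"
    using mu_dilate[OF j(2) co_cell_box, of j "axis i0 1" ?k] by (simp add: algebra_simps)
  then have W0: "\<mu> ?W = 0"
    using j(4) by simp
  show "null_at \<mu> (axis i0 1)" if J: "null_off J" "i0 \<notin> J" "i0 = i0 \<or> i0 \<in> J" for J
  proof (rule null_at_axis[OF J co_cell_box cell_self[OF subgroup_box] _ W0])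
    fix p :: "'f ^ 'n"
    assume p: "p \<in> ?W"
    have "icube k0 \<subseteq> (ibox ?k :: ('f ^ 'n) set)"
      by (rule box_mono) (use k0 in auto)
    then have "cell p (icube k0) \<subseteq> cell p (ibox ?k)"
      unfolding cell_def by blast
    also have "\<dots> = ?W"
      by (rule cell_eq[OF subgroup_box p])
    finally show "cell p (icube k0) \<subseteq> ?W" .
    have "p $ i0 - 1 \<in> ideal_pow k0" "p \<in> icube 0"
      using p p_iff by auto
    then show "p \<in> icube 0 \<and> p $ i0 \<noteq> 0 \<and> val (p $ i0) = 0 \<and> \<alpha> i0 (p $ i0) = 1"
      using smooth val_unit ideal_pow_mono[OF k0] by blast
  qed
qed simp

lemma zero_if_axis_cell_zero:
  assumes i: "i = i0 \<or> (\<forall>t. t \<noteq> 0 \<longrightarrow> \<alpha> i0 t = 1)" and t: "t \<noteq> 0" "\<alpha> i t \<noteq> 1"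
    and zero: "\<mu> (cell (axis i 1) (icube k0)) = 0" and A: "compact_open A"
  shows "\<mu> A = 0"
proof (rule zero_if_null_at_axis[OF i t _ A])
  fix J assume J: "null_off J" "i \<notin> J" "i = i0 \<or> i0 \<in> J"
  show "null_at \<mu> (axis i 1)"
  proof (rule null_at_axis[OF J vec_ultra.co_cell_L cell_self[OF subgroup_box] _ zero])
    fix p :: "'f ^ 'n"
    assume p: "p \<in> cell (axis i 1) (icube k0)"
    show "cell p (icube k0) \<subseteq> cell (axis i 1) (icube k0)"
      using cell_eq[OF subgroup_box p] by simp
    show "p \<in> icube 0 \<and> p $ i \<noteq> 0 \<and> val (p $ i) = 0 \<and> \<alpha> i (p $ i) = 1"
      using near_axis[OF p] by simp
  qed
qed

end

text \<open>The test set is O^n if all characters are trivial, and otherwise the cell of depth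
  \<open>k0\<close> around the axis vector of a nontrivial one, with \<open>i0\<close> preferred.
  Both are read off from \<open>\<alpha>\<close>, \<open>i0\<close> and \<open>k0\<close> alone,
  before \<open>\<mu>\<close> is given.\<close>

lemma borel_dist_determined:
  fixes \<alpha> :: "'n::finite \<Rightarrow> 'f::nonarch_local_field \<Rightarrow> complex"
  shows "\<exists>A0. compact_open A0 \<and> (\<forall>\<mu>. borel_dist \<mu> \<alpha> i0 k0 \<longrightarrow> \<mu> A0 = 0 \<longrightarrow> (\<forall>A. compact_open A \<longrightarrow> \<mu> A = 0))"
proof (cases "\<forall>j t. t \<noteq> 0 \<longrightarrow> \<alpha> j t = 1")
  case True
  then show ?thesis
    using borel_dist.zero_if_all_trivial[of _ \<alpha> i0 k0] co_box by blast
next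
  case False
  then obtain i t where "i = i0 \<or> (\<forall>t. t \<noteq> 0 \<longrightarrow> \<alpha> i0 t = 1)" "t \<noteq> 0" "\<alpha> i t \<noteq> 1"
    by metis
  then show ?thesis
    using borel_dist.zero_if_axis_cell_zero[of _ \<alpha> i0 k0 i t] vec_ultra.co_cell_L[of "axis i 1" k0] by blast
qed

section \<open>Boxes and their index\<close>

interpretation fld_ultra: ultra_group "ideal_pow :: int \<Rightarrow> 'f::nonarch_local_field set"
proof
  fix k l :: int and x :: 'f and U :: "'f set"
  show "is_subgroup (ideal_pow k :: 'f set)"
    by (auto simp: is_subgroup_def intro: ideal_pow_diff)
  show "k \<le> l \<Longrightarrow> ideal_pow l \<subseteq> (ideal_pow k :: 'f set)"
    by (auto intro: ideal_pow_mono)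
  show "\<exists>k. x \<in> ideal_pow k"
    by (rule ex_ideal_pow)
  show "compact (ideal_pow k :: 'f set)"
    by (rule compact_ideal_pow)
  show "open U \<longleftrightarrow> (\<forall>p\<in>U. \<exists>k. cell p (ideal_pow k) \<subseteq> U)"
    unfolding open_ideal_pow_iff by (auto simp: cell_def subset_iff)
qed

text \<open>\<open>R\<close> represents the residue field, the integers modulo the maximal
  ideal.\<close>

definition is_transversal :: "'f::nonarch_local_field set \<Rightarrow> bool" where
  "is_transversal R \<longleftrightarrow> finite R \<and> R \<subseteq> ideal_pow 0 \<and> (\<forall>x\<in>ideal_pow 0. \<exists>!r. r \<in> R \<and> x - r \<in> ideal_pow 1)"

lemma ex_transversal: "\<exists>R::'f::nonarch_local_field set. is_transversal R"
proof -
  let ?c = "\<lambda>p::'f. cell p (ideal_pow 1)"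
  let ?P = "?c ` ideal_pow 0"
  \<comment> \<open>\<open>coset_sum\<close> is applied to the zero function, for its finiteness
    claim.\<close>
  have fin: "finite ?P"
  proof (rule fld_ultra.coset_sum(1)[of "\<lambda>_. 0"])
    fix p :: 'f assume "p \<in> ideal_pow 0"
    then have "ideal_pow 0 = cell p (ideal_pow 0)"
      using cell_eq[OF fld_ultra.subgroup_L, of p 0 0] by (simp add: cell_def)
    then show "cell p (ideal_pow 1) \<subseteq> ideal_pow 0"
      using fld_ultra.mono_L[of 0 1] by (auto simp: cell_def)
  qed (simp_all add: fin_additive_def fld_ultra.co_L fld_ultra.subgroup_L fld_ultra.co_cell_L)
  define h where "h C = (SOME x. x \<in> C \<and> x \<in> ideal_pow 0)" for C :: "'f set"
  have h: "h (?c x) \<in> ?c x" "h (?c x) \<in> ideal_pow 0" if "x \<in> ideal_pow 0" for x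
    using someI[of "\<lambda>z. z \<in> ?c x \<and> z \<in> ideal_pow 0" x] cell_self[OF fld_ultra.subgroup_L] that
    unfolding h_def by blast+
  have ex1: "\<exists>!r. r \<in> h ` ?P \<and> x - r \<in> ideal_pow 1" if x: "x \<in> ideal_pow 0" for x
  proof (rule ex1I[of _ "h (?c x)"])
    show "h (?c x) \<in> h ` ?P \<and> x - h (?c x) \<in> ideal_pow 1"
      using h(1)[OF x] x ideal_pow_commute by (auto simp: cell_def)
    fix r assume r: "r \<in> h ` ?P \<and> x - r \<in> ideal_pow 1"
    then obtain z where z: "z \<in> ideal_pow 0" "r = h (?c z)"
      by blast
    have "?c r = ?c z"
      by (rule cell_eq[OF fld_ultra.subgroup_L]) (simp add: z h)
    moreover have "?c x = ?c r"
      by (rule cell_eq[OF fld_ultra.subgroup_L]) (use r in \<open>simp add: cell_def\<close>)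
    ultimately show "r = h (?c x)"
      using z by simp
  qed
  have "is_transversal (h ` ?P)"
    unfolding is_transversal_def
  proof (intro conjI ballI)
    show "finite (h ` ?P)"
      by (rule finite_imageI[OF fin])
    show "h ` ?P \<subseteq> ideal_pow 0"
      using h(2) by auto
  qed (rule ex1)
  then show ?thesis ..
qed

lemma transversal_box:
  fixes k :: "'n::finite \<Rightarrow> int" and R :: "'f::nonarch_local_field set" and p :: "'f ^ 'n" and i :: 'n
  assumes R: "is_transversal R"
  defines "X \<equiv> \<lambda>r. cell (p + axis i (unif powi k i * r)) (ibox (k(i := k i + 1)))"
  shows "cell p (ibox k) = (\<Union>r\<in>R. X r)"
    and "r \<in> R \<Longrightarrow> s \<in> R \<Longrightarrow> r \<noteq> s \<Longrightarrow> X r \<inter> X s = {}"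
proof -
  define t :: 'f where "t = unif powi k i"
  have t: "t \<noteq> 0" "val t = k i"
    by (simp_all add: t_def)
  have dilate: "z - t * r \<in> ideal_pow (k i + 1) \<longleftrightarrow> z / t - r \<in> ideal_pow 1" for z r
  proof -
    have "z - t * r = t * (z / t - r)"
      using t(1) by (simp add: field_simps)
    then show ?thesis
      using ideal_pow_scale[OF t(1), of "z / t - r" "k i + 1"] t(2) by simp
  qed
  have X_iff: "y \<in> X r \<longleftrightarrow> (\<forall>a. a \<noteq> i \<longrightarrow> y $ a - p $ a \<in> ideal_pow (k a)) \<and> (y $ i - p $ i) / t - r \<in> ideal_pow 1" for y r
  proof -
    have "y \<in> X r \<longleftrightarrow> (\<forall>a. a \<noteq> i \<longrightarrow> y $ a - p $ a \<in> ideal_pow (k a)) \<and> (y $ i - p $ i) - t * r \<in> ideal_pow (k i + 1)"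
      unfolding X_def cell_def ibox_def t_def
      by (auto simp: axis_def algebra_simps split: if_splits)
    then show ?thesis
      by (simp only: dilate)
  qed
  have B_iff: "y \<in> cell p (ibox k) \<longleftrightarrow> (\<forall>a. a \<noteq> i \<longrightarrow> y $ a - p $ a \<in> ideal_pow (k a)) \<and> (y $ i - p $ i) / t \<in> ideal_pow 0" for y
  proof -
    have "y $ i - p $ i \<in> ideal_pow (k i) \<longleftrightarrow> (y $ i - p $ i) / t \<in> ideal_pow 0"
      using ideal_pow_scale[OF t(1), of "(y $ i - p $ i) / t" "k i"] t by simp
    then show ?thesis
      unfolding cell_def ibox_def by auto
  qed
  show "cell p (ibox k) = (\<Union>r\<in>R. X r)"
  proof (intro equalityI subsetI)
    fix y assume y: "y \<in> cell p (ibox k)"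
    then have "(y $ i - p $ i) / t \<in> ideal_pow 0"
      by (simp add: B_iff)
    then obtain r where r: "r \<in> R" "(y $ i - p $ i) / t - r \<in> ideal_pow 1"
      using R unfolding is_transversal_def by blast
    then have "y \<in> X r"
      using y by (simp add: B_iff X_iff)
    then show "y \<in> (\<Union>r\<in>R. X r)"
      using r(1) by blast
  next
    fix y assume "y \<in> (\<Union>r\<in>R. X r)"
    then obtain r where r: "r \<in> R" "y \<in> X r"
      by blast
    have "((y $ i - p $ i) / t - r) + r \<in> ideal_pow 0"
    proof (rule ideal_pow_add)
      have "(y $ i - p $ i) / t - r \<in> ideal_pow 1"
        using r(2) by (simp only: X_iff)
      then show "(y $ i - p $ i) / t - r \<in> ideal_pow 0"
        by (rule ideal_pow_mono[rotated]) simp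
      show "r \<in> ideal_pow 0"
        using R r(1) by (auto simp: is_transversal_def)
    qed
    then show "y \<in> cell p (ibox k)"
      using r(2) B_iff X_iff by simp
  qed
  show "X r \<inter> X s = {}" if rs: "r \<in> R" "s \<in> R" "r \<noteq> s"
  proof (rule ccontr)
    assume "X r \<inter> X s \<noteq> {}"
    then obtain y where "y \<in> X r" "y \<in> X s"
      by blast
    then have "(y $ i - p $ i) / t - r \<in> ideal_pow 1" "(y $ i - p $ i) / t - s \<in> ideal_pow 1"
      using X_iff by auto
    then have "r - s \<in> ideal_pow 1"
      using ideal_pow_diff[of "(y $ i - p $ i) / t - s" 1 "(y $ i - p $ i) / t - r"] by simp
    moreover have "\<exists>!a. a \<in> R \<and> r - a \<in> ideal_pow 1"
      using R rs(1) unfolding is_transversal_def by blast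
    ultimately show False
      using rs by (metis diff_self ideal_pow_0)
  qed
qed

text \<open>The residue cardinality q as a complex number; all transversals have the same
  size.\<close>

definition res_card :: "'f::nonarch_local_field itself \<Rightarrow> complex" where
  "res_card _ = of_nat (card (SOME R::'f set. is_transversal R))"

lemma res_card_nz [simp]: "res_card TYPE('f::nonarch_local_field) \<noteq> 0"
proof -
  define R where "R = (SOME R::'f set. is_transversal R)"
  have "is_transversal R"
    unfolding R_def by (rule someI_ex[OF ex_transversal])
  then have "finite R" "R \<noteq> {}"
    unfolding is_transversal_def using ideal_pow_0[of 0] by blast+
  then show ?thesis
    by (simp add: res_card_def R_def[symmetric])
qed

text \<open>Splitting along coordinate \<open>i\<close> yields one translate for each of the q
  residue classes, all of the same measure by \<open>eq\<close>.\<close>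

lemma box_refine:
  fixes m :: "('f::nonarch_local_field ^ 'n) set \<Rightarrow> complex"
  assumes m: "fin_additive m"
    and eq: "\<And>w. w \<in> ideal_pow (k i) \<Longrightarrow>
      m (cell (p + axis i w) (ibox (k(i := k i + 1)))) = m (cell p (ibox (k(i := k i + 1))))"
  shows "m (cell p (ibox k)) = res_card TYPE('f) * m (cell p (ibox (k(i := k i + 1))))"
proof -
  define R where "R = (SOME R::'f set. is_transversal R)"
  have R: "is_transversal R"
    unfolding R_def by (rule someI_ex[OF ex_transversal])
  let ?X = "\<lambda>r. cell (p + axis i (unif powi k i * r)) (ibox (k(i := k i + 1)))"
  have "m (cell p (ibox k)) = m (\<Union>r\<in>R. ?X r)"
    using transversal_box(1)[OF R, of p k i] by simp
  also have "\<dots> = (\<Sum>r\<in>R. m (?X r))"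
  proof (rule fin_additive_UN[OF m])
    show "finite R"
      using R by (simp add: is_transversal_def)
    show "?X r \<inter> ?X s = {}" if "r \<in> R" "s \<in> R" "r \<noteq> s" for r s
      by (rule transversal_box(2)[OF R that])
  qed (rule co_cell_box)
  also have "\<dots> = (\<Sum>r\<in>R. m (cell p (ibox (k(i := k i + 1)))))"
  proof (rule sum.cong[OF refl])
    fix r assume "r \<in> R"
    then have "r \<in> ideal_pow 0"
      using R by (auto simp: is_transversal_def)
    then have "unif powi k i * r \<in> ideal_pow (k i)"
      by (simp add: ideal_pow_scale)
    then show "m (?X r) = m (cell p (ibox (k(i := k i + 1))))"
      by (rule eq)
  qed
  finally show ?thesis
    by (simp add: res_card_def R_def)
qed

section \<open>Maps acting on both components\<close>

lemma map_prod_Times: "map_prod f g ` (A \<times> B) = (f ` A) \<times> (g ` B)"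
  by force

lemma cts_map_prod: "vec_ultra.cts_hom f \<Longrightarrow> vec_ultra.cts_hom g \<Longrightarrow> pair_ultra.cts_hom (map_prod f g)"
  for f g :: "'f::nonarch_local_field ^ 'n \<Rightarrow> 'f ^ 'n"
proof -
  assume f: "vec_ultra.cts_hom f" and g: "vec_ultra.cts_hom g"
  have "\<exists>l. map_prod f g ` (icube l \<times> icube l) \<subseteq> icube k \<times> icube k" for k
  proof -
    obtain a b where ab: "f ` icube a \<subseteq> icube k" "g ` icube b \<subseteq> icube k"
      using f g unfolding vec_ultra.cts_hom_def by meson
    have "icube (max a b) \<subseteq> (icube a :: ('f ^ 'n) set)" "icube (max a b) \<subseteq> (icube b :: ('f ^ 'n) set)"
      by (simp_all add: box_mono)
    then have "f ` icube (max a b) \<subseteq> icube k" "g ` icube (max a b) \<subseteq> icube k"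
      using ab by (meson image_mono order_trans)+
    then have "map_prod f g ` (icube (max a b) \<times> icube (max a b)) \<subseteq> icube k \<times> icube k"
      unfolding map_prod_Times by (intro Sigma_mono)
    then show ?thesis ..
  qed
  then show ?thesis
    using f g unfolding pair_ultra.cts_hom_def vec_ultra.cts_hom_def by (auto simp: map_prod_def)
qed

lemma co_map_prod:
  fixes f g f' g' :: "'f::nonarch_local_field ^ 'n \<Rightarrow> 'f ^ 'n"
  assumes "vec_ultra.cts_hom f" "vec_ultra.cts_hom g" "vec_ultra.cts_hom f'" "vec_ultra.cts_hom g'"
    and "\<And>x. f (f' x) = x" "\<And>x. f' (f x) = x" "\<And>x. g (g' x) = x" "\<And>x. g' (g x) = x" and "compact_open A"
  shows "compact_open (map_prod f g ` A)"
  by (rule pair_ultra.co_image[of _ "map_prod f' g'"])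
    (use assms in \<open>auto simp: cts_map_prod prod.map_comp\<close>)

lemma cts_id: "vec_ultra.cts_hom (id :: 'f::nonarch_local_field ^ 'n \<Rightarrow> 'f ^ 'n)"
  by (auto simp: vec_ultra.cts_hom_def)

lemma co_pair_smult: "t \<noteq> 0 \<Longrightarrow> compact_open A \<Longrightarrow> compact_open (map_prod ((*s) t) id ` A)"
  for A :: "(('f::nonarch_local_field ^ 'n) \<times> ('f ^ 'n)) set"
  by (rule co_map_prod[of _ _ "(*s) (inverse t)" id]) (simp_all add: cts_smult cts_id)

lemma co_pair_dilate: "t \<noteq> 0 \<Longrightarrow> compact_open A \<Longrightarrow> compact_open (map_prod (dilate i (inverse t)) (dilate i t) ` A)"
  for A :: "(('f::nonarch_local_field ^ 'n) \<times> ('f ^ 'n)) set"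
  by (rule co_map_prod[of _ _ "dilate i t" "dilate i (inverse t)"]) (simp_all add: cts_dilate)

lemma co_pair_shear: "i \<noteq> j \<Longrightarrow> compact_open A \<Longrightarrow> compact_open (map_prod (shear j i (- w)) (shear i j w) ` A)"
  for A :: "(('f::nonarch_local_field ^ 'n) \<times> ('f ^ 'n)) set"
  by (rule co_map_prod[of _ _ "shear j i w" "shear i j (- w)"])
    (simp_all add: cts_shear shear_inverse(2)[of j i "- w", simplified] shear_inverse(1)[of j i "- w", simplified])

text \<open>On \<open>icube b\<close> such a shear moves points by elements of
  \<open>icube l\<close> only, hence inside the cells that make up \<open>B\<close>.\<close>

lemma shear_stable:
  fixes B :: "('f::nonarch_local_field ^ 'n) set"
  assumes ij: "i \<noteq> j" and B: "B \<subseteq> icube b" "\<And>p. p \<in> B \<Longrightarrow> cell p (icube l) \<subseteq> B" and v: "v \<in> ideal_pow (l - b)"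
  shows "shear i j v ` B = B"
proof -
  have sub: "shear i j w y \<in> B" if w: "w \<in> ideal_pow (l - b)" and y: "y \<in> B" for w y
  proof -
    have "w * y $ i \<in> ideal_pow (l - b + b)"
      using w B(1) y by (intro ideal_pow_mult) (auto simp: ibox_def)
    then have "shear i j w y \<in> cell y (icube l)"
      by (simp add: cell_def ibox_def)
    then show ?thesis
      using B(2) y by blast
  qed
  show ?thesis
  proof (intro equalityI subsetI)
    fix y assume "y \<in> B"
    then have "shear i j v (shear i j (- v) y) \<in> shear i j v ` B"
      using sub[of "- v" y] v by (intro imageI) simp
    then show "y \<in> shear i j v ` B"
      using ij by simp
  qed (use sub v in auto)
qed

text \<open>Descent to the constant multi-index: lower any coordinate exceeding \<open>K\<close>;
  the total excess over \<open>K\<close> decreases.\<close>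

lemma shift_invariant_const:
  fixes f :: "('n::finite \<Rightarrow> int) \<Rightarrow> 'a"
  assumes step: "\<And>k i. (\<And>a. K \<le> k a) \<Longrightarrow> f (k(i := k i + 1)) = f k" and k: "\<And>a. K \<le> k a"
  shows "f k = f (\<lambda>_. K)"
  using k
proof (induction "nat (\<Sum>a\<in>UNIV. k a - K)" arbitrary: k rule: less_induct)
  case less
  show ?case
  proof (cases "\<forall>a. k a = K")
    case True
    then have "k = (\<lambda>_. K)"
      by auto
    then show ?thesis
      by simp
  next
    case False
    then obtain i where i: "k i > K"
      using less.prems by (metis order_le_less)
    let ?k = "k(i := k i - 1)"
    have k': "K \<le> ?k a" for a
      using i less.prems[of a] by auto
    have "(\<Sum>a\<in>UNIV. ?k a - K) < (\<Sum>a\<in>UNIV. k a - K)"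
      by (rule sum_strict_mono_ex1) auto
    moreover have "0 \<le> (\<Sum>a\<in>UNIV. ?k a - K)"
      by (rule sum_nonneg) (use k' in auto)
    ultimately have "f ?k = f (\<lambda>_. K)"
      using k' by (intro less.hyps) auto
    moreover have "f (?k(i := ?k i + 1)) = f ?k"
      by (rule step[OF k'])
    ultimately show ?thesis
      by simp
  qed
qed

section \<open>The fibre over a basis vector\<close>

locale pair_dist =
  fixes m :: "(('f::nonarch_local_field ^ 'n::finite) \<times> ('f ^ 'n)) set \<Rightarrow> complex"
    and \<chi>1 \<chi>2 :: "'f \<Rightarrow> complex" and i0 :: 'n and k0 :: int
  assumes additive: "fin_additive m"
    and m_smult: "t \<noteq> 0 \<Longrightarrow> compact_open A \<Longrightarrow> m (map_prod ((*s) t) id ` A) = \<chi>1 t * m A"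
    and m_dilate: "t \<noteq> 0 \<Longrightarrow> compact_open A \<Longrightarrow> m (map_prod (dilate i (inverse t)) (dilate i t) ` A) = \<chi>2 t * m A"
    and m_shear: "i \<noteq> j \<Longrightarrow> compact_open A \<Longrightarrow> m (map_prod (shear j i (- w)) (shear i j w) ` A) = m A"
    and smooth1: "t - 1 \<in> ideal_pow k0 \<Longrightarrow> \<chi>1 t = 1"
    and smooth2: "t - 1 \<in> ideal_pow k0 \<Longrightarrow> \<chi>2 t = 1"
    and k0: "1 \<le> k0"
begin

abbreviation e0 :: "'f ^ 'n" where
  "e0 \<equiv> axis i0 1"

lemma near_one: "t - 1 \<in> ideal_pow k0 \<Longrightarrow> t \<noteq> 0 \<and> val t = 0" for t :: 'f
  by (rule val_unit, rule ideal_pow_mono[OF k0])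

lemma m_smult_cell:
  assumes "t \<noteq> 0" "compact_open B"
  shows "m (cell (t *s p) (ibox (\<lambda>a. k a + val t)) \<times> B) = \<chi>1 t * m (cell p (ibox k) \<times> B)"
  using m_smult[OF assms(1) co_Times[OF co_cell_box assms(2)], of p k]
  by (simp add: map_prod_Times smult_cell smult_box assms(1))

lemma m_shear_cell:
  assumes "i \<noteq> j" "compact_open B" "w \<in> ideal_pow (k i - k j)"
  shows "m (cell (shear j i w p) (ibox k) \<times> shear i j (- w) ` B) = m (cell p (ibox k) \<times> B)"
  using m_shear[OF assms(1) co_Times[OF co_cell_box assms(2)], of "- w" p k] assms
  by (simp add: map_prod_Times shear_cell shear_box)

lemma section_additive:
  assumes B: "compact_open B"
  shows "fin_additive (\<lambda>X. m (X \<times> B))"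
  unfolding fin_additive_def
proof (intro allI impI)
  fix X Y :: "('f ^ 'n) set" assume XY: "compact_open X" "compact_open Y" "X \<inter> Y = {}"
  then have "(X \<times> B) \<inter> (Y \<times> B) = {}"
    by blast
  then have "m ((X \<times> B) \<union> (Y \<times> B)) = m (X \<times> B) + m (Y \<times> B)"
    using additive co_Times[OF XY(1) B] co_Times[OF XY(2) B] unfolding fin_additive_def by blast
  then show "m ((X \<union> Y) \<times> B) = m (X \<times> B) + m (Y \<times> B)"
    by (simp add: Sigma_Un_distrib1)
qed

text \<open>The centre \<open>e0 + axis i w\<close> is an image of \<open>e0\<close> under an
  element that keeps the box and \<open>B\<close>: for \<open>i = i0\<close> the scalar
  \<open>1 + w\<close>, on which \<chi>1 is 1; otherwise a shear whose effect on the second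
  component is too small to change \<open>B\<close>.\<close>

lemma index_step:
  assumes B: "compact_open B" "B \<subseteq> icube b" "\<And>p. p \<in> B \<Longrightarrow> cell p (icube l) \<subseteq> B"
    and K: "k0 \<le> K" "l - b \<le> K" and k: "\<And>a. K \<le> k a"
  shows "m (cell e0 (ibox k) \<times> B) = res_card TYPE('f) * m (cell e0 (ibox (k(i := k i + 1))) \<times> B)"
proof (rule box_refine[where m = "\<lambda>X. m (X \<times> B)"])
  let ?k = "k(i := k i + 1)"
  show "fin_additive (\<lambda>X. m (X \<times> B))"
    by (rule section_additive[OF B(1)])
  fix w :: 'f assume w: "w \<in> ideal_pow (k i)"
  show "m (cell (e0 + axis i w) (ibox ?k) \<times> B) = m (cell e0 (ibox ?k) \<times> B)"
  proof (cases "i = i0")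
    case True
    have "(1 + w) - 1 \<in> ideal_pow k0"
      using ideal_pow_mono[OF order_trans[OF K(1) k[of i]] w] by simp
    then have t: "1 + w \<noteq> 0" "val (1 + w) = 0" "\<chi>1 (1 + w) = 1"
      using near_one smooth1 by blast+
    have "(1 + w) *s e0 = e0 + axis i w"
      using True by (simp add: vec_eq_iff axis_def)
    moreover have "m (cell ((1 + w) *s e0) (ibox (\<lambda>a. ?k a + val (1 + w))) \<times> B) = \<chi>1 (1 + w) * m (cell e0 (ibox ?k) \<times> B)"
      by (rule m_smult_cell[OF t(1) B(1)])
    ultimately show ?thesis
      by (simp only: t(2,3) add_0_right mult_1_left)
  next
    case False
    \<comment> \<open>The refined box has exponent \<open>k i + 1\<close> at \<open>i\<close>, so
      the shear keeps it only if \<open>k i0 \<ge> 1\<close>; this is where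
      \<open>1 \<le> k0\<close> enters.\<close>
    have "w \<in> ideal_pow (?k i - ?k i0)"
      using False k[of i0] K(1) k0 by (intro ideal_pow_mono[OF _ w]) simp
    then have "m (cell (shear i0 i w e0) (ibox ?k) \<times> shear i i0 (- w) ` B) = m (cell e0 (ibox ?k) \<times> B)"
      by (rule m_shear_cell[OF False B(1)])
    moreover have "shear i0 i w e0 = e0 + axis i w"
      using False by (simp add: vec_eq_iff axis_def)
    moreover have "shear i i0 (- w) ` B = B"
    proof (rule shear_stable[OF False B(2)])
      show "cell p (icube l) \<subseteq> B" if "p \<in> B" for p
        by (rule B(3)[OF that])
      show "- w \<in> ideal_pow (l - b)"
        unfolding ideal_pow_minus by (rule ideal_pow_mono[OF order_trans[OF K(2) k[of i]] w])
    qed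
    ultimately show ?thesis
      by simp
  qed
qed

text \<open>
  The power of the residue cardinality compensates the volume of the ibox around \<open>e0\<close>, so that
  \<open>dens k B\<close> no longer depends on \<open>k\<close> once all \<open>k a\<close> are large; \<open>eta B\<close> is that stable value.
\<close>

definition dens :: "('n \<Rightarrow> int) \<Rightarrow> ('f ^ 'n) set \<Rightarrow> complex" where
  "dens k B = res_card TYPE('f) powi (\<Sum>a\<in>UNIV. k a) * m (cell e0 (ibox k) \<times> B)"

lemma dens_const:
  assumes B: "compact_open B" "B \<subseteq> icube b" "\<And>p. p \<in> B \<Longrightarrow> cell p (icube l) \<subseteq> B"
    and K: "k0 \<le> K" "l - b \<le> K" and k: "\<And>a. K \<le> k a"
  shows "dens k B = dens (\<lambda>_. K) B"
proof (rule shift_invariant_const[where f = "\<lambda>k. dens k B", OF _ k])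
  fix k :: "'n \<Rightarrow> int" and i :: 'n
  assume k: "\<And>a. K \<le> k a"
  have "(\<Sum>a\<in>UNIV. (k(i := k i + 1)) a) = (\<Sum>a\<in>UNIV. k a + (if a = i then 1 else 0))"
    by (rule sum.cong) auto
  also have "\<dots> = (\<Sum>a\<in>UNIV. k a) + 1"
    by (simp add: sum.distrib)
  finally have sum: "(\<Sum>a\<in>UNIV. (k(i := k i + 1)) a) = (\<Sum>a\<in>UNIV. k a) + 1" .
  have "m (cell e0 (ibox k) \<times> B) = res_card TYPE('f) * m (cell e0 (ibox (k(i := k i + 1))) \<times> B)"
    by (rule index_step[OF B K k])
  then show "dens (k(i := k i + 1)) B = dens k B"
    unfolding dens_def sum by (simp add: power_int_add)
qed

text \<open>Stability is required for all boxes with large exponents, not only for cubes, because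
  dilations turn cubes into boxes with unequal exponents.\<close>

definition is_dens :: "('f ^ 'n) set \<Rightarrow> complex \<Rightarrow> bool" where
  "is_dens B z \<longleftrightarrow> (\<exists>K. \<forall>k. (\<forall>a. K \<le> k a) \<longrightarrow> dens k B = z)"

lemma is_densI:
  assumes B: "compact_open B" "B \<subseteq> icube b" "\<And>p. p \<in> B \<Longrightarrow> cell p (icube l) \<subseteq> B" and K: "k0 \<le> K" "l - b \<le> K"
  shows "is_dens B (dens (\<lambda>_. K) B)"
  unfolding is_dens_def using dens_const[OF B K] by blast

lemma is_dens_unique: "is_dens B z \<Longrightarrow> is_dens B z' \<Longrightarrow> z = z'"
  unfolding is_dens_def
proof (elim exE)
  fix K K'
  assume "\<forall>k. (\<forall>a. K \<le> k a) \<longrightarrow> dens k B = z" "\<forall>k. (\<forall>a. K' \<le> k a) \<longrightarrow> dens k B = z'"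
  from this[THEN spec[of _ "\<lambda>_. max K K'"]] have "dens (\<lambda>_. max K K') B = z" "dens (\<lambda>_. max K K') B = z'"
    by simp_all
  then show "z = z'"
    by simp
qed

definition eta :: "('f ^ 'n) set \<Rightarrow> complex" where
  "eta B = (THE z. is_dens B z)"

lemma eta_eqI: "is_dens B z \<Longrightarrow> eta B = z"
  unfolding eta_def using is_dens_unique by blast

lemma co_data:
  fixes B :: "('f ^ 'n) set"
  assumes "compact_open B"
  obtains b l :: int where "B \<subseteq> icube b" "\<And>p. p \<in> B \<Longrightarrow> cell p (icube l) \<subseteq> B"
  using vec_ultra.co_bounded[OF assms] vec_ultra.co_uniform[OF assms] by blast

lemma is_dens_eta: "compact_open B \<Longrightarrow> is_dens B (eta B)"
proof -
  assume B: "compact_open B"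
  then obtain b l where bl: "B \<subseteq> icube b" "\<And>p. p \<in> B \<Longrightarrow> cell p (icube l) \<subseteq> B"
    using co_data by blast
  have "is_dens B (dens (\<lambda>_. max k0 (l - b)) B)"
    by (rule is_densI[OF B bl]) auto
  then show ?thesis
    using eta_eqI by simp
qed

text \<open>As densities are eventually constant, a single pair of sufficiently small boxes related
  by a group element compares \<open>eta B\<close> with \<open>eta B'\<close>. The change
  \<open>d\<close> of total exponent becomes a power of q.\<close>

lemma eta_transport:
  assumes B: "compact_open B" "compact_open B'"
    and ex: "\<And>K. \<exists>k k'. (\<forall>a. K \<le> k a) \<and> (\<forall>a. K \<le> k' a) \<and>
      m (cell e0 (ibox k') \<times> B') = c * m (cell e0 (ibox k) \<times> B) \<and> (\<Sum>a\<in>UNIV. k' a) = (\<Sum>a\<in>UNIV. k a) + d"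
  shows "eta B' = c * res_card TYPE('f) powi d * eta B"
proof -
  obtain K K' where K: "\<And>k. (\<forall>a. K \<le> k a) \<Longrightarrow> dens k B = eta B"
      "\<And>k. (\<forall>a. K' \<le> k a) \<Longrightarrow> dens k B' = eta B'"
    using is_dens_eta[OF B(1)] is_dens_eta[OF B(2)] unfolding is_dens_def by blast
  obtain k k' where k: "\<forall>a. max K K' \<le> k a" "\<forall>a. max K K' \<le> k' a"
      "m (cell e0 (ibox k') \<times> B') = c * m (cell e0 (ibox k) \<times> B)" "(\<Sum>a\<in>UNIV. k' a) = (\<Sum>a\<in>UNIV. k a) + d"
    using ex by blast
  have "dens k' B' = c * res_card TYPE('f) powi d * dens k B"
    by (simp add: dens_def k(3,4) power_int_add)
  then show ?thesis
    using K k(1,2) by simp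
qed

text \<open>
  Scaling \<open>y $ i0\<close> alone while fixing \<open>e0\<close> needs a dilation of both vectors combined with a scalar
  multiplication of \<open>x\<close>; the powers of the residue cardinality are the resulting moduli.
\<close>

definition \<alpha> :: "'n \<Rightarrow> 'f \<Rightarrow> complex" where
  "\<alpha> i t = (if i = i0 then \<chi>2 t * \<chi>1 t * res_card TYPE('f) powi (\<Sum>a\<in>UNIV - {i0}. val t) else \<chi>2 t * res_card TYPE('f) powi (- val t))"

lemma eta_additive: "fin_additive eta"
  unfolding fin_additive_def
proof (intro allI impI)
  fix A B :: "('f ^ 'n) set" assume AB: "compact_open A" "compact_open B" "A \<inter> B = {}"
  obtain K K' where K: "\<And>k. (\<forall>a. K \<le> k a) \<Longrightarrow> dens k A = eta A"
      "\<And>k. (\<forall>a. K' \<le> k a) \<Longrightarrow> dens k B = eta B"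
    using is_dens_eta[OF AB(1)] is_dens_eta[OF AB(2)] unfolding is_dens_def by blast
  have "m (X \<times> (A \<union> B)) = m (X \<times> A) + m (X \<times> B)" if "compact_open X" for X :: "('f ^ 'n) set"
  proof -
    have "(X \<times> A) \<inter> (X \<times> B) = {}"
      using AB(3) by blast
    then have "m ((X \<times> A) \<union> (X \<times> B)) = m (X \<times> A) + m (X \<times> B)"
      using additive co_Times[OF that AB(1)] co_Times[OF that AB(2)] unfolding fin_additive_def by blast
    then show ?thesis
      by (simp add: Sigma_Un_distrib2)
  qed
  then have "dens k (A \<union> B) = dens k A + dens k B" for k
    by (simp add: dens_def co_cell_box algebra_simps)
  then have "is_dens (A \<union> B) (eta A + eta B)"
    using K unfolding is_dens_def by (intro exI[of _ "max K K'"]) simp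
  then show "eta (A \<union> B) = eta A + eta B"
    by (rule eta_eqI)
qed

lemma eta_borel: "borel_dist eta \<alpha> i0 k0"
proof
  show "fin_additive eta"
    by (rule eta_additive)
  show "1 \<le> k0"
    by (rule k0)
  show "\<alpha> i t = 1" if "t - 1 \<in> ideal_pow k0" for i t
    using near_one[OF that] smooth1[OF that] smooth2[OF that] by (simp add: \<alpha>_def)
next
  fix i j :: 'n and w :: 'f and B :: "('f ^ 'n) set"
  assume ij: "i \<noteq> j" and j: "j \<noteq> i0" and B: "compact_open B"
  obtain l where l: "- w \<in> ideal_pow l"
    using ex_ideal_pow by blast
  have "eta (shear i j w ` B) = 1 * res_card TYPE('f) powi 0 * eta B"
  proof (rule eta_transport[OF B co_shear[OF ij B]])
    fix K :: int
    \<comment> \<open>The shear with parameter \<open>- w\<close> adds a multiple of coordinate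
      \<open>j\<close> to coordinate \<open>i\<close>. Exponents elsewhere are raised by
      \<open>max 0 (- l)\<close> so that the box absorbs this, however large \<open>w\<close>
      is.\<close>
    let ?k = "\<lambda>a. if a = i then K else K + max 0 (- l)"
    have "- w \<in> ideal_pow (?k i - ?k j)"
      using ij by (intro ideal_pow_mono[OF _ l]) simp
    then have "m (cell (shear j i (- w) e0) (ibox ?k) \<times> shear i j (- (- w)) ` B) = m (cell e0 (ibox ?k) \<times> B)"
      by (rule m_shear_cell[OF ij B])
    moreover have "shear j i (- w) e0 = e0"
      using j by (simp add: vec_eq_iff axis_def)
    ultimately have "m (cell e0 (ibox ?k) \<times> shear i j w ` B) = 1 * m (cell e0 (ibox ?k) \<times> B)"
      by simp
    then show "\<exists>k k'. (\<forall>a. K \<le> k a) \<and> (\<forall>a. K \<le> k' a) \<and>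
        m (cell e0 (ibox k') \<times> shear i j w ` B) = 1 * m (cell e0 (ibox k) \<times> B) \<and>
        (\<Sum>a\<in>UNIV. k' a) = (\<Sum>a\<in>UNIV. k a) + 0"
      by (intro exI[of _ ?k]) auto
  qed
  then show "eta (shear i j w ` B) = eta B"
    by simp
next
  fix i :: 'n and t :: 'f and B :: "('f ^ 'n) set"
  assume t: "t \<noteq> 0" and B: "compact_open B"
  have dilate: "m (cell (dilate i (inverse t) e0) (ibox (k(i := k i - val t))) \<times> dilate i t ` B) = \<chi>2 t * m (cell e0 (ibox k) \<times> B)" for k
    using m_dilate[OF t co_Times[OF co_cell_box B], of i e0 k] t
    by (simp add: map_prod_Times dilate_cell dilate_box val_inverse)
  show "eta (dilate i t ` B) = \<alpha> i t * eta B"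
  proof (cases "i = i0")
    case False
    have "eta (dilate i t ` B) = \<chi>2 t * res_card TYPE('f) powi (- val t) * eta B"
    proof (rule eta_transport[OF B co_dilate[OF t B]])
      fix K :: int
      \<comment> \<open>The padding keeps the exponents above \<open>K\<close> after
        \<open>val t\<close> is subtracted. For \<open>i = i0\<close>, where \<open>val t\<close> is
        added instead, the padding has the opposite sign.\<close>
      let ?k = "\<lambda>a::'n. K + max 0 (val t)"
      have "dilate i (inverse t) e0 = e0"
        using False by (simp add: vec_eq_iff axis_def)
      then have "m (cell e0 (ibox (?k(i := ?k i - val t))) \<times> dilate i t ` B) = \<chi>2 t * m (cell e0 (ibox ?k) \<times> B)"
        using dilate[of ?k] by simp
      moreover have "(\<Sum>a\<in>UNIV. (?k(i := ?k i - val t)) a) = (\<Sum>a\<in>UNIV. ?k a) + - val t"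
      proof -
        have "(\<Sum>a\<in>UNIV. (?k(i := ?k i - val t)) a) = (\<Sum>a\<in>UNIV. ?k a + (if a = i then - val t else 0))"
          by (rule sum.cong) auto
        also have "\<dots> = (\<Sum>a\<in>UNIV. ?k a) + - val t"
          by (subst sum.distrib) simp
        finally show ?thesis .
      qed
      moreover have "\<forall>a. K \<le> ?k a" "\<forall>a. K \<le> (?k(i := ?k i - val t)) a"
        by auto
      ultimately show "\<exists>k k'. (\<forall>a. K \<le> k a) \<and> (\<forall>a. K \<le> k' a) \<and>
        m (cell e0 (ibox k') \<times> dilate i t ` B) = \<chi>2 t * m (cell e0 (ibox k) \<times> B) \<and>
        (\<Sum>a\<in>UNIV. k' a) = (\<Sum>a\<in>UNIV. k a) + - val t"
        by (intro exI[of _ ?k] exI[of _ "?k(i := ?k i - val t)"] conjI)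
    qed
    then show ?thesis
      using False by (simp add: \<alpha>_def)
  next
    case True
    have "eta (dilate i t ` B) = (\<chi>2 t * \<chi>1 t) * res_card TYPE('f) powi (\<Sum>a\<in>UNIV - {i0}. val t) * eta B"
    proof (rule eta_transport[OF B co_dilate[OF t B]])
      fix K :: int
      let ?k = "\<lambda>a::'n. K + max 0 (- val t)"
      let ?k' = "\<lambda>a. ?k a + (if a = i0 then 0 else val t)"
      have e: "t *s dilate i (inverse t) e0 = e0"
        using True t by (simp add: vec_eq_iff axis_def)
      have k': "(\<lambda>a. (?k(i := ?k i - val t)) a + val t) = ?k'"
        using True by auto
      have "m (cell (t *s dilate i (inverse t) e0) (ibox (\<lambda>a. (?k(i := ?k i - val t)) a + val t)) \<times> dilate i t ` B)
          = \<chi>1 t * m (cell (dilate i (inverse t) e0) (ibox (?k(i := ?k i - val t))) \<times> dilate i t ` B)"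
        by (rule m_smult_cell[OF t co_dilate[OF t B]])
      then have "m (cell e0 (ibox ?k') \<times> dilate i t ` B) = \<chi>1 t * m (cell (dilate i (inverse t) e0) (ibox (?k(i := ?k i - val t))) \<times> dilate i t ` B)"
        unfolding e k' .
      also have "\<dots> = \<chi>1 t * (\<chi>2 t * m (cell e0 (ibox ?k) \<times> B))"
        by (simp only: dilate[of ?k])
      finally have "m (cell e0 (ibox ?k') \<times> dilate i t ` B) = \<chi>2 t * \<chi>1 t * m (cell e0 (ibox ?k) \<times> B)"
        by simp
      moreover have "(\<Sum>a\<in>UNIV. ?k' a) = (\<Sum>a\<in>UNIV. ?k a) + (\<Sum>a\<in>UNIV - {i0}. val t)"
      proof -
        have "(\<Sum>a\<in>UNIV. if a = i0 then 0 else val t) = (\<Sum>a\<in>UNIV - {i0}. val t)"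
          by (rule sum.mono_neutral_cong_right) auto
        then show ?thesis
          by (subst sum.distrib) simp
      qed
      moreover have "\<forall>a. K \<le> ?k a" "\<forall>a. K \<le> ?k' a"
        by auto
      ultimately show "\<exists>k k'. (\<forall>a. K \<le> k a) \<and> (\<forall>a. K \<le> k' a) \<and>
        m (cell e0 (ibox k') \<times> dilate i t ` B) = \<chi>2 t * \<chi>1 t * m (cell e0 (ibox k) \<times> B) \<and>
        (\<Sum>a\<in>UNIV. k' a) = (\<Sum>a\<in>UNIV. k a) + (\<Sum>a\<in>UNIV - {i0}. val t)"
        by (intro exI[of _ ?k] exI[of _ ?k'] conjI)
    qed
    then show ?thesis
      using True by (simp add: \<alpha>_def)
  qed
qed

end

section \<open>Uniqueness on pairs of vectors\<close>

lemma primitive_stable: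
  assumes "p \<in> icube 0 - icube 1" "1 \<le> k"
  shows "cell p (icube k) \<subseteq> icube 0 - (icube 1 :: ('f::nonarch_local_field ^ 'n) set)"
proof
  fix y assume "y \<in> cell p (icube k)"
  then have y: "y - p \<in> icube 1"
    using vec_ultra.mono_L[OF assms(2)] by (auto simp: cell_def)
  then have "y - p \<in> icube 0"
    using vec_ultra.mono_L[of 0 1] by auto
  then have "(y - p) + p \<in> icube 0"
    using assms(1) by (intro is_subgroup_add[OF subgroup_box]) auto
  moreover have "y \<notin> icube 1"
  proof
    assume "y \<in> icube 1"
    then have "y - (y - p) \<in> icube 1"
      using y subgroup_box[of "\<lambda>_. 1"] unfolding is_subgroup_def by blast
    then show False
      using assms(1) by simp
  qed
  ultimately show "y \<in> icube 0 - icube 1"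
    by simp
qed

lemma primitive_unit:
  assumes "p \<in> icube 0 - icube 1"
  obtains i where "p $ i \<noteq> 0" "val (p $ i) = 0"
proof -
  have p: "p $ a \<in> ideal_pow 0" for a
    using assms by (simp add: ibox_def)
  obtain i where "p $ i \<notin> ideal_pow 1"
    using assms by (auto simp: ibox_def)
  then have "p $ i \<noteq> 0" "val (p $ i) = 0"
    using p[of i] by (auto simp: ideal_pow_iff)
  then show ?thesis
    by (rule that)
qed

context pair_dist
begin

text \<open>Makes vanishing of \<open>eta B\<close> visible on one explicit cell, whose depth is
  governed by \<open>B\<close> and \<open>k0\<close> and not by \<open>m\<close>.\<close>

lemma eta_eq_0_iff:
  assumes B: "compact_open B" "B \<subseteq> icube b" "\<And>p. p \<in> B \<Longrightarrow> cell p (icube l) \<subseteq> B"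
    and K: "k0 \<le> K" "l - b \<le> K"
  shows "eta B = 0 \<longleftrightarrow> m (cell e0 (icube K) \<times> B) = 0"
proof -
  have "is_dens B (dens (\<lambda>_. K) B)"
    by (rule is_densI[OF B K])
  then have "eta B = dens (\<lambda>_. K) B"
    by (rule eta_eqI)
  then show ?thesis
    by (simp add: dens_def)
qed

text \<open>Clearing the first component drags \<open>y\<close> along. The shears are integral, so
  the depths \<open>k\<close> and \<open>l\<close> are kept and the new \<open>y'\<close> stays in
  the same cube \<open>icube b\<close>; this uniform bound is what \<open>null_at_e0\<close> relies
  on.\<close>

lemma clear_pair:
  assumes "finite S" "i \<notin> S" "c \<in> icube 0" "c $ i = 1" "y \<in> icube b"
  shows "\<exists>y'\<in>icube b. m (cell c (icube k) \<times> cell y (icube l)) =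
    m (cell (\<chi> j. if j \<in> S then 0 else c $ j) (icube k) \<times> cell y' (icube l))"
  using assms(1,2)
proof (induction rule: finite_induct)
  case empty
  have "(\<chi> j. if j \<in> {} then 0 else c $ j) = c"
    by (simp add: vec_eq_iff)
  then show ?case
    using assms(5) by auto
next
  case (insert j S)
  let ?c = "\<chi> j. if j \<in> S then 0 else c $ j"
  obtain y' where y': "y' \<in> icube b"
      "m (cell c (icube k) \<times> cell y (icube l)) = m (cell ?c (icube k) \<times> cell y' (icube l))"
    using insert by auto
  have ji: "j \<noteq> i"
    using insert.prems by auto
  have cj: "c $ j \<in> ideal_pow 0"
    using assms(3) by (simp add: ibox_def)
  then have "- c $ j \<in> ideal_pow (k - k)"
    by simp
  then have "m (cell (shear i j (- c $ j) ?c) (icube k) \<times> shear j i (- (- c $ j)) ` cell y' (icube l)) =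
      m (cell ?c (icube k) \<times> cell y' (icube l))"
    by (rule m_shear_cell[OF ji vec_ultra.co_cell_L])
  moreover have "shear i j (- c $ j) ?c = (\<chi> l. if l \<in> insert j S then 0 else c $ l)"
    using insert.prems insert.hyps assms(4) by (auto simp: vec_eq_iff)
  moreover have "shear j i (c $ j) ` cell y' (icube l) = cell (shear j i (c $ j) y') (icube l)"
    using cj by (simp add: shear_cell[OF ji] shear_box[OF ji])
  moreover have "shear j i (c $ j) y' \<in> shear j i (c $ j) ` icube b"
    using y'(1) by (rule imageI)
  then have "shear j i (c $ j) y' \<in> icube b"
    using cj by (simp add: shear_box[OF ji])
  ultimately show ?case
    using y'(2) by (intro bexI[of _ "shear j i (c $ j) y'"]) simp_all
qed

text \<open>Every small cell near the fibre is moved by a scalar close to 1 and integral shears to a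
  cell over \<open>e0\<close> itself, whose measure vanishes with \<open>eta\<close>. The depth has
  to be fixed before the resulting \<open>y'\<close> is known.\<close>

lemma null_at_e0:
  assumes eta: "\<And>B. compact_open B \<Longrightarrow> eta B = 0"
  shows "null_at m (e0, y)"
proof -
  have "m A = 0" if A: "compact_open A" "A \<subseteq> cell e0 (icube k0) \<times> cell y (icube 0)" for A
  proof -
    obtain l where l: "\<And>p. p \<in> A \<Longrightarrow> cell p (icube l \<times> icube l) \<subseteq> A"
      using pair_ultra.co_uniform[OF A(1)] by blast
    obtain b where b: "A \<subseteq> icube b \<times> icube b"
      using pair_ultra.co_bounded[OF A(1)] by blast
    \<comment> \<open>\<open>k0\<close> and \<open>l - min b l\<close> are the bounds of
      \<open>eta_eq_0_iff\<close> for any cell of depth \<open>l\<close> with centre in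
      \<open>icube b\<close>; \<open>l\<close> makes the cells of the partition fit into
      \<open>A\<close>.\<close>
    define k where "k = max (max k0 l) (l - min b l)"
    have k: "k0 \<le> k" "l \<le> k" "l - min b l \<le> k"
      by (auto simp: k_def)
    let ?M = "icube k \<times> icube l :: (('f ^ 'n) \<times> ('f ^ 'n)) set"
    show ?thesis
    proof (rule pair_ultra.zero_if_cosets_zero[OF additive A(1), of ?M])
      show "is_subgroup ?M"
        by (intro subgroup_Times subgroup_box)
      show "compact_open (cell p ?M)" for p
        by (cases p) (simp add: cell_Times co_Times vec_ultra.co_cell_L)
      show "cell p ?M \<subseteq> A" if "p \<in> A" for p
      proof -
        have "cell p ?M \<subseteq> cell p (icube l \<times> icube l)"
          using vec_ultra.mono_L[OF k(2)] by (auto simp: cell_def)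
        then show ?thesis
          using l[OF that] by blast
      qed
      fix p assume p: "p \<in> A"
      obtain x z where xz: "p = (x, z)"
        by (cases p)
      have x: "x \<in> cell e0 (icube k0)" and z: "z \<in> icube b"
        using A(2) b p xz by auto
      interpret eta: borel_dist eta \<alpha> i0 k0
        by (rule eta_borel)
      note x' = eta.near_axis[OF x]
      let ?t = "x $ i0" and ?c = "inverse (x $ i0) *s x"
      have c: "?c \<in> icube 0" "?c $ i0 = 1"
        using x' by (auto simp: ibox_def ideal_pow_scale val_inverse)
      have "m (cell (?t *s ?c) (ibox (\<lambda>a. k + val ?t)) \<times> cell z (icube l)) = \<chi>1 ?t * m (cell ?c (icube k) \<times> cell z (icube l))"
        by (rule m_smult_cell[OF x'(3) vec_ultra.co_cell_L])
      then have 1: "m (cell x (icube k) \<times> cell z (icube l)) = m (cell ?c (icube k) \<times> cell z (icube l))"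
        using x'(3,4) smooth1[OF x'(2)] by simp
      let ?S = "{j. j \<noteq> i0}"
      obtain y' where y': "y' \<in> icube b"
          "m (cell ?c (icube k) \<times> cell z (icube l)) =
           m (cell (\<chi> j. if j \<in> ?S then 0 else ?c $ j) (icube k) \<times> cell y' (icube l))"
        using clear_pair[OF _ _ c z, of ?S k l] by auto
      have "(\<chi> j. if j \<in> ?S then 0 else ?c $ j) = e0"
        using c(2) by (auto simp: vec_eq_iff axis_def)
      then have 2: "m (cell ?c (icube k) \<times> cell z (icube l)) = m (cell e0 (icube k) \<times> cell y' (icube l))"
        using y'(2) by simp
      have "m (cell e0 (icube k) \<times> cell y' (icube l)) = 0"
      proof (subst eta_eq_0_iff[symmetric, OF vec_ultra.co_cell_L _ _ k(1,3)])
        show "cell y' (icube l) \<subseteq> icube (min b l)"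
        proof
          fix v assume "v \<in> cell y' (icube l)"
          then have "v - y' \<in> icube (min b l)" "y' \<in> icube (min b l)"
            using y'(1) vec_ultra.mono_L[of "min b l" l] vec_ultra.mono_L[of "min b l" b] by (auto simp: cell_def)
          then have "(v - y') + y' \<in> icube (min b l)"
            by (rule is_subgroup_add[OF subgroup_box])
          then show "v \<in> icube (min b l)"
            by simp
        qed
        show "cell v (icube l) \<subseteq> cell y' (icube l)" if "v \<in> cell y' (icube l)" for v
          using cell_eq[OF subgroup_box that] by simp
        show "eta (cell y' (icube l)) = 0"
          by (rule eta[OF vec_ultra.co_cell_L])
      qed
      then show "m (cell p ?M) = 0"
        by (simp add: xz cell_Times 1 2)
    qed
  qed
  moreover have "compact_open (cell e0 (icube k0) \<times> cell y (icube 0))"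
    by (intro co_Times vec_ultra.co_cell_L)
  moreover have "(e0, y) \<in> cell e0 (icube k0) \<times> cell y (icube 0)"
    by (simp add: cell_self[OF subgroup_box])
  ultimately show ?thesis
    unfolding null_at_def by blast
qed

lemma null_x_smult:
  assumes "\<And>y. null_at m (x, y)" "t \<noteq> 0"
  shows "null_at m (t *s x, y)"
proof -
  have "null_at m (map_prod ((*s) t) id (x, y))"
  proof (rule null_at_map[where f = "map_prod ((*s) t) id" and g = "map_prod ((*s) (inverse t)) id" and c = "\<chi>1 t"])
    show "null_at m (x, y)"
      by (rule assms(1))
  qed (use assms(2) in \<open>auto simp: co_pair_smult m_smult\<close>)
  then show ?thesis
    by simp
qed

text \<open>The hypothesis covers the whole fibre over \<open>x\<close> because the shear also moves
  \<open>y\<close>.\<close>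

lemma null_x_shear:
  assumes "\<And>y. null_at m (x, y)" "i \<noteq> j"
  shows "null_at m (shear j i w x, y)"
proof -
  have inv: "shear j i w (shear j i (- w) z) = z" "shear j i (- w) (shear j i w z) = z"
      "shear i j w (shear i j (- w) z) = z" "shear i j (- w) (shear i j w z) = z" for z :: "'f ^ 'n"
    using assms(2) by (simp_all add: shear_inverse)
  have "null_at m (map_prod (shear j i w) (shear i j (- w)) (x, shear i j w y))"
  proof (rule null_at_map[where f = "map_prod (shear j i w) (shear i j (- w))" and g = "map_prod (shear j i (- w)) (shear i j w)" and c = 1])
    show "null_at m (x, shear i j w y)"
      by (rule assms(1))
    show "compact_open (map_prod (shear j i w) (shear i j (- w)) ` A)" if "compact_open A" for A
      using co_pair_shear[OF assms(2) that, of "- w"] by simp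
    show "compact_open (map_prod (shear j i (- w)) (shear i j w) ` A)" if "compact_open A" for A
      by (rule co_pair_shear[OF assms(2) that])
    show "m (map_prod (shear j i w) (shear i j (- w)) ` A) = 1 * m A" if "compact_open A" for A
      using m_shear[OF assms(2) that, of "- w"] by simp
  qed (auto simp: inv)
  then show ?thesis
    by (simp add: inv)
qed

text \<open>Scalars and shears act transitively on nonzero first components: two shears carry
  \<open>e0\<close> to \<open>axis i 1\<close> for a nonzero coordinate \<open>i\<close> of
  \<open>x\<close>, a scalar adjusts that coordinate, further shears fill in the rest.\<close>

lemma null_x:
  assumes e0: "\<And>y. null_at m (e0, y)" and x: "x \<noteq> 0"
  shows "null_at m (x, y)"
proof -
  obtain i where i: "x $ i \<noteq> 0"
    using x by (auto simp: vec_eq_iff)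
  have ax: "null_at m (axis i 1, y)" for y
  proof (cases "i = i0")
    case False
    have "null_at m (shear i i0 (- 1) (shear i0 i 1 e0), y)"
      using False by (intro null_x_shear e0) auto
    moreover have "shear i i0 (- 1) (shear i0 i 1 e0) = axis i 1"
      using False by (simp add: vec_eq_iff axis_def)
    ultimately show ?thesis
      by simp
  qed (use e0 in simp)
  have cleared: "null_at m (x $ i *s axis i 1, y)" for y
    by (rule null_x_smult[OF ax i])
  have uncleared: "null_at m (x, y)" if "finite S" "i \<notin> S" "\<And>y. null_at m (\<chi> j. if j \<in> S then 0 else x $ j, y)" for S y
    using that
  proof (induction arbitrary: y rule: finite_induct)
    case empty
    then show ?case
      by (simp add: vec_lambda_eta)
  next
    case (insert j S)
    have ji: "j \<noteq> i"
      using insert.prems by auto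
    have "shear i j (x $ j / x $ i) (\<chi> l. if l \<in> insert j S then 0 else x $ l) = (\<chi> l. if l \<in> S then 0 else x $ l)"
      using insert.prems(1) insert.hyps i by (auto simp: vec_eq_iff)
    then have "null_at m (\<chi> l. if l \<in> S then 0 else x $ l, y)" for y
      using null_x_shear[OF insert.prems(2) ji, of "x $ j / x $ i" y] by simp
    then show ?case
      using insert.prems(1) by (intro insert.IH) auto
  qed
  have eq: "(\<chi> j. if j \<in> {j. j \<noteq> i} then 0 else x $ j) = x $ i *s axis i 1"
    by (auto simp: vec_eq_iff axis_def)
  show ?thesis
  proof (rule uncleared[of "{j. j \<noteq> i}"])
    show "null_at m (\<chi> j. if j \<in> {j. j \<noteq> i} then 0 else x $ j, y)" for y
      unfolding eq by (rule cleared)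
  qed auto
qed

text \<open>Vanishing of \<open>eta\<close> confines the support of \<open>m\<close> to
  \<open>x = 0\<close>.\<close>

lemma eq_on_slice:
  assumes eta: "\<And>B. compact_open B \<Longrightarrow> eta B = 0" and AB: "compact_open A" "compact_open B" "\<And>y. (0, y) \<in> A \<longleftrightarrow> (0, y) \<in> B"
  shows "m A = m B"
proof (rule pair_ultra.eq_if_null_off[OF additive _ AB(1,2), of "{z. fst z = 0}"])
  show "A \<inter> {z. fst z = 0} = B \<inter> {z. fst z = 0}"
    using AB(3) by auto
  show "m C = 0" if C: "compact_open C" "C \<inter> {z. fst z = 0} = {}" for C
  proof (rule pair_ultra.null_at_imp_zero[OF additive C(1)])
    fix p assume "p \<in> C"
    then have p: "fst p \<noteq> 0"
      using C(2) by auto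
    have "null_at m (e0, y)" for y
      by (rule null_at_e0) (rule eta)
    then have "null_at m (fst p, snd p)"
      by (rule null_x[OF _ p])
    then show "null_at m p"
      by simp
  qed
qed

text \<open>What remains lives on \<open>x = 0\<close>, which scaling of \<open>x\<close> fixes
  pointwise; a nontrivial \<chi>1 then leaves nothing.\<close>

lemma zero_if_eta_zero:
  assumes eta: "\<And>B. compact_open B \<Longrightarrow> eta B = 0" and t: "t \<noteq> 0" "\<chi>1 t \<noteq> 1" and A: "compact_open A"
  shows "m A = 0"
proof -
  have "m A = m (map_prod ((*s) t) id ` A)"
  proof (rule eq_on_slice[OF _ A co_pair_smult[OF t(1) A]])
    show "eta B = 0" if "compact_open B" for B
      by (rule eta[OF that])
    fix y
    show "(0, y) \<in> A \<longleftrightarrow> (0, y) \<in> map_prod ((*s) t) id ` A"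
    proof
      assume "(0, y) \<in> A"
      then have "map_prod ((*s) t) id (0, y) \<in> map_prod ((*s) t) id ` A"
        by (rule imageI)
      then show "(0, y) \<in> map_prod ((*s) t) id ` A"
        by simp
    next
      assume "(0, y) \<in> map_prod ((*s) t) id ` A"
      then obtain x where x: "(x, y) \<in> A" "t *s x = 0"
        by auto
      have "x = 0"
        using x(2) t(1) by (simp add: vec_eq_iff)
      then show "(0, y) \<in> A"
        using x(1) by simp
    qed
  qed
  then have "m A * (1 - \<chi>1 t) = 0"
    using m_smult[OF t(1) A] by (simp add: algebra_simps)
  then show ?thesis
    using t(2) by simp
qed

text \<open>\<open>icube 1\<close> is the uniformizer times \<open>icube 0\<close>, so both have the
  same measure against \<open>B\<close>, and the difference has measure 0.\<close>

lemma primitive_zero: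
  assumes "\<chi>1 unif = 1" and B: "compact_open B"
  shows "m ((icube 0 - icube 1) \<times> B) = 0"
proof -
  have "icube 1 \<subseteq> (icube 0 :: ('f ^ 'n) set)"
    by (rule box_mono) simp
  then have "m (icube 0 \<times> B) = m (icube 1 \<times> B) + m ((icube 0 - icube 1) \<times> B)"
    using vec_ultra.fin_additive_split[OF section_additive[OF B] co_box co_box, of "\<lambda>_. 0" "\<lambda>_. 1"]
    by (simp add: Int_absorb1)
  moreover have "m (icube 1 \<times> B) = m (icube 0 \<times> B)"
    using m_smult_cell[OF unif_nz B, of 0 "\<lambda>_. 0"] assms(1) by (simp add: cell_def)
  ultimately show ?thesis
    by simp
qed

section \<open>The case of trivial \<chi>1\<close>

context
  assumes triv: "\<And>t. t \<noteq> 0 \<Longrightarrow> \<chi>1 t = 1"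
begin

lemma m_unit_smult_cell:
  assumes "t \<noteq> 0" "val t = 0" "compact_open B"
  shows "m (cell (t *s p) (icube k) \<times> B) = m (cell p (icube k) \<times> B)"
  using m_smult_cell[OF assms(1,3), of p "\<lambda>_. k"] assms(2) triv[OF assms(1)] by simp

text \<open>Unit scalars and integral shears connect all primitive vectors; integral shears also
  preserve the second factor O^n. This is the reason for taking O^n there.\<close>

lemma m_primitive_cell:
  assumes c: "c \<in> icube 0 - icube 1"
  shows "m (cell c (icube k) \<times> icube 0) = m (cell e0 (icube k) \<times> icube 0)"
proof -
  obtain i where i: "c $ i \<noteq> 0" "val (c $ i) = 0"
    using c by (rule primitive_unit)
  let ?c = "inverse (c $ i) *s c"
  have c': "?c \<in> icube 0" "?c $ i = 1"
    using c i by (auto simp: ibox_def ideal_pow_scale val_inverse)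
  have cube0: "cell y (icube 0) = (icube 0 :: ('f ^ 'n) set)" if "y \<in> icube 0" for y
    using cell_eq[OF subgroup_box, of y 0 "\<lambda>_. 0"] that by (simp add: cell_def)
  have "m (cell (c $ i *s ?c) (icube k) \<times> icube 0) = m (cell ?c (icube k) \<times> icube 0)"
    by (rule m_unit_smult_cell[OF i co_box])
  then have 1: "m (cell c (icube k) \<times> icube 0) = m (cell ?c (icube k) \<times> icube 0)"
    using i by simp
  have z: "0 \<in> (icube 0 :: ('f ^ 'n) set)"
    by (simp add: ibox_def)
  let ?S = "{j. j \<noteq> i}"
  obtain y where y: "y \<in> icube 0"
      "m (cell ?c (icube k) \<times> cell 0 (icube 0)) =
       m (cell (\<chi> j. if j \<in> ?S then 0 else ?c $ j) (icube k) \<times> cell y (icube 0))"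
    using clear_pair[OF _ _ c' z, of ?S k 0] by auto
  have "(\<chi> j. if j \<in> ?S then 0 else ?c $ j) = axis i 1"
    using c'(2) by (auto simp: vec_eq_iff axis_def)
  then have 2: "m (cell ?c (icube k) \<times> icube 0) = m (cell (axis i 1) (icube k) \<times> icube 0)"
    using y(2) by (simp add: cube0[OF y(1)] cube0[OF z])
  have 3: "m (cell (axis i 1) (icube k) \<times> icube 0) = m (cell e0 (icube k) \<times> icube 0)"
  proof (cases "i = i0")
    case False
    have sh: "m (cell (shear a b w p) (icube k) \<times> icube 0) = m (cell p (icube k) \<times> icube 0)"
      if "a \<noteq> b" "w \<in> ideal_pow 0" for a b w p
      using m_shear_cell[of b a "icube 0" w "\<lambda>_. k" p] that by (simp add: co_box shear_box)
    have "shear i0 i (- 1) (shear i i0 1 (axis i 1)) = e0"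
      using False by (simp add: vec_eq_iff axis_def)
    then show ?thesis
      using sh[of i0 i "- 1" "shear i i0 1 (axis i 1)"] sh[of i i0 1 "axis i 1"] False by simp
  qed simp
  show ?thesis
    by (simp only: 1 2 3)
qed

lemma e0_primitive: "e0 \<in> icube 0 - icube 1"
  by (auto simp: ibox_def axis_def split: if_splits dest!: spec[of _ i0])

text \<open>Averaging over the primitive vectors: all their cells times O^n have equal measure, and
  the total is 0 by \<open>primitive_zero\<close>.\<close>

lemma eta_cube_zero: "eta (icube 0) = 0"
proof -
  have "m (cell e0 (icube k0) \<times> icube 0) = 0"
  proof (rule vec_ultra.coset_zero[OF section_additive[OF co_box] _ subgroup_box vec_ultra.co_cell_L _ primitive_zero e0_primitive])
    show "compact_open (icube 0 - icube 1 :: ('f ^ 'n) set)"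
      by (intro vec_ultra.co_Diff co_box)
    show "cell p (icube k0) \<subseteq> icube 0 - icube 1" if "p \<in> icube 0 - icube 1" for p :: "'f ^ 'n"
      by (rule primitive_stable[OF that k0])
  qed (auto simp: triv co_box m_primitive_cell)
  moreover have "cell p (icube 0) \<subseteq> (icube 0 :: ('f ^ 'n) set)" if "p \<in> icube 0" for p
    using cell_eq[OF subgroup_box, of p 0 "\<lambda>_. 0"] that by (simp add: cell_def)
  ultimately show ?thesis
    using k0 by (subst eta_eq_0_iff[of _ 0 0 k0]) (auto simp: co_box)
qed

text \<open>In dimension 1 a primitive vector is a unit times \<open>e0\<close>. Scalars of the
  first component suffice to permute the cells and leave \<open>B\<close> alone, so the averaging
  works for every \<open>B\<close>.\<close>

lemma eta_zero_one_dim: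
  assumes one: "\<And>i. i = i0" and B: "compact_open B"
  shows "eta B = 0"
proof -
  obtain b l where bl: "B \<subseteq> icube b" "\<And>p. p \<in> B \<Longrightarrow> cell p (icube l) \<subseteq> B"
    using co_data[OF B] by blast
  define K where "K = max k0 (l - b)"
  have K: "k0 \<le> K" "l - b \<le> K" "1 \<le> K"
    using k0 by (auto simp: K_def)
  have "m (cell e0 (icube K) \<times> B) = 0"
  proof (rule vec_ultra.coset_zero[OF section_additive[OF B] _ subgroup_box vec_ultra.co_cell_L _ primitive_zero e0_primitive])
    show "compact_open (icube 0 - icube 1 :: ('f ^ 'n) set)"
      by (intro vec_ultra.co_Diff co_box)
    fix p :: "'f ^ 'n" assume p: "p \<in> icube 0 - icube 1"
    show "cell p (icube K) \<subseteq> icube 0 - icube 1"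
      by (rule primitive_stable[OF p K(3)])
    obtain i where i: "p $ i \<noteq> 0" "val (p $ i) = 0"
      using p by (rule primitive_unit)
    have "i = i0"
      by (rule one)
    have "p $ i0 *s e0 = p"
      by (subst vec_eq_iff) (metis one axis_nth mult.right_neutral vector_smult_component)
    then show "m (cell p (icube K) \<times> B) = 0 \<or> m (cell p (icube K) \<times> B) = m (cell e0 (icube K) \<times> B)"
      using m_unit_smult_cell[OF i B, of e0 K] \<open>i = i0\<close> by simp
  qed (auto simp: triv B)
  then show ?thesis
    using eta_eq_0_iff[OF B bl K(1,2)] by simp
qed

text \<open>On units the powers of q disappear and \<chi>1 is trivial, so every torus character of
  \<open>eta\<close> restricts to \<chi>2. Either all of them are unramified and the value at O^n
  decides, or all are ramified and a coordinate \<open>j \<noteq> i0\<close> supplies the dilation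
  for \<open>zero_if_ramified\<close>.\<close>

lemma eta_zero:
  assumes B: "compact_open B"
  shows "eta B = 0"
proof (cases "\<forall>i. i = i0")
  case True
  then show ?thesis
    using eta_zero_one_dim B by blast
next
  case False
  then obtain j where j: "j \<noteq> i0"
    by blast
  interpret eta: borel_dist eta \<alpha> i0 k0
    by (rule eta_borel)
  have unit: "\<alpha> i u = \<chi>2 u" if "u \<noteq> 0" "val u = 0" for i u
    using that triv by (simp add: \<alpha>_def)
  show ?thesis
  proof (cases "\<forall>u. u \<noteq> 0 \<longrightarrow> val u = 0 \<longrightarrow> \<chi>2 u = 1")
    case True
    show ?thesis
      by (rule eta.zero_if_unramified[OF _ eta_cube_zero B]) (use True unit in simp)
  next
    case False
    then obtain u where u: "u \<noteq> 0" "val u = 0" "\<chi>2 u \<noteq> 1"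
      by blast
    show ?thesis
      by (rule eta.zero_if_ramified[OF j u(1,2) _ u(1) _ B]) (use unit[OF u(1,2)] u(3) in simp_all)
  qed
qed

text \<open>With the support on \<open>x = 0\<close>, the first factor matters only through
  containing 0. The transformation of \<open>icube 0\<close> that accompanies a move of
  \<open>B\<close> can therefore be undone, without any modulus: all torus characters are
  \<chi>2.\<close>

lemma slice_borel: "borel_dist (\<lambda>B. m (icube 0 \<times> B)) (\<lambda>_. \<chi>2) i0 k0"
proof
  have slice: "m (X \<times> B) = m (icube 0 \<times> B)" if "compact_open X" "0 \<in> X" "compact_open B" for X B :: "('f ^ 'n) set"
  proof (rule eq_on_slice)
    show "eta B = 0" if "compact_open B" for B
      by (rule eta_zero[OF that])
    show "compact_open (X \<times> B)" "compact_open (icube 0 \<times> B)"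
      using that by (auto intro: co_Times co_box)
    show "(0, y) \<in> X \<times> B \<longleftrightarrow> (0, y) \<in> icube 0 \<times> B" for y
      using that(2) by (simp add: ibox_def)
  qed
  show "fin_additive (\<lambda>B. m (icube 0 \<times> B))"
    unfolding fin_additive_def
  proof (intro allI impI)
    fix A B :: "('f ^ 'n) set" assume AB: "compact_open A" "compact_open B" "A \<inter> B = {}"
    then have "(icube 0 \<times> A) \<inter> (icube 0 \<times> B) = {}"
      by blast
    then have "m ((icube 0 \<times> A) \<union> (icube 0 \<times> B)) = m (icube 0 \<times> A) + m (icube 0 \<times> B)"
      using additive co_Times[OF co_box AB(1)] co_Times[OF co_box AB(2)] unfolding fin_additive_def by blast
    then show "m (icube 0 \<times> (A \<union> B)) = m (icube 0 \<times> A) + m (icube 0 \<times> B)"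
      by (simp add: Sigma_Un_distrib2)
  qed
  show "1 \<le> k0"
    by (rule k0)
  show "\<chi>2 t = 1" if "t - 1 \<in> ideal_pow k0" for t
    by (rule smooth2[OF that])
  show "m (icube 0 \<times> dilate i t ` B) = \<chi>2 t * m (icube 0 \<times> B)" if t: "t \<noteq> 0" and B: "compact_open B" for i t B
  proof -
    have "m (dilate i (inverse t) ` icube 0 \<times> dilate i t ` B) = m (icube 0 \<times> dilate i t ` B)"
    proof (rule slice)
      show "compact_open (dilate i (inverse t) ` icube 0 :: ('f ^ 'n) set)" "compact_open (dilate i t ` B)"
        using t B by (auto intro!: co_dilate co_box)
      show "0 \<in> dilate i (inverse t) ` (icube 0 :: ('f ^ 'n) set)"
        by (rule image_eqI[of _ _ 0]) (auto simp: vec_eq_iff ibox_def)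
    qed
    then show ?thesis
      using m_dilate[OF t co_Times[OF co_box B], of i "\<lambda>_. 0"] by (simp add: map_prod_Times)
  qed
  show "m (icube 0 \<times> shear i j w ` B) = m (icube 0 \<times> B)" if ij: "i \<noteq> j" "j \<noteq> i0" and B: "compact_open B" for i j w B
  proof -
    have "m (shear j i (- w) ` icube 0 \<times> shear i j w ` B) = m (icube 0 \<times> shear i j w ` B)"
    proof (rule slice)
      show "compact_open (shear j i (- w) ` icube 0 :: ('f ^ 'n) set)" "compact_open (shear i j w ` B)"
        using ij B by (auto intro!: co_shear co_box)
      show "0 \<in> shear j i (- w) ` (icube 0 :: ('f ^ 'n) set)"
        by (rule image_eqI[of _ _ 0]) (auto simp: vec_eq_iff ibox_def)
    qed
    then show ?thesis
      using m_shear[OF ij(1) co_Times[OF co_box B], of w "\<lambda>_. 0"] by (simp add: map_prod_Times)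
  qed
qed

text \<open>Over \<open>x = 0\<close>, \<open>A\<close> agrees with O^n times its slice
  \<open>B\<close>, which is again compact open.\<close>

lemma zero_if_slice_zero:
  assumes zero: "\<And>B. compact_open B \<Longrightarrow> m (icube 0 \<times> B) = 0" and A: "compact_open A"
  shows "m A = 0"
proof -
  define B where "B = {y. (0, y) \<in> A}"
  have slice: "open {y. (0 :: 'f ^ 'n, y :: 'f ^ 'n) \<in> C}" if "open C" for C
  proof -
    have "\<exists>k. cell y (icube k) \<subseteq> {y. (0, y) \<in> C}" if y: "(0, y) \<in> C" for y
    proof -
      obtain k where "cell (0, y) (icube k \<times> icube k) \<subseteq> C"
        using \<open>open C\<close> y unfolding pair_ultra.open_iff by blast
      then have "cell y (icube k) \<subseteq> {y. (0, y) \<in> C}"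
        using cell_self[OF subgroup_box, of 0 "\<lambda>_. k"] by (auto simp: cell_Times)
      then show ?thesis ..
    qed
    then show ?thesis
      unfolding vec_ultra.open_iff by blast
  qed
  have "open B"
    using slice[of A] A by (auto simp: B_def compact_open_def)
  moreover have "compact B"
  proof -
    have "open (- B)"
      using slice[of "- A"] pair_ultra.co_closed[OF A] by (auto simp: B_def closed_def Collect_neg_eq)
    moreover obtain b where "A \<subseteq> icube b \<times> icube b"
      using pair_ultra.co_bounded[OF A] by blast
    then have "icube b \<inter> B = B"
      by (auto simp: B_def)
    ultimately show ?thesis
      using compact_Int_closed[OF compact_box, of B "\<lambda>_. b"] by (simp add: closed_def)
  qed
  ultimately have B: "compact_open B"
    by (simp add: compact_open_def)
  have "m A = m (icube 0 \<times> B)"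
  proof (rule eq_on_slice[OF _ A co_Times[OF co_box B]])
    show "eta C = 0" if "compact_open C" for C
      by (rule eta_zero[OF that])
  qed (auto simp: B_def ibox_def)
  then show ?thesis
    using zero[OF B] by simp
qed

end

end

text \<open>The test set of the fibre problem, or of the slice problem when \<chi>1 is trivial, is
  thickened to a product in pairs: by O^n around \<open>x = 0\<close>, or by a small cell around the
  basis vector.\<close>

lemma pair_dist_determined:
  fixes \<chi>1 \<chi>2 :: "'f::nonarch_local_field \<Rightarrow> complex"
  shows "\<exists>A0 :: (('f ^ 'n) \<times> ('f ^ 'n)) set. compact_open A0 \<and> (\<forall>m. pair_dist m \<chi>1 \<chi>2 k0 \<longrightarrow> m A0 = 0 \<longrightarrow> (\<forall>A. compact_open A \<longrightarrow> m A = 0))"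
proof (cases "\<forall>t. t \<noteq> 0 \<longrightarrow> \<chi>1 t = 1")
  case True
  \<comment> \<open>An arbitrary coordinate; \<chi>1 and \<chi>2 do not distinguish one.\<close>
  define i0 :: 'n where "i0 = undefined"
  obtain B0 where B0: "compact_open B0"
      "\<And>\<mu>. borel_dist \<mu> (\<lambda>_::'n. \<chi>2) i0 k0 \<Longrightarrow> \<mu> B0 = 0 \<Longrightarrow> (\<forall>A. compact_open A \<longrightarrow> \<mu> A = 0)"
    using borel_dist_determined[of "\<lambda>_::'n. \<chi>2" i0 k0] by blast
  have main: "m A = 0" if m: "pair_dist m \<chi>1 \<chi>2 k0" and zero: "m (icube 0 \<times> B0) = 0" and A: "compact_open A" for m and A :: "(('f ^ 'n) \<times> ('f ^ 'n)) set"
  proof -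
    interpret pair_dist m \<chi>1 \<chi>2 i0 k0
      by (rule m)
    have "\<forall>B. compact_open B \<longrightarrow> m (icube 0 \<times> B) = 0"
      by (rule B0(2)[OF slice_borel zero]) (use True in auto)
    then show ?thesis
      using zero_if_slice_zero True A by blast
  qed
  show ?thesis
    by (intro exI[of _ "(icube 0 :: ('f ^ 'n) set) \<times> B0"] conjI allI impI co_Times[OF co_box B0(1)]) (rule main)
next
  case False
  then obtain t where t: "t \<noteq> 0" "\<chi>1 t \<noteq> 1"
    by blast
  define i0 :: 'n where "i0 = undefined"
  \<comment> \<open>The torus characters of the fibre depend on \<chi>1, \<chi>2 and
    \<open>i0\<close> but not on \<open>m\<close>, so \<open>B0\<close>, and with it
    \<open>K\<close>, can be fixed before \<open>m\<close>.\<close>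
  define \<alpha> where "\<alpha> = (pair_dist.\<alpha> \<chi>1 \<chi>2 i0 :: 'n \<Rightarrow> 'f \<Rightarrow> complex)"
  obtain B0 where B0: "compact_open B0" "\<And>\<mu>. borel_dist \<mu> \<alpha> i0 k0 \<Longrightarrow> \<mu> B0 = 0 \<Longrightarrow> (\<forall>A. compact_open A \<longrightarrow> \<mu> A = 0)"
    using borel_dist_determined[of \<alpha> i0 k0] by blast
  obtain b l where bl: "B0 \<subseteq> icube b" "\<And>p. p \<in> B0 \<Longrightarrow> cell p (icube l) \<subseteq> B0"
    using vec_ultra.co_bounded[OF B0(1)] vec_ultra.co_uniform[OF B0(1)] by blast
  define K where "K = max k0 (l - b)"
  have K: "k0 \<le> K" "l - b \<le> K"
    by (auto simp: K_def)
  have main: "m A = 0" if m: "pair_dist m \<chi>1 \<chi>2 k0" and zero: "m (cell (axis i0 1) (icube K) \<times> B0) = 0" and A: "compact_open A" for m and A :: "(('f ^ 'n) \<times> ('f ^ 'n)) set"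
  proof -
    interpret pd: pair_dist m \<chi>1 \<chi>2 i0 k0
      by (rule m)
    have "pd.eta B0 = 0"
      using pd.eta_eq_0_iff[OF B0(1) bl K] zero by simp
    then have "\<forall>B. compact_open B \<longrightarrow> pd.eta B = 0"
      using B0(2) pd.eta_borel unfolding \<alpha>_def by blast
    then show ?thesis
      using pd.zero_if_eta_zero t A by blast
  qed
  show ?thesis
    by (intro exI[of _ "cell (axis i0 1) (icube K) \<times> B0"] conjI allI impI co_Times[OF vec_ultra.co_cell_L B0(1)]) (rule main)
qed

section \<open>Functionals and the group action\<close>

definition indic :: "'v set \<Rightarrow> 'v \<Rightarrow> complex" where
  "indic A = (\<lambda>v. if v \<in> A then 1 else 0)"

lemma locally_const_iff:
  "locally (\<lambda>U. \<phi> constant_on U) UNIV \<longleftrightarrow> (\<forall>c. open (\<phi> -` {c}))"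
  for \<phi> :: "'v::topological_space \<Rightarrow> complex"
proof
  assume L: "locally (\<lambda>U. \<phi> constant_on U) UNIV"
  show "\<forall>c. open (\<phi> -` {c})"
  proof
    fix c
    show "open (\<phi> -` {c})"
    proof (subst open_subopen, rule ballI)
      fix x assume x: "x \<in> \<phi> -` {c}"
      obtain u v where uv: "open u" "\<phi> constant_on v" "x \<in> u" "u \<subseteq> v"
        using L[unfolded locally_def, rule_format, of UNIV x] by auto
      then have "\<phi> z = \<phi> x" if "z \<in> u" for z
        using that unfolding constant_on_def by (metis subsetD)
      then have "u \<subseteq> \<phi> -` {c}"
        using x by auto
      then show "\<exists>T. open T \<and> x \<in> T \<and> T \<subseteq> \<phi> -` {c}"
        using uv by blast
    qed
  qed
next
  assume c: "\<forall>c. open (\<phi> -` {c})"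
  show "locally (\<lambda>U. \<phi> constant_on U) UNIV"
    unfolding locally_def
  proof (intro allI impI)
    fix w and x :: 'v
    assume wx: "openin (top_of_set UNIV) w \<and> x \<in> w"
    let ?u = "w \<inter> \<phi> -` {\<phi> x}"
    have "open ?u"
      using wx c by auto
    moreover have "\<phi> constant_on ?u"
      by (auto simp: constant_on_def)
    ultimately show "\<exists>u v. openin (top_of_set UNIV) u \<and> \<phi> constant_on v \<and> x \<in> u \<and> u \<subseteq> v \<and> v \<subseteq> w"
      using wx by (intro exI[of _ ?u] conjI) auto
  qed
qed

lemma schwartz_iff:
  "\<phi> \<in> schwartz \<longleftrightarrow> (\<forall>c. open (\<phi> -` {c})) \<and> compact (closure {v. \<phi> v \<noteq> 0})"
  by (simp add: schwartz_def locally_const_iff)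

lemma schwartz_support_co: "\<phi> \<in> schwartz \<Longrightarrow> compact_open {v. \<phi> v \<noteq> 0}"
proof -
  assume \<phi>: "\<phi> \<in> schwartz"
  have "{v. \<phi> v \<noteq> 0} = - (\<phi> -` {0})" "{v. \<phi> v \<noteq> 0} = (\<Union>c\<in>- {0}. \<phi> -` {c})"
    by auto
  moreover have "open (\<phi> -` {c})" for c
    using \<phi> by (simp add: schwartz_iff)
  ultimately have "closed {v. \<phi> v \<noteq> 0}" "open {v. \<phi> v \<noteq> 0}"
    using closed_Compl open_UN by metis+
  then show ?thesis
    using \<phi> by (simp add: schwartz_iff compact_open_def)
qed

lemma schwartz_level_co: "\<phi> \<in> schwartz \<Longrightarrow> c \<noteq> 0 \<Longrightarrow> compact_open (\<phi> -` {c})"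
proof -
  assume \<phi>: "\<phi> \<in> schwartz" and c: "c \<noteq> 0"
  have "closed (\<phi> -` {c})"
  proof -
    have "- (\<phi> -` {c}) = (\<Union>d\<in>- {c}. \<phi> -` {d})"
      by auto
    then have "open (- (\<phi> -` {c}))"
      using \<phi> by (auto simp: schwartz_iff intro!: open_UN)
    then show ?thesis
      by (simp add: closed_def)
  qed
  then have "compact ({v. \<phi> v \<noteq> 0} \<inter> \<phi> -` {c})"
    using schwartz_support_co[OF \<phi>] by (intro compact_Int_closed) (simp_all add: compact_open_def)
  moreover have "{v. \<phi> v \<noteq> 0} \<inter> \<phi> -` {c} = \<phi> -` {c}"
    using c by auto
  ultimately show ?thesis
    using \<phi> by (simp add: schwartz_iff compact_open_def)
qed

lemma schwartz_finite_values: "\<phi> \<in> schwartz \<Longrightarrow> finite (range \<phi> - {0})"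
proof -
  assume \<phi>: "\<phi> \<in> schwartz"
  let ?S = "{v. \<phi> v \<noteq> 0}"
  have "?S \<subseteq> (\<Union>c\<in>UNIV. \<phi> -` {c})"
    by auto
  then obtain D where D: "finite D" "?S \<subseteq> (\<Union>c\<in>D. \<phi> -` {c})"
    using compactE_image[of ?S UNIV "\<lambda>c. \<phi> -` {c}"] schwartz_support_co[OF \<phi>] \<phi>
    unfolding compact_open_def schwartz_iff by metis
  then have "range \<phi> - {0} \<subseteq> D"
    by auto
  then show ?thesis
    using D(1) finite_subset by blast
qed

lemma ind_schwartz: "compact_open A \<Longrightarrow> closed A \<Longrightarrow> indic A \<in> schwartz"
proof -
  assume A: "compact_open A" "closed A"
  have "{v. indic A v \<noteq> 0} = A"
    by (auto simp: indic_def)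
  moreover have "indic A -` {c} = (if c = 1 then A else if c = 0 then - A else {})" for c
    by (auto simp: indic_def)
  ultimately show ?thesis
    using A by (auto simp: schwartz_iff compact_open_def)
qed

text \<open>A Schwartz function has finitely many nonzero values; removing one level set at a time
  reduces it to indicators. The hypothesis \<open>closed\<close> stands in for a separation property
  of the space.\<close>

lemma functional_zero:
  fixes \<xi> :: "('v::topological_space \<Rightarrow> complex) \<Rightarrow> complex"
  assumes \<xi>: "\<xi> \<in> functionals" and closed: "\<And>A::'v set. compact_open A \<Longrightarrow> closed A"
    and zero: "\<And>A. compact_open A \<Longrightarrow> \<xi> (indic A) = 0"
  shows "\<xi> = (\<lambda>_. 0)"
proof
  fix \<phi>
  have "\<xi> \<phi> = 0" if "\<phi> \<in> schwartz"
    using that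
  proof (induction "card (range \<phi> - {0})" arbitrary: \<phi> rule: less_induct)
    case less
    note \<phi> = less.prems
    show ?case
    proof (cases "range \<phi> - {0} = {}")
      case True
      then have "\<phi> = indic {}"
        by (auto simp: indic_def fun_eq_iff)
      then show ?thesis
        using zero[of "{}"] by simp
    next
      case False
      then obtain c where c: "c \<in> range \<phi>" "c \<noteq> 0"
        by auto
      let ?A = "\<phi> -` {c}"
      define \<psi> where "\<psi> = (\<lambda>v. if v \<in> ?A then 0 else \<phi> v)"
      have A: "compact_open ?A"
        by (rule schwartz_level_co[OF \<phi> c(2)])
      have indic: "indic ?A \<in> schwartz"
        by (rule ind_schwartz[OF A closed[OF A]])
      have \<psi>: "\<psi> \<in> schwartz"
      proof -
        have "\<psi> -` {d} = (if d = c then {} else if d = 0 then \<phi> -` {0} \<union> ?A else \<phi> -` {d})" for d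
          using c(2) by (auto simp: \<psi>_def split: if_splits)
        moreover have "closure {v. \<psi> v \<noteq> 0} = {v. \<phi> v \<noteq> 0} \<inter> - ?A"
        proof -
          have "{v. \<psi> v \<noteq> 0} = {v. \<phi> v \<noteq> 0} \<inter> - ?A"
            by (auto simp: \<psi>_def)
          moreover have "closed ({v. \<phi> v \<noteq> 0} \<inter> - ?A)"
            using A closed[OF schwartz_support_co[OF \<phi>]] by (intro closed_Int) (auto simp: compact_open_def closed_def)
          ultimately show ?thesis
            by simp
        qed
        moreover have "compact ({v. \<phi> v \<noteq> 0} \<inter> - ?A)"
          using A schwartz_support_co[OF \<phi>] by (intro compact_Int_closed) (auto simp: compact_open_def closed_def)
        ultimately show ?thesis
          using \<phi> by (auto simp: schwartz_iff)
      qed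
      have "range \<psi> - {0} \<subset> range \<phi> - {0}"
      proof
        show "range \<psi> - {0} \<subseteq> range \<phi> - {0}"
          by (auto simp: \<psi>_def)
        have "c \<notin> range \<psi>"
          using c(2) by (auto simp: \<psi>_def)
        then show "range \<psi> - {0} \<noteq> range \<phi> - {0}"
          using c by blast
      qed
      then have \<psi>0: "\<xi> \<psi> = 0"
        using \<psi> by (intro less.hyps psubset_card_mono schwartz_finite_values[OF \<phi>])
      have s: "cscale c (indic ?A) \<in> schwartz"
      proof -
        have "cscale c (indic ?A) -` {d} = (if d = c then ?A else if d = 0 then - ?A else {})" for d
          using c(2) by (auto simp: cscale_def indic_def split: if_splits)
        moreover have "closure {v. cscale c (indic ?A) v \<noteq> 0} = ?A"
        proof -
          have "{v. cscale c (indic ?A) v \<noteq> 0} = ?A"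
            using c(2) by (auto simp: cscale_def indic_def)
          then show ?thesis
            using closed[OF A] by simp
        qed
        ultimately show ?thesis
          using A closed[OF A] by (auto simp: schwartz_iff compact_open_def)
      qed
      have \<phi>_eq: "\<phi> = \<psi> + cscale c (indic ?A)"
        by (auto simp: \<psi>_def cscale_def indic_def fun_eq_iff)
      have "\<xi> (cscale c (indic ?A)) = 0"
        using \<xi> indic zero[OF A] by (auto simp: functionals_def)
      moreover have "\<xi> (\<psi> + cscale c (indic ?A)) = \<xi> \<psi> + \<xi> (cscale c (indic ?A))"
        using \<xi> \<psi> s unfolding functionals_def by blast
      ultimately have "\<xi> (\<psi> + cscale c (indic ?A)) = 0"
        using \<psi>0 by simp
      then show ?thesis
        by (subst \<phi>_eq)
    qed
  qed
  then show "\<xi> \<phi> = 0"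
    using \<xi> by (cases "\<phi> \<in> schwartz") (auto simp: functionals_def)
qed

section \<open>Elementary matrices in the acting group\<close>

lemma linear_dilate: "Vector_Spaces.linear (*s) (*s) (dilate i t :: 'f::field ^ 'n \<Rightarrow> 'f ^ 'n)"
  by (auto simp: Vector_Spaces.linear_iff vec_eq_iff algebra_simps vector_space_def)

lemma linear_shear: "Vector_Spaces.linear (*s) (*s) (shear i j w :: 'f::field ^ 'n \<Rightarrow> 'f ^ 'n)"
  by (auto simp: Vector_Spaces.linear_iff vec_eq_iff algebra_simps vector_space_def)

lemma transpose_dilate: "transpose (matrix (dilate i t)) = matrix (dilate i t)"
  by (auto simp: matrix_def transpose_def vec_eq_iff axis_def)

lemma transpose_shear: "i \<noteq> j \<Longrightarrow> transpose (matrix (shear i j w)) = matrix (shear j i w)"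
  by (auto simp: matrix_def transpose_def vec_eq_iff axis_def)

lemma matrix_dilate_inverse: "t \<noteq> 0 \<Longrightarrow> matrix (dilate i t) ** matrix (dilate i (inverse t)) = mat 1"
  by (simp add: matrix_eq matrix_works[OF linear_dilate] flip: matrix_vector_mul_assoc)

lemma matrix_dilate_inverse': "t \<noteq> 0 \<Longrightarrow> matrix (dilate i (inverse t)) ** matrix (dilate i t) = mat 1"
  by (simp add: matrix_eq matrix_works[OF linear_dilate] flip: matrix_vector_mul_assoc)

lemma matrix_shear_inverse: "i \<noteq> j \<Longrightarrow> matrix (shear i j w) ** matrix (shear i j (- w)) = mat 1"
  by (simp add: matrix_eq matrix_works[OF linear_shear] flip: matrix_vector_mul_assoc)

lemma matrix_shear_inverse': "i \<noteq> j \<Longrightarrow> matrix (shear i j (- w)) ** matrix (shear i j w) = mat 1"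
  by (simp add: matrix_eq matrix_works[OF linear_shear] flip: matrix_vector_mul_assoc)

definition g_smult :: "'f::field \<Rightarrow> 'f \<times> ('f ^ 'n ^ 'n) \<times> 'f" where
  "g_smult t = (t, mat 1, 1)"

definition g_dilate :: "'n::finite \<Rightarrow> 'f::field \<Rightarrow> 'f \<times> ('f ^ 'n ^ 'n) \<times> 'f" where
  "g_dilate i t = (1, matrix (dilate i t), 1)"

definition g_shear :: "'n::finite \<Rightarrow> 'n \<Rightarrow> 'f::field \<Rightarrow> 'f \<times> ('f ^ 'n ^ 'n) \<times> 'f" where
  "g_shear i j w = (1, matrix (shear i j w), 1)"

lemma g_smult_carrier: "t \<noteq> 0 \<Longrightarrow> g_smult t \<in> carrier act_group"
  by (auto simp: g_smult_def units_group_def GL_def invertible_def intro: exI[of _ "mat 1"])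

lemma g_dilate_carrier: "t \<noteq> 0 \<Longrightarrow> g_dilate i t \<in> carrier act_group"
  using matrix_dilate_inverse[of t i] matrix_dilate_inverse'[of t i]
  by (auto simp: g_dilate_def units_group_def GL_def invertible_def)

lemma g_shear_carrier: "i \<noteq> j \<Longrightarrow> g_shear i j w \<in> carrier act_group"
  using matrix_shear_inverse[of i j w] matrix_shear_inverse'[of i j w]
  by (auto simp: g_shear_def units_group_def GL_def invertible_def)

lemma act_g_smult: "act (g_smult t) = map_prod ((*s) t) id"
proof -
  have "matrix_inv (mat 1 :: 'a ^ 'b ^ 'b) = mat 1"
    by (simp add: matrix_inv_eqI)
  then show ?thesis
    by (auto simp: fun_eq_iff g_smult_def transpose_mat)
qed

lemma act_g_dilate: "t \<noteq> 0 \<Longrightarrow> act (g_dilate i t) = map_prod (dilate i (inverse t)) (dilate i t)"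
proof -
  assume t: "t \<noteq> 0"
  have inv: "matrix_inv (matrix (dilate i t)) = matrix (dilate i (inverse t))"
    by (rule matrix_inv_eqI[OF matrix_dilate_inverse[OF t] matrix_dilate_inverse'[OF t]])
  have "x v* matrix (dilate i (inverse t)) = dilate i (inverse t) x" for x
    using transpose_matrix_vector[of "matrix (dilate i (inverse t))" x]
    by (simp add: transpose_dilate matrix_works[OF linear_dilate] del: transpose_matrix_vector)
  then show ?thesis
    by (auto simp: fun_eq_iff g_dilate_def inv matrix_works[OF linear_dilate])
qed

text \<open>Multiplying a row vector on the right applies the transpose, which exchanges
  \<open>i\<close> and \<open>j\<close>; the inverse matrix gives the sign.\<close>

lemma act_g_shear: "i \<noteq> j \<Longrightarrow> act (g_shear i j w) = map_prod (shear j i (- w)) (shear i j w)"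
proof -
  assume ij: "i \<noteq> j"
  have inv: "matrix_inv (matrix (shear i j w)) = matrix (shear i j (- w))"
    by (rule matrix_inv_eqI[OF matrix_shear_inverse[OF ij] matrix_shear_inverse'[OF ij]])
  have "x v* matrix (shear i j (- w)) = shear j i (- w) x" for x
    using transpose_matrix_vector[of "matrix (shear i j (- w))" x]
    by (simp add: transpose_shear[OF ij] matrix_works[OF linear_shear] del: transpose_matrix_vector)
  then show ?thesis
    by (auto simp: fun_eq_iff g_shear_def inv matrix_works[OF linear_shear])
qed

lemma act_inverse:
  assumes "g \<in> carrier act_group"
  shows "act (inv\<^bsub>act_group\<^esub> g) (act g p) = p" "act g (act (inv\<^bsub>act_group\<^esub> g) p) = p"
proof -
  interpret group act_group
    by (rule group_act_group)
  have i: "inv\<^bsub>act_group\<^esub> g \<in> carrier act_group"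
    by (rule inv_closed[OF assms])
  have "act (inv\<^bsub>act_group\<^esub> g) (act g p) = act (inv\<^bsub>act_group\<^esub> g \<otimes>\<^bsub>act_group\<^esub> g) p"
    by (rule act_mult[symmetric, OF i assms])
  then show "act (inv\<^bsub>act_group\<^esub> g) (act g p) = p"
    using assms by (simp only: l_inv act_one)
  have "act g (act (inv\<^bsub>act_group\<^esub> g) p) = act (g \<otimes>\<^bsub>act_group\<^esub> inv\<^bsub>act_group\<^esub> g) p"
    by (rule act_mult[symmetric, OF assms i])
  then show "act g (act (inv\<^bsub>act_group\<^esub> g) p) = p"
    using assms by (simp only: r_inv act_one)
qed

lemma translate_ind:
  assumes "g \<in> carrier act_group"
  shows "translate g (indic A) = indic (act g ` A)"
proof -
  have "act (inv\<^bsub>act_group\<^esub> g) v \<in> A \<longleftrightarrow> v \<in> act g ` A" for v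
  proof
    assume "act (inv\<^bsub>act_group\<^esub> g) v \<in> A"
    then have "act g (act (inv\<^bsub>act_group\<^esub> g) v) \<in> act g ` A"
      by (rule imageI)
    then show "v \<in> act g ` A"
      by (simp only: act_inverse[OF assms])
  next
    assume "v \<in> act g ` A"
    then obtain u where "u \<in> A" "v = act g u"
      by blast
    then show "act (inv\<^bsub>act_group\<^esub> g) v \<in> A"
      by (simp only: act_inverse[OF assms])
  qed
  then show ?thesis
    by (simp add: translate_def indic_def fun_eq_iff)
qed

section \<open>The character as seen through an equivariant functional\<close>

context
  fixes chi :: "'f::nonarch_local_field \<times> ('f ^ 'n ^ 'n) \<times> 'f \<Rightarrow> complex"
    and \<xi> :: "(('f ^ 'n) \<times> ('f ^ 'n) \<Rightarrow> complex) \<Rightarrow> complex"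
  assumes \<xi>: "\<xi> \<in> equivariant_functionals chi"
begin

lemma xi_additive: "fin_additive (\<lambda>A. \<xi> (indic A))"
  unfolding fin_additive_def
proof (intro allI impI)
  fix A B :: "(('f ^ 'n) \<times> ('f ^ 'n)) set" assume AB: "compact_open A" "compact_open B" "A \<inter> B = {}"
  have "indic (A \<union> B) = indic A + indic B"
    using AB(3) by (auto simp: indic_def fun_eq_iff)
  then show "\<xi> (indic (A \<union> B)) = \<xi> (indic A) + \<xi> (indic B)"
    using \<xi> ind_schwartz[OF AB(1) pair_ultra.co_closed[OF AB(1)]] ind_schwartz[OF AB(2) pair_ultra.co_closed[OF AB(2)]]
    by (simp add: equivariant_functionals_def functionals_def)
qed

lemma xi_act:
  assumes "g \<in> carrier act_group" "compact_open A"
  shows "\<xi> (indic (act g ` A)) = chi g * \<xi> (indic A)"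
proof -
  have "\<forall>g\<in>carrier act_group. \<forall>\<phi>\<in>schwartz. \<xi> (translate g \<phi>) = chi g * \<xi> \<phi>"
    using \<xi> unfolding equivariant_functionals_def by blast
  then have "\<xi> (translate g (indic A)) = chi g * \<xi> (indic A)"
    using assms(1) ind_schwartz[OF assms(2) pair_ultra.co_closed[OF assms(2)]] by blast
  then show ?thesis
    by (simp only: translate_ind[OF assms(1)])
qed

lemma xi_smult: "t \<noteq> 0 \<Longrightarrow> compact_open A \<Longrightarrow> \<xi> (indic (map_prod ((*s) t) id ` A)) = chi (g_smult t) * \<xi> (indic A)"
  using xi_act[OF g_smult_carrier] by (simp add: act_g_smult)

lemma xi_dilate: "t \<noteq> 0 \<Longrightarrow> compact_open A \<Longrightarrow>
    \<xi> (indic (map_prod (dilate i (inverse t)) (dilate i t) ` A)) = chi (g_dilate i t) * \<xi> (indic A)"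
  using xi_act[OF g_dilate_carrier] by (simp add: act_g_dilate)

lemma xi_shear: "i \<noteq> j \<Longrightarrow> compact_open A \<Longrightarrow>
    \<xi> (indic (map_prod (shear j i (- w)) (shear i j w) ` A)) = chi (g_shear i j w) * \<xi> (indic A)"
  using xi_act[OF g_shear_carrier] by (simp add: act_g_shear)

text \<open>Conjugation by a dilation by 2 doubles the parameter, so \<open>chi (u w) = chi (u (2 w)) = (chi (u w))\<^sup>2\<close>.\<close>

lemma chi_shear:
  assumes chi: "\<forall>g\<in>carrier act_group. chi g \<noteq> 0"
    and A: "compact_open A" "\<xi> (indic A) \<noteq> 0" and ij: "i \<noteq> j"
  shows "chi (g_shear i j w) = 1"
proof -
  let ?u = "\<lambda>w. map_prod (shear j i (- w)) (shear i j w) :: ('f ^ 'n) \<times> ('f ^ 'n) \<Rightarrow> _"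
  let ?d = "map_prod (dilate i (inverse 2)) (dilate i 2) :: ('f ^ 'n) \<times> ('f ^ 'n) \<Rightarrow> _"
  have two: "(2 :: 'f) \<noteq> 0"
    by simp
  have uA: "compact_open (?u w ` B)" if "compact_open B" for w B
    by (rule co_pair_shear[OF ij that])
  have dA: "compact_open (?d ` B)" if "compact_open B" for B
    by (rule co_pair_dilate[OF two that])
  have "?u w ` ?u w ` A = ?u (2 * w) ` A"
    unfolding image_image using ij
    by (intro image_cong refl) (auto simp: vec_eq_iff algebra_simps)
  then have sq: "chi (g_shear i j w) * chi (g_shear i j w) = chi (g_shear i j (2 * w))"
    using xi_shear[OF ij uA[OF A(1)], of w w] xi_shear[OF ij A(1), of w] xi_shear[OF ij A(1), of "2 * w"] A(2)
    by simp
  have "?u w ` ?d ` A = ?d ` ?u (2 * w) ` A"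
    unfolding image_image using ij
    by (intro image_cong refl) (auto simp: vec_eq_iff algebra_simps)
  then have "chi (g_shear i j w) * chi (g_dilate i 2) = chi (g_dilate i 2) * chi (g_shear i j (2 * w))"
    using xi_shear[OF ij dA[OF A(1)], of w] xi_dilate[OF two A(1), of i]
      xi_dilate[OF two uA[OF A(1)], of i "2 * w"] xi_shear[OF ij A(1), of "2 * w"] A(2)
    by simp
  then have "chi (g_shear i j w) = chi (g_shear i j (2 * w))"
    using bspec[OF chi g_dilate_carrier[OF two, of i]] by simp
  then show ?thesis
    using sq bspec[OF chi g_shear_carrier[OF ij, of w]] by simp
qed

text \<open>Dilations of two coordinates are conjugate under a product of three shears, and
  \<open>chi\<close> is 1 on shears. The identity is read off from the values of
  \<open>\<xi>\<close> at translates of \<open>A\<close>.\<close>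

lemma chi_dilate_eq:
  assumes chi: "\<forall>g\<in>carrier act_group. chi g \<noteq> 0"
    and A: "compact_open A" "\<xi> (indic A) \<noteq> 0" and t: "t \<noteq> 0"
  shows "chi (g_dilate i t) = chi (g_dilate j t)"
proof (cases "i = j")
  case False
  let ?u = "\<lambda>i j w. map_prod (shear j i (- w)) (shear i j w) :: ('f ^ 'n) \<times> ('f ^ 'n) \<Rightarrow> _"
  let ?d = "\<lambda>i. map_prod (dilate i (inverse t)) (dilate i t) :: ('f ^ 'n) \<times> ('f ^ 'n) \<Rightarrow> _"
  \<comment> \<open>The Weyl element exchanging coordinates \<open>i\<close> and \<open>j\<close> up to sign.\<close>
  define s where "s B = ?u i j 1 ` ?u j i (- 1) ` ?u i j 1 ` B" for B
  have ji: "j \<noteq> i"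
    using False by simp
  have s: "compact_open (s B)" "\<xi> (indic (s B)) = \<xi> (indic B)" if B: "compact_open B" for B
  proof -
    have 1: "compact_open (?u i j 1 ` B)"
      by (rule co_pair_shear[OF False B])
    have 2: "compact_open (?u j i (- 1) ` ?u i j 1 ` B)"
      by (rule co_pair_shear[OF ji 1])
    show "compact_open (s B)"
      unfolding s_def by (rule co_pair_shear[OF False 2])
    show "\<xi> (indic (s B)) = \<xi> (indic B)"
      unfolding s_def xi_shear[OF False 2] xi_shear[OF ji 1] xi_shear[OF False B]
      by (simp add: chi_shear[OF chi A False] chi_shear[OF chi A ji])
  qed
  have "?d j ` s A = s (?d i ` A)"
    unfolding s_def image_image using False ji t
    by (intro image_cong refl) (auto simp: vec_eq_iff algebra_simps)
  then have "chi (g_dilate j t) * \<xi> (indic (s A)) = \<xi> (indic (s (?d i ` A)))"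
    using xi_dilate[OF t s(1)[OF A(1)], of j] by simp
  then show ?thesis
    using s(2)[OF A(1)] s(2)[OF co_pair_dilate[OF t A(1)], of i] xi_dilate[OF t A(1), of i] A(2) by simp
qed simp

text \<open>Elements close to 1 stabilise the compact open set \<open>A\<close>, and
  \<open>\<xi> (indic A) \<noteq> 0\<close> forces \<open>chi\<close> to be 1 on the
  stabiliser.\<close>

lemma chi_smooth:
  assumes A: "compact_open A" "\<xi> (indic A) \<noteq> 0"
  shows "\<exists>k\<ge>1. \<forall>t i. t - 1 \<in> ideal_pow k \<longrightarrow> chi (g_smult t) = 1 \<and> chi (g_dilate i t) = 1"
proof -
  obtain l where l: "\<And>p. p \<in> A \<Longrightarrow> cell p (icube l \<times> icube l) \<subseteq> A"
    using pair_ultra.co_uniform[OF A(1)] by blast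
  obtain b where b: "A \<subseteq> icube b \<times> icube b"
    using pair_ultra.co_bounded[OF A(1)] by blast
  \<comment> \<open>On \<open>icube b\<close>, multiplication by \<open>t\<close> moves coordinates
    by elements of exponent at least \<open>k + b \<ge> l\<close>; the bound 1 makes
    \<open>t\<close> a unit.\<close>
  define k where "k = max 1 (l - b)"
  have mult: "(t - 1) * x \<in> ideal_pow l" if t: "t - 1 \<in> ideal_pow k" and x: "x \<in> ideal_pow b" for t x :: 'f
    by (rule ideal_pow_mono[OF _ ideal_pow_mult[OF t x]]) (simp add: k_def)
  have smult: "t *s x - x \<in> icube l" if "t - 1 \<in> ideal_pow k" "x \<in> icube b" for t :: 'f and x :: "'f ^ 'n"
  proof -
    have "(t *s x - x) $ a \<in> ideal_pow l" for a
      using mult[OF that(1), of "x $ a"] that(2) by (simp add: ibox_def left_diff_distrib)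
    then show ?thesis
      by (simp add: ibox_def)
  qed
  have dilate: "dilate i t x - x \<in> icube l" if "t - 1 \<in> ideal_pow k" "x \<in> icube b" for i t and x :: "'f ^ 'n"
  proof -
    have "(dilate i t x - x) $ a \<in> ideal_pow l" for a
      using mult[OF that(1), of "x $ a"] that(2) by (cases "a = i") (simp_all add: ibox_def left_diff_distrib)
    then show ?thesis
      by (simp add: ibox_def)
  qed
  have unit: "t \<noteq> 0 \<and> val t = 0" if "t - 1 \<in> ideal_pow k" for t :: 'f
    by (rule val_unit, rule ideal_pow_mono[OF _ that]) (simp add: k_def)
  have inv: "inverse t - 1 \<in> ideal_pow k" if t: "t - 1 \<in> ideal_pow k" for t :: 'f
  proof -
    have "- (inverse t * (t - 1)) \<in> ideal_pow k"
      using unit[OF t] t by (simp add: ideal_pow_scale val_inverse)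
    moreover have "- (inverse t * (t - 1)) = inverse t - 1"
      using unit[OF t] by (simp add: algebra_simps)
    ultimately show ?thesis
      by simp
  qed
  have image: "map_prod f g ` A = A"
    if f: "\<And>x. x \<in> icube b \<Longrightarrow> f x - x \<in> icube l" "\<And>x. x \<in> icube b \<Longrightarrow> f' x - x \<in> icube l"
      and g: "\<And>x. x \<in> icube b \<Longrightarrow> g x - x \<in> icube l" "\<And>x. x \<in> icube b \<Longrightarrow> g' x - x \<in> icube l"
      and ff: "\<And>x. f (f' x) = x" and gg: "\<And>x. g (g' x) = x"
    for f f' g g' :: "'f ^ 'n \<Rightarrow> 'f ^ 'n"
  proof -
    have sub: "map_prod u v z \<in> A"
      if "z \<in> A" "\<And>x. x \<in> icube b \<Longrightarrow> u x - x \<in> icube l" "\<And>x. x \<in> icube b \<Longrightarrow> v x - x \<in> icube l"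
      for z and u v :: "'f ^ 'n \<Rightarrow> 'f ^ 'n"
    proof -
      have "map_prod u v z \<in> cell z (icube l \<times> icube l)"
        using that b by (cases z) (auto simp: cell_def)
      then show ?thesis
        using l[OF that(1)] by blast
    qed
    show ?thesis
    proof (intro equalityI subsetI)
      fix z assume "z \<in> A"
      then have "map_prod f g (map_prod f' g' z) \<in> map_prod f g ` A"
        using sub[OF _ f(2) g(2)] by (intro imageI)
      then show "z \<in> map_prod f g ` A"
        by (simp add: prod.map_comp comp_def ff gg prod.map_ident)
    qed (use sub f(1) g(1) in auto)
  qed
  have "chi (g_smult t) = 1 \<and> chi (g_dilate i t) = 1" if t: "t - 1 \<in> ideal_pow k" for i t
  proof
    have t0: "t \<noteq> 0"
      using unit[OF t] by simp
    have "map_prod ((*s) t) id ` A = A"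
      by (rule image[of _ "(*s) (inverse t)" _ id])
        (use smult[OF t] smult[OF inv[OF t]] t0 in \<open>auto simp: ibox_def\<close>)
    then show "chi (g_smult t) = 1"
      using xi_smult[OF t0 A(1)] A(2) by simp
    have "map_prod (dilate i (inverse t)) (dilate i t) ` A = A"
      by (rule image[of _ "dilate i t" _ "dilate i (inverse t)"])
        (use dilate[OF t] dilate[OF inv[OF t]] t0 in \<open>auto\<close>)
    then show "chi (g_dilate i t) = 1"
      using xi_dilate[OF t0 A(1), of i] A(2) by simp
  qed
  then show ?thesis
    by (intro exI[of _ k]) (auto simp: k_def)
qed

end

theorem theorem4p1:
  fixes chi :: "'f::nonarch_local_field \<times> ('f ^ 'n ^ 'n) \<times> 'f \<Rightarrow> complex"
  assumes "is_character chi"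
  shows "dim_at_most (equivariant_functionals chi) 1"
proof -
  let ?D = "equivariant_functionals chi"
  have "chi \<in> carrier act_group \<rightarrow> carrier units_group"
    using assms by (simp add: is_character_def hom_def)
  then have chi: "\<forall>g\<in>carrier act_group. chi g \<noteq> 0"
    by (auto simp: units_group_def Pi_iff)
  have closed: "closed A" if "compact_open A" for A :: "(('f ^ 'n) \<times> ('f ^ 'n)) set"
    by (rule pair_ultra.co_closed[OF that])
  have zeroI: "\<xi> = (\<lambda>_. 0)" if "\<xi> \<in> ?D" "\<And>A. compact_open A \<Longrightarrow> \<xi> (indic A) = 0" for \<xi>
  proof (rule functional_zero)
    show "\<xi> \<in> functionals"
      using that(1) by (simp add: equivariant_functionals_def)
  qed (use closed that(2) in auto)
  \<comment> \<open>A spanning set with at most one element yields both finite-dimensionality and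
    the bound on \<open>cfun.dim\<close>.\<close>
  have "\<exists>B. finite B \<and> card B \<le> 1 \<and> B \<subseteq> ?D \<and> ?D \<subseteq> cfun.span B"
  proof (cases "\<exists>\<xi>\<in>?D. \<exists>A. compact_open A \<and> \<xi> (indic A) \<noteq> 0")
    case False
    then have "?D \<subseteq> {0}"
      using zeroI by (fastforce simp: zero_fun_def)
    then show ?thesis
      by (intro exI[of _ "{}"]) simp
  next
    case True
    then obtain \<xi> A where \<xi>: "\<xi> \<in> ?D" "compact_open A" "\<xi> (indic A) \<noteq> 0"
      by blast
    define i :: 'n where "i = undefined"
    \<comment> \<open>\<open>k\<close> comes from the single functional \<open>\<xi>\<close> but
      concerns \<open>chi\<close> alone, so it, and therefore \<open>A0\<close>, serves every other
      \<open>\<zeta>\<close> as well.\<close>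
    obtain k where k: "1 \<le> k" "\<And>t i. t - 1 \<in> ideal_pow k \<Longrightarrow> chi (g_smult t) = 1 \<and> chi (g_dilate i t) = 1"
      using chi_smooth[OF \<xi>] by blast
    have pd: "pair_dist (\<lambda>A. \<zeta> (indic A)) (\<lambda>t. chi (g_smult t)) (\<lambda>t. chi (g_dilate i t)) k" if \<zeta>: "\<zeta> \<in> ?D" for \<zeta>
    proof
      show "fin_additive (\<lambda>A. \<zeta> (indic A))"
        by (rule xi_additive[OF \<zeta>])
      show "1 \<le> k"
        by (rule k(1))
      show "\<zeta> (indic (map_prod (dilate j (inverse t)) (dilate j t) ` A)) = chi (g_dilate i t) * \<zeta> (indic A)"
        if "t \<noteq> 0" "compact_open A" for t j A
        using xi_dilate[OF \<zeta> that, of j] chi_dilate_eq[OF \<xi>(1) chi \<xi>(2,3) that(1), of i j] by simp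
      show "\<zeta> (indic (map_prod (shear j a (- w)) (shear a j w) ` A)) = \<zeta> (indic A)"
        if "a \<noteq> j" "compact_open A" for a j w A
        using xi_shear[OF \<zeta> that, of w] chi_shear[OF \<xi>(1) chi \<xi>(2,3) that(1), of w] by simp
    qed (use k(2) xi_smult[OF \<zeta>] in auto)
    obtain A0 where A0: "compact_open A0" "\<And>m. pair_dist m (\<lambda>t. chi (g_smult t)) (\<lambda>t. chi (g_dilate i t)) k \<Longrightarrow>
        m A0 = 0 \<Longrightarrow> (\<forall>A :: (('f ^ 'n) \<times> ('f ^ 'n)) set. compact_open A \<longrightarrow> m A = 0)"
      using pair_dist_determined[of "\<lambda>t. chi (g_smult t)" "\<lambda>t. chi (g_dilate i t)" k] by blast
    have zero: "\<zeta> = (\<lambda>_. 0)" if "\<zeta> \<in> ?D" "\<zeta> (indic A0) = 0" for \<zeta>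
      using zeroI[OF that(1)] A0(2)[OF pd[OF that(1)] that(2)] by blast
    have nz: "\<xi> (indic A0) \<noteq> 0"
      using zero[OF \<xi>(1)] \<xi>(3) by force
    have "\<zeta> \<in> cfun.span {\<xi>}" if \<zeta>: "\<zeta> \<in> ?D" for \<zeta>
    proof -
      \<comment> \<open>The multiple of \<open>\<xi>\<close> that agrees with \<open>\<zeta>\<close>
        at \<open>A0\<close>; the difference vanishes there and hence everywhere.\<close>
      define c where "c = \<zeta> (indic A0) / \<xi> (indic A0)"
      have "\<zeta> - cscale c \<xi> \<in> ?D"
        by (intro cfun.subspace_diff[OF subspace_equivariant_functionals] \<zeta>
            cfun.subspace_scale[OF subspace_equivariant_functionals] \<xi>(1))
      moreover have "(\<zeta> - cscale c \<xi>) (indic A0) = 0"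
        using nz by (simp add: c_def cscale_def)
      ultimately have "\<zeta> - cscale c \<xi> = (\<lambda>_. 0)"
        by (rule zero)
      then have "\<zeta> = cscale c \<xi>"
        by (simp add: fun_eq_iff)
      then show ?thesis
        by (simp add: cfun.span_base cfun.span_scale)
    qed
    then show ?thesis
      using \<xi>(1) by (intro exI[of _ "{\<xi>}"]) auto
  qed
  then obtain B where B: "finite B" "card B \<le> 1" "B \<subseteq> ?D" "?D \<subseteq> cfun.span B"
    by blast
  have "cfun.dim ?D \<le> card B"
    by (rule cfun.dim_le_card[OF B(4,1)])
  then show ?thesis
    using B unfolding dim_at_most_def by auto
qed

end
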